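(* Let $n\ge 1$ be an integer, let $p>0$ and $q>0$, and let $u,v:\mathbf{R}^n\to[0,\infty)$ be Lebesgue measurable functions satisfying $$u(x)=\int_{\mathbf{R}^n}|x-y|^p\,v(y)^{-q}\,dy,\qquad v(x)=\int_{\mathbf{R}^n}|x-y|^p\,u(y)^{-q}\,dy$$ for all $x\in\mathbf{R}^n$. Then $q=1+\frac{2n}{p}$ and there exist constants $a,b>0$ and a point $\overline{x}\in\mathbf{R}^n$ such that $$u(x)=v(x)=a\left(b^2+|x-\overline{x}|^2\right)^{p/2}\qquad\text{for all }x\in\mathbf{R}^n.$$
   Context: The functions $u,v$ are finite-valued; in the integrals, $0^{-q}=+\infty$. *)

theory Defs
  imports "HOL-Analysis.Analysis"
begin

text \<open>
  The power \<open>t\<close> to the \<open>-q\<close> as an extended nonnegative real, with value \<open>\<infinity>\<close> at \<open>t = 0\<close>; the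
  real-valued \<^const>\<open>powr\<close> would give the value \<open>0\<close> there.
\<close>

definition neg_power :: "real \<Rightarrow> real \<Rightarrow> ennreal" where
  "neg_power t q = (if t = 0 then \<infinity> else ennreal (t powr (- q)))"

end

theory Submission
  imports Defs
begin

text \<open>
Write \<open>n\<close> for the dimension. The exponent is found first; the shape of the solutions depends on it.

The exponent comes from a Pohozaev identity that needs no derivative of the solutions. Put
\<open>A(t) = \<integral> u(t x) u(x)\<^sup>-\<^sup>q dx\<close>, and \<open>B(t)\<close> for the same pairing built from \<open>v\<close>. Convexity of
\<open>s \<mapsto> s\<^sup>1\<^sup>-\<^sup>q\<close> bounds \<open>A(t)\<close> below by an explicit function \<open>L(t)\<close>, with equality at \<open>t = 1\<close>; Fubini gives
\<open>A(t) = t\<^sup>p B(1/t)\<close>, so \<open>t\<^sup>p L(1/t)\<close> is a second lower bound that is attained at \<open>t = 1\<close>. Unless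
\<open>q = 1 + 2n/p\<close>, the two bounds have different slopes at \<open>1\<close>; but \<open>A\<close> is differentiable there and can
touch both only if the slopes agree (\<open>critical_exponent\<close>). The work lies in the differentiability: for
\<open>p < 1\<close> it requires the integrability of \<open>\<bar>x\<bar> \<bar>x - y\<bar>\<^sup>p\<^sup>-\<^sup>1\<close> against both weights.

At this exponent the Jacobian of the inversion \<open>z \<mapsto> z\<^sup>* = r\<^sup>2 z / \<bar>z\<bar>\<^sup>2\<close> is absorbed by the Kelvin transform
\<open>u\<^sub>r(z) = (\<bar>z\<bar>/r)\<^sup>p u(z\<^sup>*)\<close>, and folding the ball onto its exterior gives, for a kernel \<open>K\<close> that is
larger than \<open>\<bar>x - z\<bar>\<^sup>p\<close> outside the sphere,
\<open>u\<^sub>r(x) - u(x) = \<integral>\<^bsub>\<bar>z\<bar>>r\<^esub> (K(x,z) - \<bar>x - z\<bar>\<^sup>p) (v(z)\<^sup>-\<^sup>q - v\<^sub>r(z)\<^sup>-\<^sup>q) dz\<close> (\<open>kelvin_difference\<close>).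
The method of moving spheres now applies: consider the radii \<open>r\<close> for which \<open>u \<le> u\<^sub>r\<close> and \<open>v \<le> v\<^sub>r\<close> outside the
sphere. Small radii qualify (\<open>kelvin_above_small\<close>), and large ones do not because \<open>u\<close> grows like
\<open>\<bar>x\<bar>\<^sup>p\<close> (\<open>mass_le_of_dominates\<close>). At the largest such radius either both inequalities are equalities, or both are
strict everywhere, in which case slightly larger radii would qualify too (\<open>dominates_open_right\<close>). So
\<open>u = u\<^sub>r\<close> and \<open>v = v\<^sub>r\<close> for this radius (\<open>kelvin_invariance\<close>). Small and slightly larger radii are both handled
by one contraction estimate: where the inequality fails, the supremum of the failure is at most a
multiple of itself, with a factor that is small with the measure of the failure set (\<open>narrow_region\<close>).

The centre of the spheres is arbitrary. The invariance about \<open>x\<close> carries the behaviour of \<open>u\<close> at infinity,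
which is explicit, to a neighbourhood of \<open>x\<close>. This shows that \<open>(u/\<alpha>)\<^sup>2\<^sup>/\<^sup>p\<close>, where \<open>\<alpha> = \<integral> v\<^sup>-\<^sup>q\<close>, has
the derivative \<open>2 (x - c)\<close> at every \<open>x\<close>, where \<open>c\<close> is the barycenter of the weight \<open>v\<^sup>-\<^sup>q\<close>; hence it is
\<open>\<bar>x - c\<bar>\<^sup>2 + b\<^sup>2\<close> (\<open>classification\<close>).
\<close>

section \<open>Inequalities for real powers\<close>

lemma powr_add_le_two_powr:
  fixes a b p :: real
  assumes "a \<ge> 0" "b \<ge> 0" "p > 0"
  shows "(a + b) powr p \<le> 2 powr p * (a powr p + b powr p)"
proof -
  have "(a + b) powr p \<le> (2 * max a b) powr p"
    using assms by (intro powr_mono2) auto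
  also have "\<dots> = 2 powr p * (max a b) powr p"
    using assms by (simp add: powr_mult)
  also have "\<dots> \<le> 2 powr p * (a powr p + b powr p)"
    by (intro mult_left_mono) (auto simp: max_def)
  finally show ?thesis .
qed

text \<open>By homogeneity this is the inequality \<open>\<bar>s\<^sup>p - 1\<bar> \<le> \<bar>s - 1\<bar>\<close>. Unlike the mean value theorem it gives a bound
in terms of \<open>b\<close> alone, even if \<open>a\<close> is much smaller than \<open>b\<close>.\<close>
lemma abs_diff_powr_le_concave:
  fixes a b p :: real
  assumes p: "0 < p" "p \<le> 1" and "a \<ge> 0" "b > 0"
  shows "\<bar>a powr p - b powr p\<bar> \<le> \<bar>a - b\<bar> * b powr (p - 1)"
proof -
  define s where "s = a / b"
  have s: "s \<ge> 0" "a = s * b" using assms by (auto simp: s_def)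
  have *: "\<bar>s powr p - 1\<bar> \<le> \<bar>s - 1\<bar>"
  proof (cases "s \<ge> 1")
    case True
    then have "1 \<le> s powr p" "s powr p \<le> s powr 1"
      using p powr_mono[of p 1 s] by (auto simp: ge_one_powr_ge_zero)
    then show ?thesis using True by simp
  next
    case False
    then have "s \<le> s powr p" "s powr p \<le> 1"
      using p s powr_mono'[of p 1 s] by (auto simp: powr_le1)
    then show ?thesis using False by simp
  qed
  have bp: "b powr p = b * b powr (p - 1)" using \<open>b > 0\<close> by (simp add: powr_diff)
  have "a powr p - b powr p = b powr p * (s powr p - 1)"
    using s assms by (simp add: powr_mult algebra_simps)
  then have "\<bar>a powr p - b powr p\<bar> = b powr p * \<bar>s powr p - 1\<bar>"
    by (simp add: abs_mult)
  also have "\<dots> \<le> b powr p * \<bar>s - 1\<bar>" using * by (intro mult_left_mono) auto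
  also have "\<dots> = \<bar>b * (s - 1)\<bar> * b powr (p - 1)" using \<open>b > 0\<close> by (simp add: bp abs_mult)
  also have "b * (s - 1) = a - b" using s by (simp add: algebra_simps)
  finally show ?thesis .
qed

lemma abs_diff_powr_le_convex:
  fixes a b c p :: real
  assumes p: "p \<ge> 1" and a: "0 \<le> a" "a \<le> c" and b: "0 \<le> b" "b \<le> c"
  shows "\<bar>a powr p - b powr p\<bar> \<le> p * c powr (p - 1) * \<bar>a - b\<bar>"
proof -
  have main: "y powr p - x powr p \<le> p * c powr (p - 1) * (y - x)"
    if x: "0 \<le> x" "x < y" "y \<le> c" for x y
  proof -
    have "continuous_on {x..y} (\<lambda>t. t powr p)"
      using p x by (intro continuous_on_powr' continuous_intros) auto
    moreover have D: "((\<lambda>t. t powr p) has_real_derivative p * t powr (p - 1)) (at t)" if "x < t" "t < y" for t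
      using that x by (auto intro!: derivative_eq_intros)
    ultimately obtain l z where z: "x < z" "z < y" "((\<lambda>t. t powr p) has_real_derivative l) (at z)"
      "y powr p - x powr p = (y - x) * l"
      using MVT[of x y "\<lambda>t. t powr p"] x(2) by (auto simp: real_differentiable_def)
    then have l: "l = p * z powr (p - 1)" using DERIV_unique[OF z(3) D] by simp
    have "z powr (p - 1) \<le> c powr (p - 1)" using z x p by (intro powr_mono2) auto
    then have "(y - x) * (p * z powr (p - 1)) \<le> (y - x) * (p * c powr (p - 1))"
      using x p by (intro mult_left_mono) auto
    then show ?thesis using z l by (simp add: mult_ac)
  qed
  show ?thesis
  proof (cases a b rule: linorder_cases)
    case less
    then show ?thesis using main[of a b] a b p powr_mono2[of p a b] by simp
  next
    case greater
    then show ?thesis using main[of b a] a b p powr_mono2[of p b a] by simp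
  qed simp
qed

text \<open>Negative powers are Lipschitz away from zero; only the positive part of \<open>t - s\<close> matters, by monotonicity.\<close>
lemma neg_powr_diff_le:
  fixes s t m q :: real
  assumes q: "q > 0" and m: "0 < m" "m \<le> s" "m \<le> t"
  shows "s powr (-q) - t powr (-q) \<le> q * m powr (-q - 1) * max 0 (t - s)"
proof (cases "s < t")
  case True
  have "((\<lambda>t. t powr (-q)) has_real_derivative (-q) * x powr (-q - 1)) (at x)" if "s \<le> x" "x \<le> t" for x
    using that m by (auto intro!: derivative_eq_intros)
  then obtain z where z: "s < z" "z < t" "t powr (-q) - s powr (-q) = (t - s) * ((-q) * z powr (-q - 1))"
    using MVT2[of s t "\<lambda>t. t powr (-q)" "\<lambda>x. (-q) * x powr (-q - 1)"] True by blast
  have "z powr (-q - 1) \<le> m powr (-q - 1)" using z m q by (intro powr_mono2') auto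
  then have "(t - s) * (q * z powr (-q - 1)) \<le> (t - s) * (q * m powr (-q - 1))"
    using True q by (intro mult_left_mono) auto
  then show ?thesis using z True by (simp add: algebra_simps)
next
  case False
  then have "s powr (-q) \<le> t powr (-q)" using m q by (intro powr_mono2') auto
  moreover have "max 0 (t - s) = 0" using False by simp
  ultimately show ?thesis by simp
qed

text \<open>Cover the punctured ball by the dyadic shells of radii between \<open>r / 2\<^sup>k\<^sup>+\<^sup>1\<close> and \<open>r / 2\<^sup>k\<close>. On each shell the integrand is
comparable to a constant, and the contributions form a geometric series because \<open>a\<close> is below the dimension.\<close>
lemma nn_integral_norm_powr_le:
  fixes a :: real
  assumes a: "0 \<le> a" "a < real DIM('a::euclidean_space)"
  shows "\<exists>C>0. \<forall>r>0. (\<integral>\<^sup>+ z. ennreal (norm z powr (-a)) * indicator {z. norm z \<le> r} z \<partial>(lborel :: 'a measure))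
       \<le> ennreal (C * r powr (real DIM('a) - a))"
proof -
  define n where "n = DIM('a)"
  define \<omega> where "\<omega> = unit_ball_vol (real n)"
  define \<rho> where "\<rho> = (1/2::real) powr (real n - a)"
  have \<rho>: "0 < \<rho>" "\<rho> < 1" using a by (auto simp: \<rho>_def n_def powr_divide gr_one_powr)
  have \<omega>: "\<omega> \<ge> 0" by (simp add: \<omega>_def)
  define C where "C = 2 powr a * \<omega> / (1 - \<rho>) + 1"
  have C: "C > 0" using \<rho> \<omega> by (simp add: C_def add_nonneg_pos)
  have "(\<integral>\<^sup>+ z. ennreal (norm z powr (-a)) * indicator {z. norm z \<le> r} z \<partial>(lborel :: 'a measure))
       \<le> ennreal (C * r powr (real n - a))" if r: "r > 0" for r
  proof -
    define s where "s k = r / 2 ^ k" for k :: nat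
    have s: "s k > 0" for k using r by (simp add: s_def)
    have pt: "ennreal (norm z powr (-a)) * indicator {z. norm z \<le> r} z
        \<le> (\<Sum>k. ennreal (s (Suc k) powr (-a)) * indicator {z. norm z \<le> s k} z)"
      if z: "z \<noteq> 0" for z :: 'a
    proof (cases "norm z \<le> r")
      case True
      have "\<exists>k. s k < norm z"
      proof -
        have "s \<longlonglongrightarrow> 0" unfolding s_def by (rule LIMSEQ_divide_realpow_zero) simp
        then show ?thesis using z order_tendstoD(2)[of s 0 sequentially "norm z"]
          by (auto dest: eventually_happens)
      qed
      define k where "k = (LEAST k. s k < norm z)"
      have k: "s k < norm z" unfolding k_def using \<open>\<exists>k. s k < norm z\<close> by (rule LeastI_ex)
      have "k \<noteq> 0"
      proof
        assume "k = 0" then show False using k True by (simp add: s_def)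
      qed
      then obtain j where j: "k = Suc j" using not0_implies_Suc by blast
      then have "\<not> s j < norm z" using not_less_Least[of j "\<lambda>k. s k < norm z"] by (simp add: k_def)
      then have "ennreal (norm z powr (-a)) * indicator {z. norm z \<le> r} z \<le> ennreal (s (Suc j) powr (-a)) * indicator {z. norm z \<le> s j} z"
        using True k j a s[of "Suc j"] by (auto intro!: ennreal_leI powr_mono2')
      also have "\<dots> \<le> (\<Sum>k. ennreal (s (Suc k) powr (-a)) * indicator {z. norm z \<le> s k} z)"
        using sum_le_suminf[of "\<lambda>k. ennreal (s (Suc k) powr (-a)) * indicator {z. norm z \<le> s k} z" "{j}"]
        by (simp add: summableI del: sum_mult_indicator)
      finally show ?thesis .
    qed (simp add: indicator_def)
    have shell: "s (Suc k) powr (-a) * (\<omega> * s k ^ n) = (2 powr a * \<omega> * r powr (real n - a)) * \<rho> ^ k" for k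
    proof -
      have "s (Suc k) = s k * (1/2)" by (simp add: s_def)
      then have "s (Suc k) powr (-a) = s k powr (-a) * 2 powr a"
        using s[of k] by (simp only: powr_mult) (simp add: powr_divide powr_minus)
      moreover have "s k ^ n = s k powr real n" using s[of k] by (simp add: powr_realpow)
      moreover have "s k powr (real n - a) = s k powr real n * s k powr (-a)"
        by (metis add_uminus_conv_diff powr_add)
      moreover have "s k powr (real n - a) = r powr (real n - a) * \<rho> ^ k"
      proof -
        have "s k = r * (1/2) powr real k" by (simp add: s_def powr_realpow power_divide)
        then have "s k powr (real n - a) = r powr (real n - a) * (1/2) powr (real k * (real n - a))"
          using r by (simp only: powr_mult powr_powr)
        also have "(1/2) powr (real k * (real n - a)) = \<rho> ^ k"
          using \<rho>(1) unfolding \<rho>_def by (simp only: powr_powr mult.commute flip: powr_realpow)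
        finally show ?thesis .
      qed
      ultimately show ?thesis by simp
    qed
    have AEnz: "AE z in (lborel::'a measure). z \<noteq> 0"
      using AE_lborel_singleton[of "0::'a"] by simp
    have "(\<integral>\<^sup>+ z. ennreal (norm z powr (-a)) * indicator {z. norm z \<le> r} z \<partial>(lborel :: 'a measure))
       \<le> (\<integral>\<^sup>+ z. (\<Sum>k. ennreal (s (Suc k) powr (-a)) * indicator {z. norm z \<le> s k} z) \<partial>(lborel :: 'a measure))"
      using AEnz pt by (intro nn_integral_mono_AE) auto
    also have "\<dots> = (\<Sum>k. \<integral>\<^sup>+ z. ennreal (s (Suc k) powr (-a)) * indicator {z. norm z \<le> s k} z \<partial>(lborel :: 'a measure))"
      by (rule nn_integral_suminf) measurable
    also have "\<dots> = (\<Sum>k. ennreal (s (Suc k) powr (-a)) * emeasure lborel {z::'a. norm z \<le> s k})"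
      by (intro suminf_cong nn_integral_cmult_indicator) measurable
    also have "\<dots> = (\<Sum>k. ennreal (s (Suc k) powr (-a) * (\<omega> * s k ^ n)))"
    proof (rule suminf_cong)
      fix k
      have "emeasure lborel {z::'a. norm z \<le> s k} = ennreal (\<omega> * s k ^ n)"
        using emeasure_cball[of "s k" "0::'a"] s[of k] by (simp add: cball_def \<omega>_def n_def)
      then show "ennreal (s (Suc k) powr (-a)) * emeasure lborel {z::'a. norm z \<le> s k}
          = ennreal (s (Suc k) powr (-a) * (\<omega> * s k ^ n))"
        by (simp add: ennreal_mult')
    qed
    also have "\<dots> = (\<Sum>k. ennreal ((2 powr a * \<omega> * r powr (real n - a)) * \<rho> ^ k))"
      by (simp only: shell)
    also have "\<dots> = ennreal ((2 powr a * \<omega> * r powr (real n - a)) * (1 / (1 - \<rho>)))"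
    proof (rule suminf_ennreal_eq)
      show "(\<lambda>k. (2 powr a * \<omega> * r powr (real n - a)) * \<rho> ^ k) sums ((2 powr a * \<omega> * r powr (real n - a)) * (1 / (1 - \<rho>)))"
        using \<rho> by (intro sums_mult geometric_sums) auto
    qed (use \<omega> \<rho> in auto)
    also have "\<dots> \<le> ennreal (C * r powr (real n - a))"
      by (intro ennreal_leI) (simp add: C_def algebra_simps)
    finally show ?thesis .
  qed
  then show ?thesis using C unfolding n_def by blast
qed

section \<open>Inversion in a sphere\<close>

definition inversion :: "real \<Rightarrow> 'a::real_inner \<Rightarrow> 'a" where
  "inversion r z = (r\<^sup>2 / (norm z)\<^sup>2) *\<^sub>R z"

lemma norm_inversion:
  assumes "z \<noteq> 0" shows "norm (inversion r z) = r\<^sup>2 / norm z"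
  using assms by (simp add: inversion_def power2_eq_square)

lemma inversion_eq_0_iff [simp]:
  assumes "r > 0" shows "inversion r z = 0 \<longleftrightarrow> z = 0"
  using assms by (simp add: inversion_def)

lemma inversion_involution:
  assumes "r > 0" shows "inversion r (inversion r z) = z"
proof (cases "z = 0")
  case False
  then show ?thesis using assms
    by (subst inversion_def)
       (simp add: norm_inversion, simp add: inversion_def power2_eq_square)
qed (use assms in auto)

lemma inversion_measurable [measurable]:
  "(inversion r :: 'a::euclidean_space \<Rightarrow> 'a) \<in> borel_measurable borel"
  unfolding inversion_def[abs_def] by measurable

lemma inversion_derivative:
  fixes z :: "'a::euclidean_space"
  assumes "z \<noteq> 0"
  shows "(inversion r has_derivative
    (\<lambda>h. (r\<^sup>2 / (norm z)\<^sup>2) *\<^sub>R (h - (2 * (z \<bullet> h) / (norm z)\<^sup>2) *\<^sub>R z))) (at z within S)"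
proof -
  have nz: "z \<bullet> z \<noteq> 0" using assms by simp
  have "((\<lambda>z. (r\<^sup>2 / (z \<bullet> z)) *\<^sub>R z) has_derivative
      (\<lambda>h. (r\<^sup>2 / (z \<bullet> z)) *\<^sub>R h + (- (r\<^sup>2 * (2 * (z \<bullet> h))) / ((z \<bullet> z) * (z \<bullet> z))) *\<^sub>R z)) (at z within S)"
    using nz by (auto intro!: derivative_eq_intros simp: fun_eq_iff inner_commute field_simps)
  also have "(\<lambda>h. (r\<^sup>2 / (z \<bullet> z)) *\<^sub>R h + (- (r\<^sup>2 * (2 * (z \<bullet> h))) / ((z \<bullet> z) * (z \<bullet> z))) *\<^sub>R z)
      = (\<lambda>h. (r\<^sup>2 / (norm z)\<^sup>2) *\<^sub>R (h - (2 * (z \<bullet> h) / (norm z)\<^sup>2) *\<^sub>R z))"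
    by (simp add: fun_eq_iff power2_norm_eq_inner scaleR_diff_right)
  finally show ?thesis by (simp add: inversion_def[abs_def] power2_norm_eq_inner)
qed

lemma hyperplane_reflection_orthogonal:
  fixes z :: "'a::euclidean_space"
  assumes "z \<noteq> 0"
  shows "orthogonal_transformation (\<lambda>h. h - (2 * (z \<bullet> h) / (norm z)\<^sup>2) *\<^sub>R z)"
  unfolding orthogonal_transformation_def
proof safe
  show "linear (\<lambda>h. h - (2 * (z \<bullet> h) / (norm z)\<^sup>2) *\<^sub>R z)"
    by (rule linearI) (simp_all add: algebra_simps add_divide_distrib inner_add_right)
  fix v w
  have "z \<bullet> z \<noteq> 0" using assms by simp
  then show "(v - (2 * (z \<bullet> v) / (norm z)\<^sup>2) *\<^sub>R z) \<bullet> (w - (2 * (z \<bullet> w) / (norm z)\<^sup>2) *\<^sub>R z) = v \<bullet> w"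
    by (simp add: power2_norm_eq_inner inner_diff_left inner_diff_right inner_commute field_simps)
qed

text \<open>The derivative of an inversion is a scalar multiple of the reflection in the hyperplane orthogonal to \<open>z\<close>.\<close>
lemma abs_det_inversion_derivative:
  fixes z :: "real ^ 'n"
  assumes "z \<noteq> 0"
  shows "\<bar>det (matrix (\<lambda>h. (r\<^sup>2 / (norm z)\<^sup>2) *\<^sub>R (h - (2 * (z \<bullet> h) / (norm z)\<^sup>2) *\<^sub>R z)))\<bar>
    = (r / norm z) ^ (2 * CARD('n))"
proof -
  let ?R = "\<lambda>h. h - (2 * (z \<bullet> h) / (norm z)\<^sup>2) *\<^sub>R z"
  have R: "orthogonal_transformation ?R" by (rule hyperplane_reflection_orthogonal[OF assms])
  have "matrix ((*\<^sub>R) (r\<^sup>2 / (norm z)\<^sup>2) \<circ> ?R)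
      = matrix ((*\<^sub>R) (r\<^sup>2 / (norm z)\<^sup>2)) ** matrix ?R"
    by (rule matrix_compose) (use R in \<open>auto simp: orthogonal_transformation_def linear_linear intro: bounded_linear.linear\<close>)
  then have "det (matrix ((*\<^sub>R) (r\<^sup>2 / (norm z)\<^sup>2) \<circ> ?R)) = (r\<^sup>2 / (norm z)\<^sup>2) ^ CARD('n) * det (matrix ?R)"
    by (simp add: det_mul)
  then show ?thesis
    using orthogonal_transformation_det[OF R]
    by (simp add: o_def abs_mult power_abs power_mult power_divide power_even_abs flip: power_mult)
qed

lemma emeasure_inversion_wellorder:
  fixes B :: "(real ^ 'n::{finite,wellorder}) set"
  assumes r: "r > 0" and B: "B \<in> sets borel" "B \<subseteq> ball 0 r - {0}"
  shows "emeasure lborel B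
    = (\<integral>\<^sup>+ z. ennreal ((r / norm z) ^ (2 * CARD('n))) * indicator {z. z \<noteq> 0 \<and> inversion r z \<in> B} z \<partial>lborel)"
proof -
  define S where "S = {z. z \<noteq> 0 \<and> inversion r z \<in> B}"
  have S[measurable]: "S \<in> sets borel" unfolding S_def using B(1) by measurable
  have img: "inversion r ` S = B"
  proof safe
    fix y assume "y \<in> B"
    then show "y \<in> inversion r ` S" using B r
      by (intro image_eqI[of _ _ "inversion r y"]) (auto simp: S_def inversion_involution)
  qed (auto simp: S_def)
  have bnd: "bounded B" using B(2) bounded_subset[OF bounded_ball] by blast
  then have lm: "B \<in> lmeasurable"
    using B(1) by (intro bounded_set_imp_lmeasurable) auto
  have inj: "inj_on (inversion r) S"
    by (metis inj_onI r inversion_involution)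
  have "((\<lambda>z. \<bar>det (matrix (\<lambda>h. (r\<^sup>2 / (norm z)\<^sup>2) *\<^sub>R (h - (2 * (z \<bullet> h) / (norm z)\<^sup>2) *\<^sub>R z)))\<bar>)
       has_integral measure lebesgue B) S"
    by (subst has_measure_differentiable_image[symmetric, where f="inversion r"])
       (auto simp: img lm inj S_def[symmetric] intro!: inversion_derivative, auto simp: S_def)
  then have "((\<lambda>z. (r / norm z) ^ (2 * CARD('n))) has_integral measure lebesgue B) S"
    by (rule has_integral_eq[rotated]) (auto simp: S_def abs_det_inversion_derivative)
  from nn_integral_has_integral_lebesgue'[OF _ this] r
  have "(\<integral>\<^sup>+ z. ennreal ((r / norm z) ^ (2 * CARD('n))) * indicator S z \<partial>lborel) = measure lebesgue B"
    by simp
  also have "\<dots> = emeasure lborel B"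
    using emeasure_bounded_finite[OF bnd] B(1) emeasure_eq_ennreal_measure[of lborel B] by simp
  finally show ?thesis by (simp add: S_def)
qed

section \<open>Change of variables under inversion\<close>

text \<open>The change of variables theorem for \<open>real ^ 'n\<close> concerns well-ordered index types. A copy of the finite
type \<open>'n\<close>, ordered along an enumeration, transfers it to an arbitrary finite index type.\<close>
typedef 'a well_ordered = "UNIV :: 'a set" by auto

instance well_ordered :: (finite) finite
proof
  have "(UNIV :: 'a well_ordered set) = range Abs_well_ordered"
    by (metis Abs_well_ordered_cases surjI UNIV_I Rep_well_ordered_inverse)
  then show "finite (UNIV :: 'a well_ordered set)" by (metis finite finite_imageI)
qed

instantiation well_ordered :: (finite) wellorder
begin

definition less_eq_well_ordered :: "'a well_ordered \<Rightarrow> 'a well_ordered \<Rightarrow> bool" where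
  "x \<le> y \<longleftrightarrow> to_nat (Rep_well_ordered x) \<le> to_nat (Rep_well_ordered y)"

definition less_well_ordered :: "'a well_ordered \<Rightarrow> 'a well_ordered \<Rightarrow> bool" where
  "x < y \<longleftrightarrow> to_nat (Rep_well_ordered x) < to_nat (Rep_well_ordered y)"

instance
proof
  fix P :: "'a well_ordered \<Rightarrow> bool" and a :: "'a well_ordered"
  assume *: "\<And>x. (\<And>y. y < x \<Longrightarrow> P y) \<Longrightarrow> P x"
  show "P a"
  proof (induction a rule: measure_induct_rule[of "\<lambda>x. to_nat (Rep_well_ordered x)"])
    case (less x)
    show ?case by (rule *, rule less) (simp add: less_well_ordered_def)
  qed
qed (auto simp: less_eq_well_ordered_def less_well_ordered_def Rep_well_ordered_inject)

end

lemma bij_Rep_well_ordered: "bij Rep_well_ordered"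
  by (metis Abs_well_ordered_inverse Rep_well_ordered_inverse UNIV_I bij_betw_byWitness bijI' )

definition reindex :: "real ^ 'n::finite \<Rightarrow> real ^ 'n well_ordered" where
  "reindex x = (\<chi> i. x $ Rep_well_ordered i)"

lemma inner_reindex: "reindex x \<bullet> reindex y = x \<bullet> y"
  unfolding inner_vec_def reindex_def
  by (simp add: sum.reindex_bij_betw[OF bij_Rep_well_ordered, of "\<lambda>i. x $ i * y $ i"])

lemma norm_reindex [simp]: "norm (reindex x) = norm x"
  by (simp add: norm_eq_sqrt_inner inner_reindex)

lemma reindex_scaleR: "reindex (c *\<^sub>R x) = c *\<^sub>R reindex x"
  by (simp add: reindex_def vec_eq_iff)

lemma reindex_eq_0_iff [simp]: "reindex x = 0 \<longleftrightarrow> x = 0"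
  by (metis norm_reindex norm_eq_zero)

lemma reindex_inversion: "reindex (inversion r x) = inversion r (reindex x)"
  by (simp add: inversion_def reindex_scaleR)

lemma reindex_measurable [measurable]: "reindex \<in> borel_measurable borel"
  unfolding reindex_def[abs_def]
  by (intro borel_measurable_continuous_onI continuous_on_vec_lambda continuous_on_component continuous_on_id)

lemma reindex_surj: "\<exists>x. reindex x = y"
  by (rule exI[of _ "\<chi> i. y $ Abs_well_ordered i"])
     (simp add: reindex_def vec_eq_iff Rep_well_ordered_inverse)

lemma bij_reindex: "bij (reindex :: real ^ 'n \<Rightarrow> _)"
proof (rule bijI')
  fix x y :: "real ^ 'n"
  have "reindex x = reindex y \<Longrightarrow> x $ i = y $ i" for i
    by (metis Abs_well_ordered_inverse UNIV_I reindex_def vec_lambda_beta)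
  then show "(reindex x = reindex y) = (x = y)" by (metis vec_eq_iff)
qed (metis reindex_surj)

lemma card_well_ordered [simp]: "CARD('n well_ordered) = CARD('n)"
  by (rule bij_betw_same_card[OF bij_Rep_well_ordered])

text \<open>The two measures agree on boxes, since reindexing permutes the factors of the volume.\<close>
lemma distr_reindex: "distr lborel borel reindex = (lborel :: (real ^ 'n::finite well_ordered) measure)"
proof (rule lborel_eqI[symmetric])
  fix l u :: "real ^ 'n well_ordered" assume *: "\<And>b. b \<in> Basis \<Longrightarrow> l \<bullet> b \<le> u \<bullet> b"
  from reindex_surj[of l] reindex_surj[of u]
  obtain l' u' where lu: "l = reindex l'" "u = reindex u'" by blast
  have le: "l' $ i \<le> u' $ i" for i
    using *[of "axis (Abs_well_ordered i) 1"]
    by (simp add: lu inner_axis reindex_def Abs_well_ordered_inverse axis_in_Basis_iff)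
  have "reindex -` box l u = box l' u'"
    by (auto simp: lu mem_box_cart reindex_def Abs_well_ordered_inverse)
       (metis Abs_well_ordered_inverse UNIV_I)+
  then have "emeasure (distr lborel borel reindex) (box l u) = emeasure lborel (box l' u')"
    by (subst emeasure_distr) auto
  also have "\<dots> = (\<Prod>b\<in>Basis. (u' - l') \<bullet> b)"
    using le by (intro emeasure_lborel_box) (auto simp: Basis_vec_def inner_axis)
  also have "(\<Prod>b\<in>Basis. (u' - l') \<bullet> b) = (\<Prod>i\<in>UNIV. u' $ i - l' $ i)"
    by (simp add: Basis_vec_def cart_eq_inner_axis axis_eq_axis prod.UNION_disjoint inner_diff_left)
  also have "\<dots> = (\<Prod>i\<in>UNIV. u $ i - l $ i)"
    by (simp add: lu reindex_def prod.reindex_bij_betw[OF bij_Rep_well_ordered, of "\<lambda>i. u' $ i - l' $ i"])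
  also have "\<dots> = (\<Prod>b\<in>Basis. (u - l) \<bullet> b)"
    by (simp add: Basis_vec_def cart_eq_inner_axis axis_eq_axis prod.UNION_disjoint inner_diff_left)
  finally show "emeasure (distr lborel borel reindex) (box l u) = (\<Prod>b\<in>Basis. (u - l) \<bullet> b)" .
qed simp

lemma emeasure_inversion:
  fixes B :: "(real ^ 'n) set"
  assumes r: "r > 0" and B: "B \<in> sets borel" "B \<subseteq> ball 0 r - {0}"
  shows "emeasure lborel B
    = (\<integral>\<^sup>+ z. ennreal ((r / norm z) ^ (2 * CARD('n))) * indicator {z. z \<noteq> 0 \<and> inversion r z \<in> B} z \<partial>lborel)"
proof -
  define B' where "B' = {y. inv reindex y \<in> B}"
  have inv_meas: "inv (reindex :: real ^ 'n \<Rightarrow> _) \<in> borel_measurable borel"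
  proof -
    have "inv (reindex :: real ^ 'n \<Rightarrow> _) = (\<lambda>y. \<chi> i. y $ Abs_well_ordered i)"
      by (rule inv_equality)
         (simp_all add: reindex_def vec_eq_iff Rep_well_ordered_inverse Abs_well_ordered_inverse)
    also have "\<dots> \<in> borel_measurable borel"
      by (intro borel_measurable_continuous_onI continuous_on_vec_lambda continuous_on_component continuous_on_id)
    finally show ?thesis .
  qed
  have B': "B' \<in> sets borel" unfolding B'_def using inv_meas B(1) by measurable
  have mem: "reindex x \<in> B' \<longleftrightarrow> x \<in> B" for x
    by (simp add: B'_def inv_f_f[OF bij_is_inj[OF bij_reindex]])
  have sub: "B' \<subseteq> ball 0 r - {0}"
  proof
    fix y assume "y \<in> B'"
    moreover obtain x where "y = reindex x" by (metis reindex_surj)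
    ultimately show "y \<in> ball 0 r - {0}" using B(2) mem by auto
  qed
  have "emeasure lborel B = emeasure (distr lborel borel reindex) B'"
    using B' by (subst emeasure_distr) (auto simp: mem intro!: arg_cong[of _ _ "emeasure lborel"])
  also have "\<dots> = (\<integral>\<^sup>+ z. ennreal ((r / norm z) ^ (2 * CARD('n))) * indicator {z. z \<noteq> 0 \<and> inversion r z \<in> B'} z \<partial>distr lborel borel reindex)"
    unfolding distr_reindex using emeasure_inversion_wellorder[OF r B' sub] by simp
  also have "\<dots> = (\<integral>\<^sup>+ z. ennreal ((r / norm z) ^ (2 * CARD('n))) * indicator {z. z \<noteq> 0 \<and> inversion r z \<in> B'} (reindex z) \<partial>(lborel :: (real^'n) measure))"
    using B' by (subst nn_integral_distr) auto
  finally show ?thesis by (simp add: indicator_def mem flip: reindex_inversion)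
qed

text \<open>The exterior of the sphere, weighted with the Jacobian, is folded onto the ball; the centre of the ball is
missed, but it is a null set.\<close>
lemma distr_inversion:
  assumes r: "r > 0"
  shows "distr (density lborel (\<lambda>z. ennreal ((r / norm z) ^ (2 * CARD('n))) * indicator {z. r < norm z} z)) borel (inversion r)
       = density lborel (\<lambda>y :: real ^ 'n. indicator {y. norm y < r} y)" (is "distr (density _ ?J) _ _ = ?R")
proof (rule measure_eqI)
  fix A assume "A \<in> sets (distr (density lborel ?J) borel (inversion r))"
  then have A[measurable]: "A \<in> sets borel" by (simp only: sets_distr)
  have vim: "inversion r -` A \<in> sets lborel"
    using measurable_sets[OF inversion_measurable A, of r] by simp
  have "emeasure ?R A = (\<integral>\<^sup>+ y. indicator {y. norm y < r} y * indicator A y \<partial>(lborel :: (real ^ 'n) measure))"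
    by (rule emeasure_density) measurable
  also have "\<dots> = (\<integral>\<^sup>+ y. indicator (A \<inter> {y. norm y < r}) y \<partial>(lborel :: (real ^ 'n) measure))"
    by (rule nn_integral_cong) (simp split: split_indicator)
  also have "\<dots> = emeasure lborel (A \<inter> {y. norm y < r})" by (rule nn_integral_indicator) measurable
  also have "\<dots> = emeasure lborel (A \<inter> {y. norm y < r} - {0})"
    by (rule emeasure_eq_AE) (use AE_lborel_singleton[of "0 :: real ^ 'n"] in auto)
  also have "\<dots> = (\<integral>\<^sup>+ z. ennreal ((r / norm z) ^ (2 * CARD('n)))
      * indicator {z. z \<noteq> 0 \<and> inversion r z \<in> A \<inter> {y. norm y < r} - {0}} z \<partial>lborel)"
    by (rule emeasure_inversion[OF r]) auto
  also have "\<dots> = (\<integral>\<^sup>+ z. ?J z * indicator (inversion r -` A) z \<partial>lborel)"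
  proof (rule nn_integral_cong)
    fix z :: "real ^ 'n"
    have "r\<^sup>2 / norm z < r \<longleftrightarrow> r < norm z" if "z \<noteq> 0"
      using that r by (simp add: divide_simps power2_eq_square)
    then show "ennreal ((r / norm z) ^ (2 * CARD('n)))
        * indicator {z. z \<noteq> 0 \<and> inversion r z \<in> A \<inter> {y. norm y < r} - {0}} z
      = ?J z * indicator (inversion r -` A) z"
      using r by (cases "z = 0") (auto simp: indicator_def norm_inversion)
  qed
  also have "\<dots> = emeasure (density lborel ?J) (inversion r -` A)"
  proof (rule emeasure_density[symmetric])
    show "?J \<in> borel_measurable lborel" by measurable
  qed (rule vim)
  also have "\<dots> = emeasure (distr (density lborel ?J) borel (inversion r)) A"
    using measurable_sets[OF inversion_measurable A, of r] by (subst emeasure_distr) auto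
  finally show "emeasure (distr (density lborel ?J) borel (inversion r)) A = emeasure ?R A" ..
qed (simp only: sets_distr sets_density sets_lborel)

text \<open>The equivalence is used in both directions: to fold the ball outwards, and to reduce integrability at infinity to
integrability at the centre.\<close>
lemma integral_inversion:
  fixes h :: "real ^ 'n \<Rightarrow> real"
  assumes r: "r > 0" and h[measurable]: "h \<in> borel_measurable borel"
  shows "integrable lborel (\<lambda>y. indicator {y. norm y < r} y * h y) \<longleftrightarrow>
      integrable lborel (\<lambda>z. indicator {z. r < norm z} z * ((r / norm z) ^ (2 * CARD('n)) * h (inversion r z)))"
      (is "?I1 \<longleftrightarrow> ?I2")
    and "(\<integral>y. indicator {y. norm y < r} y * h y \<partial>lborel) =
      (\<integral>z. indicator {z. r < norm z} z * ((r / norm z) ^ (2 * CARD('n)) * h (inversion r z)) \<partial>lborel)"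
      (is "?L = ?R")
proof -
  let ?w = "\<lambda>z :: real ^ 'n. indicator {z. r < norm z} z * (r / norm z) ^ (2 * CARD('n))"
  let ?b = "\<lambda>y :: real ^ 'n. indicator {y. norm y < r} y :: real"
  let ?M = "density lborel (\<lambda>z. ennreal (?w z))"
  have w0: "?w z \<ge> 0" for z using r by (auto simp: indicator_def)
  have eq: "distr ?M borel (inversion r) = density lborel (\<lambda>y. ennreal (?b y))"
  proof -
    have "(\<lambda>z. ennreal (?w z)) = (\<lambda>z. ennreal ((r / norm z) ^ (2 * CARD('n))) * indicator {z. r < norm z} z)"
      by (rule ext) (simp split: split_indicator)
    moreover have "(\<lambda>y. ennreal (?b y)) = (\<lambda>y. indicator {y. norm y < r} y)"
      by (rule ext) (simp split: split_indicator)
    ultimately show ?thesis by (simp only: distr_inversion[OF r])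
  qed
  have mw: "?w \<in> borel_measurable lborel" by measurable
  have mb: "?b \<in> borel_measurable lborel" by measurable
  have mh: "h \<in> borel_measurable lborel" by measurable
  have mc: "(\<lambda>z. h (inversion r z)) \<in> borel_measurable lborel" by measurable
  have inv: "inversion r \<in> measurable ?M borel" by measurable
  have b0: "AE y in lborel. 0 \<le> ?b y" by simp
  have w0': "AE z in lborel. 0 \<le> ?w z" using w0 by simp
  have "?I1 \<longleftrightarrow> integrable (density lborel (\<lambda>y. ennreal (?b y))) h"
    using integrable_density[OF mh mb b0] by simp
  also have "\<dots> \<longleftrightarrow> integrable ?M (\<lambda>z. h (inversion r z))"
    unfolding eq[symmetric] by (rule integrable_distr_eq[OF inv h])
  also have "\<dots> \<longleftrightarrow> integrable lborel (\<lambda>z. ?w z *\<^sub>R h (inversion r z))"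
    by (rule integrable_density[OF mc mw w0'])
  finally show "?I1 \<longleftrightarrow> ?I2" by (simp only: real_scaleR_def mult.assoc)
  have "?L = integral\<^sup>L (density lborel (\<lambda>y. ennreal (?b y))) h"
    using integral_density[OF mh mb b0] by simp
  also have "\<dots> = integral\<^sup>L ?M (\<lambda>z. h (inversion r z))"
    unfolding eq[symmetric] by (rule integral_distr[OF inv h])
  also have "\<dots> = (\<integral>z. ?w z *\<^sub>R h (inversion r z) \<partial>lborel)"
    by (rule integral_density[OF mc mw w0'])
  finally show "?L = ?R" by (simp only: real_scaleR_def mult.assoc)
qed

section \<open>Positivity and continuity of solutions\<close>

text \<open>Names for the facts on Bochner integrals whose base names also denote facts on gauge integrals.\<close>

lemmas integrable_add' = Bochner_Integration.integrable_add
lemmas integrable_diff' = Bochner_Integration.integrable_diff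
lemmas integrable_bound' = Bochner_Integration.integrable_bound
lemmas integral_add' = Bochner_Integration.integral_add
lemmas integral_diff' = Bochner_Integration.integral_diff
lemmas integral_cong' = Bochner_Integration.integral_cong
lemmas integral_nonneg' = Bochner_Integration.integral_nonneg

lemma norm_powr_add_le:
  fixes x y :: "'a::real_normed_vector"
  assumes "p > 0" shows "norm (x + y) powr p \<le> 2 powr p * (norm x powr p + norm y powr p)"
proof -
  have "norm (x + y) powr p \<le> (norm x + norm y) powr p"
    using assms by (intro powr_mono2 norm_triangle_ineq) auto
  also have "\<dots> \<le> 2 powr p * (norm x powr p + norm y powr p)"
    using assms by (intro powr_add_le_two_powr) auto
  finally show ?thesis .
qed

lemma norm_powr_diff_le:
  fixes x y :: "'a::real_normed_vector"
  assumes "p > 0" shows "norm (x - y) powr p \<le> 2 powr p * (norm x powr p + norm y powr p)"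
  using norm_powr_add_le[OF assms, of x "- y"] by simp

context
  fixes M :: "'a::euclidean_space measure" and f :: "'a \<Rightarrow> real" and p :: real
  assumes sub: "sets borel \<subseteq> sets M" and space: "space M = UNIV"
    and f_meas: "f \<in> borel_measurable M" and f_nonneg: "\<And>y. f y \<ge> 0" and p: "p > 0"
    and pot: "\<And>x. integrable M (\<lambda>y. norm (x - y) powr p * f y)"
begin

lemma borel_measurable_mono: "g \<in> borel_measurable borel \<Longrightarrow> g \<in> borel_measurable M"
  using sub space by (auto simp: measurable_def space_borel)

text \<open>The finiteness of the potential at \<open>0\<close> and at one unit vector already controls the total mass.\<close>
lemma potential_moments:
  "integrable M f" "integrable M (\<lambda>y. norm y powr p * f y)"
proof -
  show 1: "integrable M (\<lambda>y. norm y powr p * f y)" using pot[of 0] by simp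
  obtain e :: 'a where e: "norm e = 1" using nonempty_Basis norm_Basis by blast
  \<comment> \<open>The kernels at \<open>0\<close> and at \<open>e\<close> do not vanish simultaneously.\<close>
  have *: "f y \<le> 2 powr p * (norm y powr p * f y + norm (e - y) powr p * f y)" for y

  proof -
    have "1 \<le> 2 powr p * (norm y powr p + norm (e - y) powr p)"
      using norm_powr_add_le[OF p, of y "e - y"] e by simp
    from mult_right_mono[OF this f_nonneg[of y]] show ?thesis by (simp add: algebra_simps)
  qed
  show "integrable M f"
  proof (rule integrable_bound')
    show "integrable M (\<lambda>y. 2 powr p * (norm y powr p * f y + norm (e - y) powr p * f y))"
      by (intro integrable_mult_right integrable_add' 1 pot)
    show "AE x in M. norm (f x) \<le> norm (2 powr p * (norm x powr p * f x + norm (e - x) powr p * f x))"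
      using * f_nonneg by (intro AE_I2) (simp add: order_trans[OF _ abs_ge_self])
  qed (rule f_meas)
qed

lemma potential_continuous:
  "continuous_on UNIV (\<lambda>x. \<integral>y. norm (x - y) powr p * f y \<partial>M)"
proof -
  have mm: "(\<lambda>y. norm (z - y) powr p * f y) \<in> borel_measurable M" for z
    by (rule borel_measurable_times[OF borel_measurable_mono f_meas]) measurable
  have "(\<lambda>k. \<integral>y. norm (X k - y) powr p * f y \<partial>M) \<longlonglongrightarrow> (\<integral>y. norm (x - y) powr p * f y \<partial>M)"
    if X: "X \<longlonglongrightarrow> x" for X x
  proof -
    obtain B where B: "norm (X k) \<le> B" for k
      using convergent_imp_Bseq[of X] X by (auto simp: convergent_def Bseq_def)
    show ?thesis
    proof (rule integral_dominated_convergence)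
      show "integrable M (\<lambda>y. 2 powr p * (B powr p * f y + norm y powr p * f y))"
        by (intro integrable_mult_right integrable_add' potential_moments)
      show "AE y in M. (\<lambda>k. norm (X k - y) powr p * f y) \<longlonglongrightarrow> norm (x - y) powr p * f y"
        using p X by (intro AE_I2 tendsto_intros tendsto_powr') auto
      fix k
      have "norm (X k - y) powr p \<le> 2 powr p * (B powr p + norm y powr p)" for y
        by (rule order_trans[OF norm_powr_diff_le[OF p]])
           (use B p in \<open>auto intro!: mult_left_mono powr_mono2\<close>)
      from mult_right_mono[OF this f_nonneg]
      show "AE y in M. norm (norm (X k - y) powr p * f y) \<le> 2 powr p * (B powr p * f y + norm y powr p * f y)"
        using f_nonneg by (intro AE_I2) (simp add: algebra_simps)
    qed (rule mm)+
  qed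
  then show ?thesis by (auto simp: continuous_on_sequentially o_def)
qed

end

text \<open>The hypotheses in the form in which they are used: the solutions are positive and continuous, and the
integrals are finite real integrals with respect to Borel measure.\<close>
locale neg_power_pair =
  fixes u v :: "real ^ 'n \<Rightarrow> real" and p q :: real
  assumes p_pos: "p > 0" and q_pos: "q > 0"
    and u_cont: "continuous_on UNIV u" and v_cont: "continuous_on UNIV v"
    and u_pos: "\<And>x. u x > 0" and v_pos: "\<And>x. v x > 0"
    and u_int: "\<And>x. integrable lborel (\<lambda>y. norm (x - y) powr p * v y powr (-q))"
    and v_int: "\<And>x. integrable lborel (\<lambda>y. norm (x - y) powr p * u y powr (-q))"
    and u_eq: "\<And>x. u x = (\<integral>y. norm (x - y) powr p * v y powr (-q) \<partial>lborel)"
    and v_eq: "\<And>x. v x = (\<integral>y. norm (x - y) powr p * u y powr (-q) \<partial>lborel)"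

lemma neg_power_measurable: "(\<lambda>t. neg_power t q) \<in> borel_measurable borel"
  unfolding neg_power_def by measurable

text \<open>A potential vanishes only if its integrand vanishes almost everywhere, but the weight never vanishes.\<close>
lemma potential_pos:
  fixes w z :: "real ^ 'n \<Rightarrow> real"
  assumes z: "z \<in> borel_measurable lebesgue" and z0: "\<And>x. z x \<ge> 0"
    and eq: "ennreal (w x) = (\<integral>\<^sup>+ y. ennreal (norm (x - y) powr p) * neg_power (z y) q \<partial>lebesgue)"
  shows "w x > 0"
proof (rule ccontr)
  assume "\<not> w x > 0"
  then have "(\<integral>\<^sup>+ y. ennreal (norm (x - y) powr p) * neg_power (z y) q \<partial>lebesgue) = 0"
    using eq by (simp add: ennreal_neg)
  moreover have "(\<lambda>y. ennreal (norm (x - y) powr p) * neg_power (z y) q) \<in> borel_measurable lebesgue"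
    by (intro borel_measurable_times_ennreal measurable_compose[OF z neg_power_measurable] measurable_completion) measurable
  ultimately have "AE y in lebesgue. ennreal (norm (x - y) powr p) * neg_power (z y) q = 0"
    by (simp add: nn_integral_0_iff_AE)
  moreover have "AE y in lebesgue. y \<noteq> x"
    using AE_lborel_singleton[of x] by (rule AE_completion)
  ultimately have "AE y in (lebesgue :: (real ^ 'n) measure). False"
  proof eventually_elim
    case (elim y)
    have "ennreal (norm (x - y) powr p) \<noteq> 0" using elim by (simp add: ennreal_eq_0_iff)
    moreover have "neg_power (z y) q \<noteq> 0" using z0[of y] by (simp add: neg_power_def ennreal_eq_0_iff)
    ultimately show False using elim by simp
  qed
  then have "emeasure lebesgue (UNIV :: (real ^ 'n) set) = 0"
    by (simp add: eventually_False ae_filter_eq_bot_iff)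
  then show False by (simp add: emeasure_completion)
qed

text \<open>Each function is a finite potential of the other, so positivity comes first, then integrability, and then
continuity; continuity makes both functions Borel measurable.\<close>
lemma neg_power_pairI:
  fixes u v :: "real ^ 'n \<Rightarrow> real" and p q :: real
  assumes p: "p > 0" and q: "q > 0"
    and u_meas: "u \<in> borel_measurable lebesgue"
    and v_meas: "v \<in> borel_measurable lebesgue"
    and u_nonneg: "\<And>x. u x \<ge> 0"
    and v_nonneg: "\<And>x. v x \<ge> 0"
    and u_eq: "\<And>x. ennreal (u x) =
      (\<integral>\<^sup>+ y. ennreal (norm (x - y) powr p) * neg_power (v y) q \<partial>lebesgue)"
    and v_eq: "\<And>x. ennreal (v x) =
      (\<integral>\<^sup>+ y. ennreal (norm (x - y) powr p) * neg_power (u y) q \<partial>lebesgue)"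
  shows "neg_power_pair u v p q"
proof -
  have u_pos: "u x > 0" for x by (rule potential_pos[OF v_meas v_nonneg u_eq])
  have v_pos: "v x > 0" for x by (rule potential_pos[OF u_meas u_nonneg v_eq])
  have half: "continuous_on UNIV w \<and> (\<forall>x. integrable lebesgue (\<lambda>y. norm (x - y) powr p * z y powr (-q)))
      \<and> (\<forall>x. w x = (\<integral>y. norm (x - y) powr p * z y powr (-q) \<partial>lebesgue))"
    if z: "z \<in> borel_measurable lebesgue" "\<And>x. z x > 0" and w: "\<And>x. w x > 0"
      and eq: "\<And>x. ennreal (w x) = (\<integral>\<^sup>+ y. ennreal (norm (x - y) powr p) * neg_power (z y) q \<partial>lebesgue)"
    for w z :: "real ^ 'n \<Rightarrow> real"
  proof -
    have m: "(\<lambda>y. z y powr (-q)) \<in> borel_measurable lebesgue" using z(1) by measurable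
    have mk: "(\<lambda>y. norm (x - y) powr p * z y powr (-q)) \<in> borel_measurable lebesgue" for x
      by (intro borel_measurable_times m measurable_completion) measurable
    have "ennreal (w x) = (\<integral>\<^sup>+ y. ennreal (norm (x - y) powr p * z y powr (-q)) \<partial>lebesgue)" for x
      unfolding eq
      by (intro nn_integral_cong) (use z(2) in \<open>simp add: neg_power_def ennreal_mult less_imp_neq[THEN not_sym]\<close>)
    then have nn: "(\<integral>\<^sup>+ y. ennreal (norm (x - y) powr p * z y powr (-q)) \<partial>lebesgue) = ennreal (w x)" for x by simp
    have int: "integrable lebesgue (\<lambda>y. norm (x - y) powr p * z y powr (-q))" for x
      by (rule integrableI_nonneg[OF mk]) (simp_all add: nn)
    have weq: "w x = (\<integral>y. norm (x - y) powr p * z y powr (-q) \<partial>lebesgue)" for x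
      using integral_eq_nn_integral[OF mk, of x] w[of x] by (simp add: nn less_imp_le)
    have "continuous_on UNIV (\<lambda>x. \<integral>y. norm (x - y) powr p * z y powr (-q) \<partial>lebesgue)"
      by (rule potential_continuous[OF _ _ m _ p int]) auto
    moreover have "w = (\<lambda>x. \<integral>y. norm (x - y) powr p * z y powr (-q) \<partial>lebesgue)"
      by (rule ext) (rule weq)
    ultimately have "continuous_on UNIV w" by (simp only:)
    then show ?thesis using int weq by blast
  qed
  note U = half[OF v_meas v_pos u_pos u_eq] and V = half[OF u_meas u_pos v_pos v_eq]
  have [measurable]: "u \<in> borel_measurable borel" "v \<in> borel_measurable borel"
    using U V by (blast intro: borel_measurable_continuous_onI)+
  have i: "integrable lebesgue g \<longleftrightarrow> integrable lborel g" "integral\<^sup>L lebesgue g = integral\<^sup>L lborel g"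
    if "g \<in> borel_measurable borel" for g :: "real ^ 'n \<Rightarrow> real"
    by (rule integrable_completion integral_completion, simp add: that)+
  have m: "(\<lambda>y. norm (x - y) powr p * v y powr (-q)) \<in> borel_measurable borel"
       "(\<lambda>y. norm (x - y) powr p * u y powr (-q)) \<in> borel_measurable borel" for x by measurable
  show ?thesis
  proof
    fix x
    show "integrable lborel (\<lambda>y. norm (x - y) powr p * v y powr (-q))"
      "integrable lborel (\<lambda>y. norm (x - y) powr p * u y powr (-q))"
      using U V i(1)[OF m(1), of x] i(1)[OF m(2), of x] by blast+
    have "u x = (\<integral>y. norm (x - y) powr p * v y powr (-q) \<partial>lebesgue)"
      "v x = (\<integral>y. norm (x - y) powr p * u y powr (-q) \<partial>lebesgue)"
      using U V by blast+
    then show "u x = (\<integral>y. norm (x - y) powr p * v y powr (-q) \<partial>lborel)"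
      "v x = (\<integral>y. norm (x - y) powr p * u y powr (-q) \<partial>lborel)"
      unfolding i(2)[OF m(1)] i(2)[OF m(2)] .
  qed (rule p q u_pos v_pos conjunct1[OF U] conjunct1[OF V])+
qed

section \<open>Translation, dilation and growth\<close>

lemma lborel_translate:
  fixes h :: "'a::euclidean_space \<Rightarrow> real" and k :: "'a \<Rightarrow> ennreal"
  shows "h \<in> borel_measurable borel \<Longrightarrow> integrable lborel (\<lambda>y. h (y + c)) \<longleftrightarrow> integrable lborel h"
    and "h \<in> borel_measurable borel \<Longrightarrow> (\<integral>y. h (y + c) \<partial>lborel) = (\<integral>y. h y \<partial>lborel)"
    and "k \<in> borel_measurable borel \<Longrightarrow> (\<integral>\<^sup>+y. k (y + c) \<partial>lborel) = (\<integral>\<^sup>+y. k y \<partial>lborel)"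
proof -
  have m: "(+) c \<in> measurable lborel borel" by simp
  show "h \<in> borel_measurable borel \<Longrightarrow> integrable lborel (\<lambda>y. h (y + c)) \<longleftrightarrow> integrable lborel h"
    using integrable_distr_eq[OF m, of h] by (simp add: lborel_distr_plus add.commute)
  show "h \<in> borel_measurable borel \<Longrightarrow> (\<integral>y. h (y + c) \<partial>lborel) = (\<integral>y. h y \<partial>lborel)"
    using integral_distr[OF m, of h] by (simp add: lborel_distr_plus add.commute)
  show "k \<in> borel_measurable borel \<Longrightarrow> (\<integral>\<^sup>+y. k (y + c) \<partial>lborel) = (\<integral>\<^sup>+y. k y \<partial>lborel)"
    using nn_integral_distr[OF m, of k] by (simp add: lborel_distr_plus add.commute)
qed

lemma lborel_dilate:
  fixes h :: "'a::euclidean_space \<Rightarrow> real"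
  assumes c: "c > 0" and h: "h \<in> borel_measurable borel" and int: "integrable lborel h"
  shows "integrable lborel (\<lambda>y. h (c *\<^sub>R y))"
    and "(\<integral>y. h (c *\<^sub>R y) \<partial>lborel) = (\<integral>y. h y \<partial>lborel) / c ^ DIM('a)"
proof -
  have m: "(\<lambda>y. c *\<^sub>R y) \<in> measurable lborel (borel :: 'a measure)" by simp
  have eq: "(lborel :: 'a measure) = density (distr lborel borel (\<lambda>x. c *\<^sub>R x)) (\<lambda>_. ennreal (c ^ DIM('a)))"
    using lborel_affine[of c "0 :: 'a"] c by simp
  have h': "h \<in> borel_measurable (distr lborel borel (\<lambda>x. c *\<^sub>R x))" using h by simp
  have "integrable (density (distr lborel borel (\<lambda>x. c *\<^sub>R x)) (\<lambda>_. ennreal (c ^ DIM('a)))) h"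
    using int eq by simp
  then have "integrable (distr lborel borel (\<lambda>x. c *\<^sub>R x)) (\<lambda>x. c ^ DIM('a) *\<^sub>R h x)"
    by (subst (asm) integrable_density[OF h']) (use c in auto)
  then have "integrable lborel (\<lambda>x. c ^ DIM('a) *\<^sub>R h (c *\<^sub>R x))"
    by (subst (asm) integrable_distr_eq[OF m]) (use h in auto)
  then show "integrable lborel (\<lambda>y. h (c *\<^sub>R y))" using c by simp
  have "(\<integral>y. h y \<partial>lborel) = (\<integral>x. c ^ DIM('a) *\<^sub>R h x \<partial>distr lborel borel (\<lambda>x. c *\<^sub>R x))"
    by (subst eq, subst integral_density[OF h']) (use c in auto)
  also have "\<dots> = (\<integral>x. c ^ DIM('a) *\<^sub>R h (c *\<^sub>R x) \<partial>lborel)"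
    by (rule integral_distr[OF m]) (use h in auto)
  finally show "(\<integral>y. h (c *\<^sub>R y) \<partial>lborel) = (\<integral>y. h y \<partial>lborel) / c ^ DIM('a)"
    using c by simp
qed

lemma not_AE_lborel_outside_open:
  fixes S :: "'a::euclidean_space set"
  assumes "open S" "S \<noteq> {}" shows "\<not> (AE x in lborel. x \<notin> S)"
proof
  assume "AE x in lborel. x \<notin> S"
  then have "S \<in> null_sets lborel"
    using assms(1) by (simp add: AE_iff_null_sets null_setsI AE_not_in)
  then have "negligible S"
    by (simp add: negligible_iff_null_sets null_sets_completionI)
  then show False using open_not_negligible assms by blast
qed

lemma lborel_integral_pos:
  fixes h :: "'a::euclidean_space \<Rightarrow> real"
  assumes "integrable lborel h" "\<And>y. h y > 0"
  shows "(\<integral>y. h y \<partial>lborel) > 0"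
proof (rule ccontr)
  assume "\<not> (\<integral>y. h y \<partial>lborel) > 0"
  moreover have "(\<integral>y. h y \<partial>lborel) \<ge> 0" using assms(2) by (intro integral_nonneg') (simp add: less_imp_le)
  ultimately have "(\<integral>y. h y \<partial>lborel) = 0" by simp
  then have "AE y in lborel. h y = 0"
    using integral_nonneg_eq_0_iff_AE[OF assms(1)] assms(2) by (simp add: less_imp_le)
  then have "AE y in lborel. y \<notin> (UNIV :: 'a set)"
  proof eventually_elim
    case (elim y)
    then show ?case using assms(2)[of y] by simp
  qed
  then show False using not_AE_lborel_outside_open[of "UNIV :: 'a set"] by simp
qed

text \<open>The weight \<open>w\<^sup>-\<^sup>q\<close> generates the potential, so its total mass is the coefficient of \<open>\<bar>x\<bar>\<^sup>p\<close> at infinity.\<close>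
definition neg_mass :: "real \<Rightarrow> (real ^ 'n \<Rightarrow> real) \<Rightarrow> real" where
  "neg_mass q w = (\<integral>y. w y powr (-q) \<partial>lborel)"

context neg_power_pair
begin

text \<open>The system is symmetric; every statement about \<open>u\<close> below is also available for \<open>v\<close> through this lemma.\<close>
lemma swapped: "neg_power_pair v u p q"
  by (rule neg_power_pair.intro)
     (rule p_pos q_pos u_cont v_cont u_pos v_pos u_int v_int u_eq v_eq)+

lemma u_meas [measurable]: "u \<in> borel_measurable borel"
  by (rule borel_measurable_continuous_onI[OF u_cont])

lemma v_meas [measurable]: "v \<in> borel_measurable borel"
  by (rule borel_measurable_continuous_onI[OF v_cont])

lemma kernel_meas [measurable]:
  "(\<lambda>y. norm (x - y) powr p * v y powr (-q)) \<in> borel_measurable borel"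
  "(\<lambda>y. norm (x - y) powr p * u y powr (-q)) \<in> borel_measurable borel"
  by measurable

lemma translated: "neg_power_pair (\<lambda>x. u (x + c)) (\<lambda>x. v (x + c)) p q"
proof
  fix x
  have *: "norm (x - y) = norm ((x + c) - (y + c))" for y by simp
  show "integrable lborel (\<lambda>y. norm (x - y) powr p * v (y + c) powr - q)"
    unfolding * using lborel_translate(1)[OF kernel_meas(1), of "x + c" c] u_int by blast
  show "integrable lborel (\<lambda>y. norm (x - y) powr p * u (y + c) powr - q)"
    unfolding * using lborel_translate(1)[OF kernel_meas(2), of "x + c" c] v_int by blast
  show "u (x + c) = (\<integral>y. norm (x - y) powr p * v (y + c) powr - q \<partial>lborel)"
    unfolding * lborel_translate(2)[OF kernel_meas(1), of "x + c" c] by (rule u_eq)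
  show "v (x + c) = (\<integral>y. norm (x - y) powr p * u (y + c) powr - q \<partial>lborel)"
    unfolding * lborel_translate(2)[OF kernel_meas(2), of "x + c" c] by (rule v_eq)
qed (auto simp: p_pos q_pos u_pos v_pos intro!: continuous_on_compose2[OF u_cont] continuous_on_compose2[OF v_cont] continuous_intros)

lemma v_neg_power_int: "integrable lborel (\<lambda>y. v y powr (-q))"
  and v_moment_int: "integrable lborel (\<lambda>y. norm y powr p * v y powr (-q))"
  by (rule potential_moments[OF _ _ _ _ p_pos u_int]; simp)+

lemma u_neg_power_int: "integrable lborel (\<lambda>y. u y powr (-q))"
  and u_moment_int: "integrable lborel (\<lambda>y. norm y powr p * u y powr (-q))"
  by (rule potential_moments[OF _ _ _ _ p_pos v_int]; simp)+

lemma mass_v_pos: "neg_mass q v > 0"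
  unfolding neg_mass_def by (rule lborel_integral_pos[OF v_neg_power_int]) (simp add: v_pos less_imp_neq[THEN not_sym])

lemma u_0: "u 0 = (\<integral>y. norm y powr p * v y powr (-q) \<partial>lborel)"
  using u_eq[of 0] by simp

lemma u_upper: "\<exists>C>0. \<forall>x. u x \<le> C * (1 + norm x powr p)"
proof -
  define K where "K = neg_mass q v + u 0"
  have K: "K > 0" using mass_v_pos u_pos[of 0] by (simp add: K_def)
  have "u x \<le> (2 powr p * K) * (1 + norm x powr p)" for x
  proof -
    have "u x = (\<integral>y. norm (x - y) powr p * v y powr (-q) \<partial>lborel)" by (rule u_eq)
    also have "\<dots> \<le> (\<integral>y. 2 powr p * (norm x powr p * v y powr (-q) + norm y powr p * v y powr (-q)) \<partial>lborel)"
    proof (rule integral_mono[OF u_int])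
      show "integrable lborel (\<lambda>y. 2 powr p * (norm x powr p * v y powr (-q) + norm y powr p * v y powr (-q)))"
        by (intro integrable_mult_right integrable_add' v_neg_power_int v_moment_int)
      fix y
      from mult_right_mono[OF norm_powr_diff_le[OF p_pos, of x y], of "v y powr (-q)"]
      show "norm (x - y) powr p * v y powr (-q) \<le> 2 powr p * (norm x powr p * v y powr (-q) + norm y powr p * v y powr (-q))"
        by (simp add: algebra_simps)
    qed
    also have "\<dots> = 2 powr p * (norm x powr p * neg_mass q v + u 0)"
      using v_neg_power_int v_moment_int by (simp add: neg_mass_def u_0 integral_add')
    also have "\<dots> \<le> 2 powr p * (K * (1 + norm x powr p))"
      using mass_v_pos u_pos[of 0] by (intro mult_left_mono) (auto simp: K_def algebra_simps)
    finally show ?thesis by (simp add: mult.assoc)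
  qed
  then show ?thesis using K by (intro exI[of _ "2 powr p * K"]) auto
qed

text \<open>Integrate the quasi-triangle inequality for \<open>\<bar>x\<bar>\<^sup>p\<close> against the weight.\<close>
lemma u_lower_aux: "norm x powr p * neg_mass q v \<le> 2 powr p * (u x + u 0)"
proof -
  have "norm x powr p * neg_mass q v = (\<integral>y. norm x powr p * v y powr (-q) \<partial>lborel)"
    by (simp add: neg_mass_def)
  also have "\<dots> \<le> (\<integral>y. 2 powr p * (norm (x - y) powr p * v y powr (-q) + norm y powr p * v y powr (-q)) \<partial>lborel)"
  proof (rule integral_mono)
    show "integrable lborel (\<lambda>y. norm x powr p * v y powr (-q))"
      by (intro integrable_mult_right v_neg_power_int)
    show "integrable lborel (\<lambda>y. 2 powr p * (norm (x - y) powr p * v y powr (-q) + norm y powr p * v y powr (-q)))"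
      by (intro integrable_mult_right integrable_add' u_int v_moment_int)
    fix y
    from mult_right_mono[OF norm_powr_add_le[OF p_pos, of "x - y" y], of "v y powr (-q)"]
    show "norm x powr p * v y powr (-q) \<le> 2 powr p * (norm (x - y) powr p * v y powr (-q) + norm y powr p * v y powr (-q))"
      by (simp add: algebra_simps)
  qed
  also have "\<dots> = 2 powr p * (u x + u 0)"
    using u_int v_moment_int by (simp add: u_0 u_eq[of x] integral_add')
  finally show ?thesis .
qed

text \<open>Continuity gives a lower bound on a ball, and \<open>u_lower_aux\<close> gives one outside it.\<close>
lemma u_lower_const: "\<exists>m>0. \<forall>x. m \<le> u x"
proof -
  define R where "R = (2 powr p * (u 0 + 1) / neg_mass q v) powr (1 / p)"
  have "R \<ge> 0" by (simp add: R_def)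
  have "\<exists>x0\<in>cball 0 R. \<forall>x\<in>cball 0 R. u x0 \<le> u x"
    using \<open>R \<ge> 0\<close> by (intro continuous_attains_inf continuous_on_subset[OF u_cont]) auto
  then obtain x0 where "\<forall>x\<in>cball 0 R. u x0 \<le> u x" by blast
  then have x0: "u x0 \<le> u x" if "norm x \<le> R" for x using that by simp
  have big: "1 \<le> u x" if "norm x > R" for x
  proof -
    have "2 powr p * (u 0 + 1) / neg_mass q v = R powr p"
      using p_pos mass_v_pos u_pos[of 0] by (simp add: R_def powr_powr)
    also have "\<dots> \<le> norm x powr p" using that p_pos \<open>R \<ge> 0\<close> by (intro powr_mono2) auto
    finally have "2 powr p * (u 0 + 1) \<le> norm x powr p * neg_mass q v"
      using mass_v_pos by (simp add: divide_simps)
    also have "\<dots> \<le> 2 powr p * (u x + u 0)" by (rule u_lower_aux)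
    finally show ?thesis by simp
  qed
  have "min 1 (u x0) \<le> u x" for x
    using x0[of x] big[of x] by (cases "norm x \<le> R") (auto simp: min_def not_le)
  then show ?thesis using u_pos[of x0] by (intro exI[of _ "min 1 (u x0)"]) auto
qed

lemma u_lower: "\<exists>c>0. \<forall>x. c * norm x powr p \<le> u x"
proof -
  obtain m where m: "m > 0" "\<And>x. m \<le> u x" using u_lower_const by blast
  define c where "c = neg_mass q v / (2 powr p * (1 + u 0 / m))"
  have d: "2 powr p * (1 + u 0 / m) > 0" using m u_pos[of 0] by (simp add: add_pos_pos)
  have "c * norm x powr p \<le> u x" for x
  proof -
    have "u 0 \<le> u 0 / m * u x" using m(1) m(2)[of x] u_pos[of 0] by (simp add: field_simps)
    then have "2 powr p * (u x + u 0) \<le> 2 powr p * (u x + u 0 / m * u x)"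
      by (intro mult_left_mono) auto
    also have "\<dots> = 2 powr p * (1 + u 0 / m) * u x" by (simp add: distrib_left distrib_right mult.assoc)
    finally have "2 powr p * (u x + u 0) \<le> 2 powr p * (1 + u 0 / m) * u x" .
    from order_trans[OF u_lower_aux this]
    have "norm x powr p * neg_mass q v \<le> 2 powr p * (1 + u 0 / m) * u x" .
    then show ?thesis using d by (simp add: c_def pos_divide_le_eq mult.commute)
  qed
  moreover have "c > 0" using d mass_v_pos by (simp add: c_def)
  ultimately show ?thesis by blast
qed

text \<open>The integral of \<open>(1 + \<bar>y\<bar>/R)\<^sup>p v\<^sup>-\<^sup>q\<close> tends to the mass as \<open>R \<rightarrow> \<infinity>\<close>, by dominated convergence.\<close>
lemma u_asymptotic_upper:
  assumes "neg_mass q v < \<beta>"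
  shows "\<exists>R>0. \<forall>x. norm x \<ge> R \<longrightarrow> u x \<le> \<beta> * norm x powr p"
proof -
  define F where "F k = (\<integral>y. (1 + norm y / real (Suc k)) powr p * v y powr (-q) \<partial>lborel)" for k
  have le: "(1 + norm y / real (Suc k)) powr p * v y powr (-q) \<le> 2 powr p * (v y powr (-q) + norm y powr p * v y powr (-q))" for y k
  proof -
    have "norm y / real (Suc k) \<le> norm y" by (simp add: divide_le_eq mult_le_cancel_left1)
    then have "(1 + norm y / real (Suc k)) powr p \<le> (1 + norm y) powr p"
      using p_pos by (intro powr_mono2) auto
    also have "\<dots> \<le> 2 powr p * (1 powr p + norm y powr p)"
      using p_pos by (intro powr_add_le_two_powr) auto
    finally have "(1 + norm y / real (Suc k)) powr p \<le> 2 powr p * (1 + norm y powr p)" by simp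
    from mult_right_mono[OF this, of "v y powr (-q)"] show ?thesis by (simp add: algebra_simps)
  qed
  have dom: "integrable lborel (\<lambda>y. 2 powr p * (v y powr (-q) + norm y powr p * v y powr (-q)))"
    by (intro integrable_mult_right integrable_add' v_neg_power_int v_moment_int)
  have lim: "(\<lambda>k. (1 + norm y / real (Suc k)) powr p * v y powr (-q)) \<longlonglongrightarrow> (1 + 0) powr p * v y powr (-q)" for y
  proof (intro tendsto_intros)
    show "(\<lambda>k. norm y / real (Suc k)) \<longlonglongrightarrow> 0"
      using LIMSEQ_Suc[OF lim_const_over_n[of "norm y"]] by simp
  qed auto
  have "F \<longlonglongrightarrow> (\<integral>y. (1 + 0) powr p * v y powr (-q) \<partial>lborel)" unfolding F_def
    by (rule integral_dominated_convergence[OF _ _ dom]) (use lim le in \<open>auto intro!: AE_I2\<close>)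
  then have "F \<longlonglongrightarrow> neg_mass q v" by (simp add: neg_mass_def)
  from order_tendstoD(2)[OF this assms] obtain k where k: "F k < \<beta>"
    by (auto dest: eventually_happens)
  have intF: "integrable lborel (\<lambda>y. (1 + norm y / real (Suc k)) powr p * v y powr (-q))"
    by (rule integrable_bound'[OF dom]) (use le[of _ k] in \<open>auto intro!: AE_I2 order_trans[OF _ abs_ge_self]\<close>)
  have "u x \<le> \<beta> * norm x powr p" if x: "norm x \<ge> real (Suc k)" for x
  proof -
    have nx: "norm x > 0" using x by (smt (verit) of_nat_0_less_iff zero_less_Suc)
    have "u x = (\<integral>y. norm (x - y) powr p * v y powr (-q) \<partial>lborel)" by (rule u_eq)
    also have "\<dots> \<le> (\<integral>y. norm x powr p * ((1 + norm y / real (Suc k)) powr p * v y powr (-q)) \<partial>lborel)"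
    proof (rule integral_mono[OF u_int])
      show "integrable lborel (\<lambda>y. norm x powr p * ((1 + norm y / real (Suc k)) powr p * v y powr (-q)))"
        by (intro integrable_mult_right intF)
      fix y
      have "norm (x - y) \<le> norm x + norm y" by (rule norm_triangle_ineq4)
      also have "norm y \<le> norm x * (norm y / real (Suc k))"
        using x by (simp add: divide_simps) (metis mult.commute mult_left_mono norm_ge_zero of_nat_Suc)
      finally have "norm (x - y) \<le> norm x * (1 + norm y / real (Suc k))" by (simp add: algebra_simps)
      then have "norm (x - y) powr p \<le> (norm x * (1 + norm y / real (Suc k))) powr p"
        using p_pos by (intro powr_mono2) auto
      also have "\<dots> = norm x powr p * (1 + norm y / real (Suc k)) powr p"
        by (simp add: powr_mult)
      finally show "norm (x - y) powr p * v y powr (-q) \<le> norm x powr p * ((1 + norm y / real (Suc k)) powr p * v y powr (-q))"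
        by (simp add: mult_right_mono flip: mult.assoc)
    qed
    also have "\<dots> = norm x powr p * F k" by (simp add: F_def)
    also have "\<dots> \<le> norm x powr p * \<beta>" using k by (intro mult_left_mono) auto
    finally show ?thesis by (simp add: mult.commute)
  qed
  then show ?thesis by (intro exI[of _ "real (Suc k)"]) auto
qed

end

section \<open>Integrability of the dilated kernel\<close>

context neg_power_pair
begin

text \<open>The weight is at least a multiple of \<open>\<bar>y\<bar>\<^sup>-\<^sup>p\<^sup>q\<close> far out. If \<open>p q\<close> were smaller, the \<open>p\<close>-th moment of the weight would
be infinite, as is seen on balls of radius \<open>R\<close> at distance \<open>2 R\<close> from the origin.\<close>
lemma exponent_lower: "p * q \<ge> real CARD('n) + p"
proof (rule ccontr)
  assume neg: "\<not> p * q \<ge> real CARD('n) + p"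
  define s where "s = real CARD('n) + p - p * q"
  have s: "s > 0" using neg by (simp add: s_def)
  obtain C where C: "C > 0" "\<And>x. v x \<le> C * (1 + norm x powr p)"
    using neg_power_pair.u_upper[OF swapped] by blast
  obtain e :: "real ^ 'n" where e: "norm e = 1" using nonempty_Basis norm_Basis by blast
  define \<omega> where "\<omega> = unit_ball_vol (real CARD('n))"
  have \<omega>: "\<omega> > 0" by (simp add: \<omega>_def)
  define c where "c = (2 * C) powr (-q) * 3 powr (- (p * q)) * \<omega>"
  have c: "c > 0" using C \<omega> by (simp add: c_def)
  have main: "c * R powr s \<le> u 0" if R: "R \<ge> 1" for R
  proof -
    \<comment> \<open>This ball lies in the annulus of radii \<open>R\<close> and \<open>3 R\<close>, so that both factors can be estimated.\<close>
    define B where "B = ball ((2 * R) *\<^sub>R e) R"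
    have B: "norm y \<ge> R" "norm y \<le> 3 * R" if "y \<in> B" for y
    proof -
      have d: "norm ((2 * R) *\<^sub>R e - y) < R" using that by (simp add: B_def dist_norm)
      have n: "norm ((2 * R) *\<^sub>R e) = 2 * R" using R e by simp
      show "norm y \<ge> R" using d n norm_triangle_ineq2[of "(2 * R) *\<^sub>R e" y] by linarith
      show "norm y \<le> 3 * R" using d n norm_triangle_ineq3[of "(2 * R) *\<^sub>R e" y] by linarith
    qed
    define a where "a = R powr p * ((2 * C) powr (-q) * (3 * R) powr (- (p * q)))"
    have le: "a * indicator B y \<le> norm y powr p * v y powr (-q)" for y
    proof (cases "y \<in> B")
      case True
      note y = B[OF True]
      have "norm y > 0" using y R by linarith
      have "1 \<le> norm y powr p" using y R p_pos by (intro ge_one_powr_ge_zero) auto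
      then have "C * (1 + norm y powr p) \<le> C * (2 * norm y powr p)" using C(1) by (intro mult_left_mono) auto
      then have "v y \<le> (2 * C) * norm y powr p" using C(2)[of y] by simp
      then have "((2 * C) * norm y powr p) powr (-q) \<le> v y powr (-q)"
        using q_pos v_pos[of y] by (intro powr_mono2') auto
      moreover have "((2 * C) * norm y powr p) powr (-q) = (2 * C) powr (-q) * norm y powr (- (p * q))"
        using C by (simp add: powr_mult powr_powr)
      moreover have "(3 * R) powr (- (p * q)) \<le> norm y powr (- (p * q))"
        using y \<open>norm y > 0\<close> p_pos q_pos by (intro powr_mono2') auto
      ultimately have "(2 * C) powr (-q) * (3 * R) powr (- (p * q)) \<le> v y powr (-q)"
        by (smt (verit) mult_left_mono powr_ge_zero)
      moreover have "R powr p \<le> norm y powr p" using y R p_pos by (intro powr_mono2) auto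
      ultimately have "a \<le> norm y powr p * v y powr (-q)" unfolding a_def
        by (intro mult_mono) auto
      then show ?thesis using True by simp
    qed simp
    have "a * measure lborel B = (\<integral>y. a * indicator B y \<partial>lborel)" by (simp add: B_def)
    also have "\<dots> \<le> u 0" unfolding u_0
    proof (rule integral_mono[OF _ v_moment_int le])
      show "integrable lborel (\<lambda>y. a * indicat_real B y)"
        by (intro integrable_mult_right integrable_real_indicator)
           (use R in \<open>auto simp: B_def emeasure_ball\<close>)
    qed
    finally have "a * measure lborel B \<le> u 0" .
    moreover have "measure lborel B = \<omega> * R ^ CARD('n)"
      using R by (simp add: B_def content_ball \<omega>_def)
    moreover have "a * (\<omega> * R ^ CARD('n)) = c * R powr s"
    proof -
      have "(3 * R) powr (- (p * q)) = 3 powr (- (p * q)) * R powr (- (p * q))"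
        using R by (simp add: powr_mult)
      moreover have "R ^ CARD('n) = R powr real CARD('n)" using R by (simp add: powr_realpow)
      moreover have "R powr s = R powr real CARD('n) * R powr p * R powr (- (p * q))"
        by (simp add: s_def flip: powr_add)
      ultimately show ?thesis by (simp add: a_def c_def)
    qed
    ultimately show ?thesis by simp
  qed
  define R where "R = max 1 ((u 0 / c + 1) powr (1 / s))"
  have "u 0 / c + 1 = ((u 0 / c + 1) powr (1 / s)) powr s"
    using s c u_pos[of 0] by (simp add: powr_powr add_pos_pos less_imp_neq[THEN not_sym] add_nonneg_nonneg)
  also have "\<dots> \<le> R powr s" using s by (intro powr_mono2) (auto simp: R_def)
  finally have "c * (u 0 / c + 1) \<le> c * R powr s" using c by (intro mult_left_mono) auto
  then have "u 0 + c \<le> c * R powr s" using c by (simp add: algebra_simps)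
  moreover have "c * R powr s \<le> u 0" by (rule main) (simp add: R_def)
  ultimately show False using c by simp
qed

lemma q_gt_1: "q > 1"
proof (rule ccontr)
  assume "\<not> q > 1"
  then have "p * q \<le> p * 1" using p_pos by (intro mult_left_mono) auto
  moreover have "real CARD('n) > 0" by simp
  ultimately show False using exponent_lower by linarith
qed

text \<open>A weaker decay than \<open>\<bar>y\<bar>\<^sup>-\<^sup>p\<^sup>q\<close>, but valid up to the origin, and homogeneous of the degree that makes
\<open>singular_kernel_bound\<close> scale correctly.\<close>
lemma v_neg_power_decay: "\<exists>C>0. \<forall>y. y \<noteq> 0 \<longrightarrow> v y powr (-q) \<le> C * norm y powr (- real CARD('n))"
proof -
  obtain m where m: "m > 0" "\<And>x. m \<le> v x" using neg_power_pair.u_lower_const[OF swapped] by blast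
  obtain c where c: "c > 0" "\<And>x. c * norm x powr p \<le> v x" using neg_power_pair.u_lower[OF swapped] by blast
  define C where "C = m powr (-q) + c powr (-q)"
  have "v y powr (-q) \<le> C * norm y powr (- real CARD('n))" if y: "y \<noteq> 0" for y
  proof (cases "norm y \<le> 1")
    case True
    have "norm y powr real CARD('n) \<le> 1 powr real CARD('n)" using True by (intro powr_mono2) auto
    then have "1 \<le> norm y powr (- real CARD('n))" using y by (simp add: powr_minus one_le_inverse_iff)
    moreover have "v y powr (-q) \<le> m powr (-q)" using m q_pos by (intro powr_mono2') auto
    ultimately have "v y powr (-q) * 1 \<le> m powr (-q) * norm y powr (- real CARD('n))" by (intro mult_mono) auto
    also have "\<dots> \<le> C * norm y powr (- real CARD('n))" by (simp add: C_def mult_right_mono)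
    finally show ?thesis by simp
  next
    case False
    have "v y powr (-q) \<le> (c * norm y powr p) powr (-q)"
      using c y q_pos by (intro powr_mono2') auto
    also have "\<dots> = c powr (-q) * norm y powr (- (p * q))" using c by (simp add: powr_mult powr_powr)
    also have "norm y powr (- (p * q)) \<le> norm y powr (- real CARD('n))"
      using False exponent_lower p_pos by (intro powr_mono) auto
    finally have "v y powr (-q) \<le> c powr (-q) * norm y powr (- real CARD('n))" by (simp add: mult_left_mono)
    also have "\<dots> \<le> C * norm y powr (- real CARD('n))" by (simp add: C_def mult_right_mono)
    finally show ?thesis .
  qed
  moreover have "C > 0" using m c by (simp add: C_def add_pos_pos)
  ultimately show ?thesis by blast
qed

text \<open>Split at \<open>\<bar>x - y\<bar> = \<bar>x\<bar>/2\<close>. Far from \<open>x\<close> the kernel is at most a constant times \<open>\<bar>x\<bar>\<^sup>p\<^sup>-\<^sup>1\<close>. Near \<open>x\<close> the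
distances of \<open>x\<close> and \<open>y\<close> from the origin are comparable, so the weight is at most a multiple of \<open>\<bar>x\<bar>\<^sup>-\<^sup>n\<close>, and the
singularity is integrable.\<close>
lemma singular_kernel_bound:
  assumes p1: "p < 1"
  shows "\<exists>C>0. \<forall>x. x \<noteq> 0 \<longrightarrow>
    (\<integral>\<^sup>+ y. ennreal (norm x * norm (x - y) powr (p - 1) * v y powr (-q)) \<partial>lborel) \<le> ennreal (C * norm x powr p)"
proof -
  define n where "n = real CARD('n)"
  have n1: "n \<ge> 1" by (simp add: n_def Suc_leI)
  obtain D where D: "D > 0" "\<And>y. y \<noteq> 0 \<Longrightarrow> v y powr (-q) \<le> D * norm y powr (- n)"
    using v_neg_power_decay unfolding n_def by blast
  have nD: "real DIM(real ^ 'n) = n" by (simp add: n_def)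
  have a: "0 \<le> 1 - p" "1 - p < real DIM(real ^ 'n)" using p1 p_pos n1 unfolding nD by linarith+
  from nn_integral_norm_powr_le[OF a] obtain C1 where C1: "C1 > 0"
    "\<And>r. r > 0 \<Longrightarrow> (\<integral>\<^sup>+ z. ennreal (norm z powr (p - 1)) * indicator {z. norm z \<le> r} z \<partial>(lborel :: (real^'n) measure))
       \<le> ennreal (C1 * r powr (n - (1 - p)))" by (auto simp: n_def)
  define M where "M = neg_mass q v"
  have M: "M > 0" using mass_v_pos by (simp add: M_def)
  define C where "C = 2 powr (1 - p) * M + D * C1 * 2 powr (1 - p)"
  have C: "C > 0" using M D C1 by (simp add: C_def add_pos_pos)
  have "(\<integral>\<^sup>+ y. ennreal (norm x * norm (x - y) powr (p - 1) * v y powr (-q)) \<partial>lborel) \<le> ennreal (C * norm x powr p)"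
    if x: "x \<noteq> 0" for x
  proof -
    define r where "r = norm x / 2"
    have r: "r > 0" "norm x = 2 * r" using x by (auto simp: r_def)
    \<comment> \<open>\<open>A\<close> bounds the kernel far from \<open>x\<close>, and \<open>B\<close> the remaining factors near \<open>x\<close>.\<close>
    define A where "A = norm x * r powr (p - 1)"
    define B where "B = norm x * D * r powr (- n)"
    have AB: "A \<ge> 0" "B \<ge> 0" using D by (auto simp: A_def B_def)
    let ?\<kappa> = "\<lambda>y. ennreal (norm (y - x) powr (p - 1)) * indicator {z. norm z \<le> r} (y - x)"
    have pt: "ennreal (norm x * norm (x - y) powr (p - 1) * v y powr (-q))
       \<le> ennreal (A * v y powr (-q)) + ennreal B * ?\<kappa> y" for y
    proof (cases "norm (y - x) \<le> r")
      case True
      then have nx: "norm (x - y) \<le> r" by (simp add: norm_minus_commute)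
      then have ny: "norm y \<ge> r" using r(2) norm_triangle_ineq2[of x y] by linarith
      then have "y \<noteq> 0" using r by auto
      have "v y powr (-q) \<le> D * norm y powr (- n)" using D(2)[OF \<open>y \<noteq> 0\<close>] .
      also have "\<dots> \<le> D * r powr (- n)" using ny r D(1) n1 by (intro mult_left_mono powr_mono2') auto
      finally have "norm x * norm (x - y) powr (p - 1) * v y powr (-q) \<le> norm x * norm (x - y) powr (p - 1) * (D * r powr (- n))"
        by (intro mult_left_mono) auto
      also have "\<dots> = B * norm (y - x) powr (p - 1)" by (simp add: B_def norm_minus_commute)
      finally have "ennreal (norm x * norm (x - y) powr (p - 1) * v y powr (-q)) \<le> ennreal (B * norm (y - x) powr (p - 1))"
        by (rule ennreal_leI)
      also have "\<dots> = ennreal B * ?\<kappa> y"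
        using True AB by (simp add: ennreal_mult')
      finally show ?thesis by (simp add: add_increasing)
    next
      case False
      then have "norm (x - y) powr (p - 1) \<le> r powr (p - 1)"
        using r p1 by (intro powr_mono2') (auto simp: norm_minus_commute)
      then have "norm x * norm (x - y) powr (p - 1) * v y powr (-q) \<le> A * v y powr (-q)"
        unfolding A_def by (intro mult_right_mono mult_left_mono) auto
      then show ?thesis by (intro add_increasing2 ennreal_leI) auto
    qed
    have "(\<integral>\<^sup>+ y. ennreal (norm x * norm (x - y) powr (p - 1) * v y powr (-q)) \<partial>lborel)
      \<le> (\<integral>\<^sup>+ y. ennreal (A * v y powr (-q)) + ennreal B * ?\<kappa> y \<partial>lborel)"
      by (intro nn_integral_mono pt)
    also have "\<dots> = (\<integral>\<^sup>+ y. ennreal (A * v y powr (-q)) \<partial>lborel)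
       + (\<integral>\<^sup>+ y. ennreal B * ?\<kappa> y \<partial>lborel)"
      by (rule nn_integral_add) measurable
    also have "(\<integral>\<^sup>+ y. ennreal (A * v y powr (-q)) \<partial>lborel) = ennreal (A * M)"
      using v_neg_power_int AB by (subst nn_integral_eq_integral) (auto simp: M_def neg_mass_def)
    also have "(\<integral>\<^sup>+ y. ennreal B * ?\<kappa> y \<partial>lborel)
      = ennreal B * (\<integral>\<^sup>+ y. ?\<kappa> y \<partial>lborel)"
      by (rule nn_integral_cmult) measurable
    also have "(\<integral>\<^sup>+ y. ?\<kappa> y \<partial>lborel)
       = (\<integral>\<^sup>+ z. ennreal (norm z powr (p - 1)) * indicator {z. norm z \<le> r} z \<partial>(lborel :: (real ^ 'n) measure))"
      using lborel_translate(3)[of "\<lambda>z. ennreal (norm z powr (p - 1)) * indicator {z. norm z \<le> r} z" "- x"] by simp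
    also have "ennreal (A * M) + ennreal B * \<dots> \<le> ennreal (A * M) + ennreal B * ennreal (C1 * r powr (n - (1 - p)))"
      by (intro add_left_mono mult_left_mono C1(2) r) auto
    also have "\<dots> = ennreal (A * M + B * (C1 * r powr (n - (1 - p))))"
      using AB M C1 by (simp add: ennreal_mult')
    also have "A * M + B * (C1 * r powr (n - (1 - p))) = C * norm x powr p"
    proof -
      have r1: "r * r powr (p - 1) = r powr p" using r by (simp add: powr_diff)
      have r2: "r powr (- n) * r powr (n - (1 - p)) = r powr (p - 1)" by (simp flip: powr_add)
      have r3: "norm x powr p = 2 powr p * r powr p" using r by (simp add: powr_mult)
      have 2: "2 powr (1 - p) * 2 powr p = (2 :: real)" by (simp flip: powr_add)
      have "A * M = 2 * M * (r * r powr (p - 1))" by (simp add: A_def r(2))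
      moreover have "B * (C1 * r powr (n - (1 - p))) = 2 * D * C1 * (r * (r powr (- n) * r powr (n - (1 - p))))"
        by (simp add: B_def r(2))
      moreover have "C * norm x powr p = (2 powr (1 - p) * 2 powr p) * (M + D * C1) * r powr p"
        by (simp add: C_def r3 algebra_simps)
      ultimately show ?thesis by (simp only: 2 r1 r2) (simp only: algebra_simps)
    qed
    finally show ?thesis .
  qed
  then show ?thesis using C by blast
qed

text \<open>One majorant serves for differentiating under both integral signs: \<open>H x\<close> is integrable in \<open>y\<close>, and its integral is
integrable in \<open>x\<close> against \<open>u\<^sup>-\<^sup>q\<close>.\<close>
lemma dilation_domination:
  "\<exists>H C. C > 0 \<and> (\<forall>x. integrable lborel (H x)) \<and> (\<forall>x. (\<integral>y. H x y \<partial>lborel) \<le> C * (1 + norm x powr p)) \<and>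
    (\<forall>x y t. y \<noteq> x \<and> 0 \<le> t \<and> t \<le> 2 \<longrightarrow>
      \<bar>norm (t *\<^sub>R x - y) powr p - norm (x - y) powr p\<bar> * v y powr (-q) \<le> \<bar>t - 1\<bar> * H x y)"
proof (cases "p < 1")
  case True
  obtain C where C: "C > 0" "\<And>x. x \<noteq> 0 \<Longrightarrow>
    (\<integral>\<^sup>+ y. ennreal (norm x * norm (x - y) powr (p - 1) * v y powr (-q)) \<partial>lborel) \<le> ennreal (C * norm x powr p)"
    using singular_kernel_bound[OF True] by blast
  define H where "H x y = norm x * norm (x - y) powr (p - 1) * v y powr (-q)" for x y :: "real ^ 'n"
  have H0: "H x y \<ge> 0" for x y by (simp add: H_def)
  have mH: "H x \<in> borel_measurable lborel" for x unfolding H_def[abs_def] by measurable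
  have nnH: "(\<integral>\<^sup>+ y. ennreal (H x y) \<partial>lborel) \<le> ennreal (C * norm x powr p)" for x
    using C(2)[of x] by (cases "x = 0") (simp_all add: H_def)
  have iH: "integrable lborel (H x)" for x
    by (rule integrableI_nonneg[OF mH]) (use H0 nnH[of x] in \<open>auto intro: le_less_trans\<close>)
  have "(\<integral>y. H x y \<partial>lborel) \<le> C * (1 + norm x powr p)" for x
  proof -
    have "ennreal (\<integral>y. H x y \<partial>lborel) \<le> ennreal (C * norm x powr p)"
      using nn_integral_eq_integral[OF iH[of x]] H0 nnH[of x] by simp
    then have "(\<integral>y. H x y \<partial>lborel) \<le> C * norm x powr p" using C by (simp add: ennreal_le_iff)
    also have "\<dots> \<le> C * (1 + norm x powr p)" using C by simp
    finally show ?thesis .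
  qed
  moreover have "\<bar>norm (t *\<^sub>R x - y) powr p - norm (x - y) powr p\<bar> * v y powr (-q) \<le> \<bar>t - 1\<bar> * H x y"
    if "y \<noteq> x" for x y t
  proof -
    let ?d = "\<bar>norm (t *\<^sub>R x - y) powr p - norm (x - y) powr p\<bar>" and ?n = "\<bar>norm (t *\<^sub>R x - y) - norm (x - y)\<bar>"
    have "?d \<le> ?n * norm (x - y) powr (p - 1)"
      using that True p_pos by (intro abs_diff_powr_le_concave) auto
    also have "?n \<le> norm ((t *\<^sub>R x - y) - (x - y))" by (rule norm_triangle_ineq3)
    also have "(t *\<^sub>R x - y) - (x - y) = (t - 1) *\<^sub>R x" by (simp add: algebra_simps)
    finally have "?d \<le> \<bar>t - 1\<bar> * norm x * norm (x - y) powr (p - 1)"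
      by (simp add: mult_right_mono)
    from mult_right_mono[OF this, of "v y powr (-q)"] show ?thesis by (simp add: H_def mult.assoc)
  qed
  ultimately show ?thesis using C(1) iH by blast
next
  case False
  define H where "H x y = p * 2 powr p * ((2 * norm x) powr p * v y powr (-q) + norm y powr p * v y powr (-q))" for x y :: "real ^ 'n"
  have iH: "integrable lborel (H x)" for x unfolding H_def
    by (intro integrable_mult_right integrable_add' v_neg_power_int v_moment_int)
  define C where "C = p * 2 powr p * (2 powr p * neg_mass q v + u 0)"
  have C: "C > 0" using p_pos mass_v_pos u_pos[of 0] by (simp add: C_def add_pos_pos)
  have "(\<integral>y. H x y \<partial>lborel) \<le> C * (1 + norm x powr p)" for x
  proof -
    have "(\<integral>y. H x y \<partial>lborel) = p * 2 powr p * ((2 * norm x) powr p * neg_mass q v + u 0)"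
      using v_neg_power_int v_moment_int by (simp add: H_def neg_mass_def u_0 integral_add')
    also have "\<dots> = p * 2 powr p * (2 powr p * neg_mass q v * norm x powr p + u 0)" by (simp add: powr_mult)
    also have "\<dots> \<le> p * 2 powr p * ((2 powr p * neg_mass q v + u 0) * (1 + norm x powr p))"
      using p_pos mass_v_pos u_pos[of 0] by (intro mult_left_mono) (auto simp: algebra_simps)
    finally show ?thesis by (simp add: C_def mult.assoc)
  qed
  moreover have "\<bar>norm (t *\<^sub>R x - y) powr p - norm (x - y) powr p\<bar> * v y powr (-q) \<le> \<bar>t - 1\<bar> * H x y"
    if t: "0 \<le> t" "t \<le> 2" for x y t
  proof -
    let ?d = "\<bar>norm (t *\<^sub>R x - y) powr p - norm (x - y) powr p\<bar>" and ?n = "\<bar>norm (t *\<^sub>R x - y) - norm (x - y)\<bar>"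
    define c where "c = 2 * norm x + norm y"
    have tx: "norm (t *\<^sub>R x) \<le> 2 * norm x" using t by (simp add: mult_right_mono)
    have c: "norm (t *\<^sub>R x - y) \<le> c" "norm (x - y) \<le> c" "norm x \<le> c" "c \<ge> 0"
      using norm_triangle_ineq4[of "t *\<^sub>R x" y] tx norm_triangle_ineq4[of x y] norm_ge_zero[of x] norm_ge_zero[of y]
      unfolding c_def by linarith+
    have "?n \<le> norm ((t *\<^sub>R x - y) - (x - y))" by (rule norm_triangle_ineq3)
    also have "(t *\<^sub>R x - y) - (x - y) = (t - 1) *\<^sub>R x" by (simp add: algebra_simps)
    also have "norm \<dots> \<le> \<bar>t - 1\<bar> * c" using c by (simp add: mult_left_mono)
    finally have d: "?n \<le> \<bar>t - 1\<bar> * c" .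
    have "?d \<le> p * c powr (p - 1) * ?n"
      using False c by (intro abs_diff_powr_le_convex) auto
    also have "\<dots> \<le> p * c powr (p - 1) * (\<bar>t - 1\<bar> * c)" using d p_pos by (intro mult_left_mono) auto
    also have "\<dots> = \<bar>t - 1\<bar> * (p * (c * c powr (p - 1)))" by simp
    finally have e: "?d \<le> \<bar>t - 1\<bar> * (p * (c * c powr (p - 1)))" .
    have "c * c powr (p - 1) \<le> c powr p" using c by (cases "c = 0") (auto simp: powr_diff)
    also have "c powr p \<le> 2 powr p * ((2 * norm x) powr p + norm y powr p)"
      unfolding c_def using p_pos by (intro powr_add_le_two_powr) auto
    finally have "\<bar>t - 1\<bar> * (p * (c * c powr (p - 1))) \<le> \<bar>t - 1\<bar> * (p * (2 powr p * ((2 * norm x) powr p + norm y powr p)))"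
      using p_pos by (intro mult_left_mono) auto
    from order_trans[OF e this]
    have "?d \<le> \<bar>t - 1\<bar> * (p * (2 powr p * ((2 * norm x) powr p + norm y powr p)))" .
    from mult_right_mono[OF this, of "v y powr (-q)"] show ?thesis by (simp add: H_def algebra_simps)
  qed
  ultimately show ?thesis using C iH by blast
qed

end

section \<open>The critical exponent\<close>

text \<open>The convex function \<open>s \<mapsto> s\<^sup>1\<^sup>-\<^sup>q / (q - 1)\<close> lies above its tangent at \<open>t\<close>. After dividing by \<open>t\<close> this follows
from \<open>1 + y \<le> exp y\<close>, used for \<open>y = (1 - q) ln (s/t)\<close> and for the logarithm.\<close>
lemma neg_powr_tangent:
  fixes s t q :: real
  assumes q: "q > 1" and s: "s > 0" and t: "t > 0"
  shows "s * t powr (-q) \<ge> t powr (1 - q) + (t powr (1 - q) - s powr (1 - q)) / (q - 1)"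
proof -
  define r where "r = s / t"
  have r: "r > 0" "s = r * t" using s t by (auto simp: r_def)
  have "(1 - q) * (r - 1) \<le> (1 - q) * ln r"
    using ln_le_minus_one[OF r(1)] q by (intro mult_left_mono_neg) auto
  also have "\<dots> \<le> exp ((1 - q) * ln r) - 1" using exp_ge_add_one_self[of "(1 - q) * ln r"] by linarith
  also have "exp ((1 - q) * ln r) = r powr (1 - q)" using r by (simp add: powr_def)
  finally have "1 - r powr (1 - q) \<le> (q - 1) * (r - 1)" by (simp add: algebra_simps)
  then have "1 + (1 - r powr (1 - q)) / (q - 1) \<le> r" using q by (simp add: divide_simps) (simp add: algebra_simps)
  from mult_left_mono[OF this, of "t powr (1 - q)"]
  have "t powr (1 - q) * (1 + (1 - r powr (1 - q)) / (q - 1)) \<le> t powr (1 - q) * r" by simp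
  moreover have "t powr (1 - q) * r = s * t powr (-q)"
  proof -
    have "t powr (1 - q) = t * t powr (-q)" using t powr_add[of t 1 "-q"] by simp
    then show ?thesis using t by (simp add: r_def)
  qed
  moreover have "t powr (1 - q) * (1 + (1 - r powr (1 - q)) / (q - 1))
      = t powr (1 - q) + (t powr (1 - q) - s powr (1 - q)) / (q - 1)"
    using r t by (simp add: powr_mult algebra_simps diff_divide_distrib)
  ultimately show ?thesis by simp
qed

context neg_power_pair
begin

definition dilation_pairing :: "real \<Rightarrow> real" where
  "dilation_pairing t = (\<integral>x. u (t *\<^sub>R x) * u x powr (-q) \<partial>lborel)"

lemma dilation_pairing_int: "integrable lborel (\<lambda>x. u (t *\<^sub>R x) * u x powr (-q))"
proof -
  obtain C where C: "C > 0" "\<And>x. u x \<le> C * (1 + norm x powr p)" using u_upper by blast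
  show ?thesis
  proof (rule integrable_bound')
    show "integrable lborel (\<lambda>x. C * (u x powr (-q) + \<bar>t\<bar> powr p * (norm x powr p * u x powr (-q))))"
      by (intro integrable_mult_right integrable_add' u_neg_power_int u_moment_int)
    have "u (t *\<^sub>R x) * u x powr (-q) \<le> C * (u x powr (-q) + \<bar>t\<bar> powr p * (norm x powr p * u x powr (-q)))" for x
      using mult_right_mono[OF C(2)[of "t *\<^sub>R x"], of "u x powr (-q)"]
      by (simp add: powr_mult algebra_simps)
    then show "AE x in lborel. norm (u (t *\<^sub>R x) * u x powr (-q)) \<le> norm (C * (u x powr (-q) + \<bar>t\<bar> powr p * (norm x powr p * u x powr (-q))))"
      using u_pos by (intro AE_I2) (simp add: less_imp_le order_trans[OF _ abs_ge_self])
  qed measurable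
qed

lemma u_power_int: "integrable lborel (\<lambda>x. u x powr (1 - q))"
  and dilation_pairing_1: "dilation_pairing 1 = (\<integral>x. u x powr (1 - q) \<partial>lborel)"
proof -
  have eq: "u x * u x powr (-q) = u x powr (1 - q)" for x
    using u_pos[of x] powr_add[of "u x" 1 "-q"] by simp
  show "integrable lborel (\<lambda>x. u x powr (1 - q))" using dilation_pairing_int[of 1] by (simp add: eq)
  show "dilation_pairing 1 = (\<integral>x. u x powr (1 - q) \<partial>lborel)" by (simp add: dilation_pairing_def eq)
qed

lemma dilation_pairing_1_pos: "dilation_pairing 1 > 0"
  unfolding dilation_pairing_1
  by (rule lborel_integral_pos[OF u_power_int]) (simp add: u_pos less_imp_neq[THEN not_sym])

text \<open>Integrate the tangent inequality and rescale \<open>\<integral> u(t x)\<^sup>1\<^sup>-\<^sup>q dx\<close>.\<close>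
lemma dilation_pairing_lower:
  assumes t: "t > 0"
  shows "dilation_pairing t \<ge> dilation_pairing 1 * (1 + (1 - t powr (- real CARD('n))) / (q - 1))"
proof -
  define I where "I = dilation_pairing 1"
  have m: "(\<lambda>x. u x powr (1 - q)) \<in> borel_measurable borel" by measurable
  note d = lborel_dilate[OF t m u_power_int]
  have "I * (1 + (1 - t powr (- real CARD('n))) / (q - 1)) = I + (I - I / t ^ CARD('n)) / (q - 1)"
    using t by (simp add: powr_minus powr_realpow algebra_simps divide_inverse)
  also have "\<dots> = (\<integral>x. u x powr (1 - q) + (u x powr (1 - q) - u (t *\<^sub>R x) powr (1 - q)) / (q - 1) \<partial>lborel)"
    using d u_power_int by (simp add: I_def dilation_pairing_1)
  also have "\<dots> \<le> dilation_pairing t" unfolding dilation_pairing_def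
    using d(1) u_power_int
    by (intro integral_mono dilation_pairing_int neg_powr_tangent q_gt_1 u_pos) auto
  finally show ?thesis by (simp add: I_def)
qed

text \<open>Insert the integral equation for \<open>u\<close>, exchange the integrals, and use the homogeneity of the kernel.\<close>
lemma dilation_pairing_swap:
  assumes t: "t > 0"
  shows "dilation_pairing t = t powr p * neg_power_pair.dilation_pairing v q (1 / t)"
proof -
  interpret sw: neg_power_pair v u p q by (rule swapped)
  define k where "k x y = ennreal (norm (t *\<^sub>R x - y) powr p * v y powr (-q) * u x powr (-q))" for x y
  have k: "(\<lambda>(x, y). k x y) \<in> borel_measurable (lborel \<Otimes>\<^sub>M lborel)"
    unfolding k_def by measurable
  have "(\<integral>\<^sup>+ x. ennreal (u (t *\<^sub>R x) * u x powr (-q)) \<partial>lborel) = (\<integral>\<^sup>+ x. \<integral>\<^sup>+ y. k x y \<partial>lborel \<partial>lborel)"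
  proof (rule nn_integral_cong)
    fix x
    have "(\<integral>\<^sup>+ y. k x y \<partial>lborel) = ennreal (\<integral>y. norm (t *\<^sub>R x - y) powr p * v y powr (-q) * u x powr (-q) \<partial>lborel)"
      unfolding k_def by (rule nn_integral_eq_integral) (use u_int in auto)
    then show "ennreal (u (t *\<^sub>R x) * u x powr (-q)) = (\<integral>\<^sup>+ y. k x y \<partial>lborel)"
      by (simp add: u_eq[of "t *\<^sub>R x"])
  qed
  also have "\<dots> = (\<integral>\<^sup>+ y. \<integral>\<^sup>+ x. k x y \<partial>lborel \<partial>lborel)"
    using lborel_pair.Fubini'[OF k] by simp
  also have "\<dots> = (\<integral>\<^sup>+ y. ennreal (t powr p * (v ((1 / t) *\<^sub>R y) * v y powr (-q))) \<partial>lborel)"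
  proof (rule nn_integral_cong)
    fix y :: "real ^ 'n"
    have eq: "norm (t *\<^sub>R x - y) powr p = t powr p * norm ((1 / t) *\<^sub>R y - x) powr p" for x
    proof -
      have "t *\<^sub>R x - y = t *\<^sub>R (x - (1 / t) *\<^sub>R y)" using t by (simp add: algebra_simps)
      then have "norm (t *\<^sub>R x - y) = t * norm ((1 / t) *\<^sub>R y - x)" using t by (simp only: norm_scaleR norm_minus_commute)
      then show ?thesis using t by (simp only: powr_mult)
    qed
    have "(\<integral>\<^sup>+ x. k x y \<partial>lborel) = (\<integral>\<^sup>+ x. ennreal ((t powr p * v y powr (-q)) * (norm ((1 / t) *\<^sub>R y - x) powr p * u x powr (-q))) \<partial>lborel)"
      unfolding k_def eq by (simp only: mult_ac)
    also have "\<dots> = ennreal (\<integral>x. (t powr p * v y powr (-q)) * (norm ((1 / t) *\<^sub>R y - x) powr p * u x powr (-q)) \<partial>lborel)"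
      by (rule nn_integral_eq_integral) (use v_int[of "(1 / t) *\<^sub>R y"] in auto)
    also have "(\<integral>x. (t powr p * v y powr (-q)) * (norm ((1 / t) *\<^sub>R y - x) powr p * u x powr (-q)) \<partial>lborel)
        = (t powr p * v y powr (-q)) * v ((1 / t) *\<^sub>R y)"
      by (simp only: v_eq[of "(1 / t) *\<^sub>R y"] integral_mult_right_zero)
    finally show "(\<integral>\<^sup>+ x. k x y \<partial>lborel) = ennreal (t powr p * (v ((1 / t) *\<^sub>R y) * v y powr (-q)))"
      by (simp only: mult_ac)
  qed
  also have "\<dots> = ennreal (t powr p * sw.dilation_pairing (1 / t))"
    unfolding sw.dilation_pairing_def
    by (subst nn_integral_eq_integral)
       (use sw.dilation_pairing_int[of "1 / t"] v_pos in \<open>auto simp: less_imp_le\<close>)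
  also have "(\<integral>\<^sup>+ x. ennreal (u (t *\<^sub>R x) * u x powr (-q)) \<partial>lborel) = ennreal (dilation_pairing t)"
    unfolding dilation_pairing_def
    by (rule nn_integral_eq_integral) (use dilation_pairing_int[of t] u_pos in \<open>auto simp: less_imp_le\<close>)
  finally have "ennreal (dilation_pairing t) = ennreal (t powr p * sw.dilation_pairing (1 / t))" .
  moreover have "dilation_pairing t \<ge> 0" "sw.dilation_pairing (1 / t) \<ge> 0"
    unfolding dilation_pairing_def sw.dilation_pairing_def
    by (intro integral_nonneg' mult_nonneg_nonneg; simp add: u_pos v_pos less_imp_le)+
  ultimately show ?thesis by (simp add: ennreal_inj)
qed

text \<open>The derivative is taken under the two integral signs in turn, first the one over \<open>y\<close> and then the one over \<open>x\<close>.
Only its existence matters; its value is forced by the two lower bounds.\<close>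
lemma dilation_pairing_differentiable: "\<exists>D. (dilation_pairing has_real_derivative D) (at 1)"
proof -
  obtain H C where C: "C > 0" and iH: "\<And>x. integrable lborel (H x)"
    and H_le: "\<And>x. (\<integral>y. H x y \<partial>lborel) \<le> C * (1 + norm x powr p)"
    and dom: "\<And>x y t. y \<noteq> x \<Longrightarrow> 0 \<le> t \<Longrightarrow> t \<le> 2 \<Longrightarrow>
      \<bar>norm (t *\<^sub>R x - y) powr p - norm (x - y) powr p\<bar> * v y powr (-q) \<le> \<bar>t - 1\<bar> * H x y"
    using dilation_domination by blast
  \<comment> \<open>The derivative at \<open>t = 1\<close> of \<open>norm (t *\<^sub>R x - y) powr p\<close> for \<open>y \<noteq> x\<close>.\<close>
  define d where "d x y = p / 2 * ((norm (x - y))\<^sup>2) powr (p / 2 - 1) * (2 * (x \<bullet> (x - y)))" for x y :: "real ^ 'n"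
  have d: "((\<lambda>t. norm (t *\<^sub>R x - y) powr p) has_real_derivative d x y) (at 1)" if "y \<noteq> x" for x y
  proof -
    have eq: "norm (t *\<^sub>R x - y) powr p = ((t *\<^sub>R x - y) \<bullet> (t *\<^sub>R x - y)) powr (p / 2)" for t
    proof -
      have "norm (t *\<^sub>R x - y) powr p = ((norm (t *\<^sub>R x - y))\<^sup>2) powr (p / 2)"
        by (cases "t *\<^sub>R x - y = 0") (simp_all add: powr_powr flip: powr_numeral)
      then show ?thesis by (simp add: power2_norm_eq_inner)
    qed
    have pos: "(x - y) \<bullet> (x - y) > 0" using that by simp
    have "((\<lambda>t. (t *\<^sub>R x - y) \<bullet> (t *\<^sub>R x - y)) has_real_derivative 2 * (x \<bullet> (x - y))) (at 1)"
    proof -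
      have "((\<lambda>t. t\<^sup>2 * (x \<bullet> x) - 2 * t * (x \<bullet> y) + y \<bullet> y) has_real_derivative 2 * (x \<bullet> (x - y))) (at 1)"
        by (auto intro!: derivative_eq_intros simp: inner_diff_right algebra_simps)
      moreover have "(\<lambda>t. (t *\<^sub>R x - y) \<bullet> (t *\<^sub>R x - y)) = (\<lambda>t. t\<^sup>2 * (x \<bullet> x) - 2 * t * (x \<bullet> y) + y \<bullet> y)"
        by (rule ext) (simp add: inner_diff_left inner_diff_right inner_commute power2_eq_square algebra_simps)
      ultimately show ?thesis by simp
    qed
    from DERIV_powr[OF this _ DERIV_const[of "p / 2"]] pos
    have "((\<lambda>t. ((t *\<^sub>R x - y) \<bullet> (t *\<^sub>R x - y)) powr (p / 2)) has_real_derivative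
        ((x - y) \<bullet> (x - y)) powr (p / 2) * ((2 * (x \<bullet> (x - y))) * (p / 2) / ((x - y) \<bullet> (x - y)))) (at 1)"
      by simp
    moreover have "((x - y) \<bullet> (x - y)) powr (p / 2) * ((2 * (x \<bullet> (x - y))) * (p / 2) / ((x - y) \<bullet> (x - y))) = d x y"
      using pos by (simp add: d_def powr_diff power2_norm_eq_inner)
    ultimately show ?thesis by (simp only: eq)
  qed
  \<comment> \<open>The limit must not depend on the sequence, so the witness is fixed before \<open>T\<close>.\<close>
  have "\<exists>D. \<forall>T. (\<forall>k. T k \<noteq> 1) \<longrightarrow> (\<forall>k. 0 \<le> T k \<and> T k \<le> 2) \<longrightarrow> T \<longlonglongrightarrow> 1 \<longrightarrow>
     (\<lambda>k. (dilation_pairing (T k) - dilation_pairing 1) / (T k - 1)) \<longlonglongrightarrow> D"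
  proof (intro exI allI impI)
    fix T :: "nat \<Rightarrow> real" assume T1: "\<forall>k. T k \<noteq> 1" and T2: "\<forall>k. 0 \<le> T k \<and> T k \<le> 2" and T: "T \<longlonglongrightarrow> 1"
    have filt: "filterlim T (at 1) sequentially"
      using T T1 by (simp add: filterlim_at)
    define Q where "Q k x y = (norm (T k *\<^sub>R x - y) powr p - norm (x - y) powr p) / (T k - 1) * v y powr (-q)" for k x y
    define G where "G x = (\<integral>y. d x y * v y powr (-q) \<partial>lborel)" for x
    have quot: "(u (T k *\<^sub>R x) - u x) / (T k - 1) = (\<integral>y. Q k x y \<partial>lborel)" for k x
    proof -
      have "(u (T k *\<^sub>R x) - u x) / (T k - 1) = (\<integral>y. (norm (T k *\<^sub>R x - y) powr p * v y powr (-q) - norm (x - y) powr p * v y powr (-q)) / (T k - 1) \<partial>lborel)"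
        using u_int by (simp add: u_eq[of x] u_eq[of "T k *\<^sub>R x"] integral_diff')
      also have "\<dots> = (\<integral>y. Q k x y \<partial>lborel)"
        by (simp add: Q_def left_diff_distrib)
      finally show ?thesis .
    qed
    have neq: "AE y in lborel. y \<noteq> x" for x :: "real ^ 'n" by (rule AE_lborel_singleton)
    have dm: "AE y in lborel. norm (Q k x y) \<le> H x y" for k x
      using neq[of x]
    proof eventually_elim
      case (elim y)
      have "\<bar>norm (T k *\<^sub>R x - y) powr p - norm (x - y) powr p\<bar> * v y powr (-q) \<le> \<bar>T k - 1\<bar> * H x y"
        using dom[OF elim, of "T k"] T2 by blast
      moreover have "\<bar>T k - 1\<bar> > 0" using T1 by simp
      ultimately show ?case by (simp add: Q_def abs_mult abs_divide divide_le_eq mult.commute)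
    qed
    have mq: "(\<lambda>y. Q k x y) \<in> borel_measurable lborel" for k x
      unfolding Q_def by measurable
    have inner: "(\<lambda>k. (u (T k *\<^sub>R x) - u x) / (T k - 1)) \<longlonglongrightarrow> G x" for x
      unfolding quot G_def
    proof (rule integral_dominated_convergence[OF _ mq iH _ dm])
      show "(\<lambda>y. d x y * v y powr (-q)) \<in> borel_measurable lborel" unfolding d_def by measurable
      show "AE y in lborel. (\<lambda>k. Q k x y) \<longlonglongrightarrow> d x y * v y powr (-q)"
        using neq[of x]
      proof eventually_elim
        case (elim y)
        from d[OF elim] have "((\<lambda>t. (norm (t *\<^sub>R x - y) powr p - norm (1 *\<^sub>R x - y) powr p) / (t - 1)) \<longlongrightarrow> d x y) (at 1)"
          by (simp add: has_field_derivative_iff)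
        from filterlim_compose[OF this filt] show ?case unfolding Q_def by (intro tendsto_mult_right) simp
      qed
    qed
    have bound: "\<bar>(u (T k *\<^sub>R x) - u x) / (T k - 1)\<bar> \<le> C * (1 + norm x powr p)" for k x
    proof -
      have "\<bar>(u (T k *\<^sub>R x) - u x) / (T k - 1)\<bar> \<le> (\<integral>y. H x y \<partial>lborel)"
        unfolding quot
      proof (rule order_trans[OF integral_abs_bound integral_mono_AE])
        have "integrable lborel (\<lambda>y. Q k x y)"
        proof (rule integrable_bound'[OF iH mq])
          show "AE y in lborel. norm (Q k x y) \<le> norm (H x y)"
            using dm[of k x] by eventually_elim simp
        qed
        then show "integrable lborel (\<lambda>y. \<bar>Q k x y\<bar>)"
          by (rule integrable_abs)
        show "AE y in lborel. \<bar>Q k x y\<bar> \<le> H x y"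
          using dm[of k x] by simp
      qed (rule iH)
      then show ?thesis using H_le[of x] by linarith
    qed
    have Gm: "G \<in> borel_measurable lborel"
      by (rule borel_measurable_LIMSEQ_real[OF inner]) measurable
    have lim: "(\<lambda>k. \<integral>x. (u (T k *\<^sub>R x) - u x) / (T k - 1) * u x powr (-q) \<partial>lborel) \<longlonglongrightarrow> (\<integral>x. G x * u x powr (-q) \<partial>lborel)"
    proof (rule integral_dominated_convergence)
      show "integrable lborel (\<lambda>x. C * (u x powr (-q) + norm x powr p * u x powr (-q)))"
        by (intro integrable_mult_right integrable_add' u_neg_power_int u_moment_int)
      show "AE x in lborel. (\<lambda>k. (u (T k *\<^sub>R x) - u x) / (T k - 1) * u x powr (-q)) \<longlonglongrightarrow> G x * u x powr (-q)"
        using inner by (intro AE_I2 tendsto_mult_right) auto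
      fix k
      have "norm ((u (T k *\<^sub>R x) - u x) / (T k - 1) * u x powr (-q)) \<le> C * (u x powr (-q) + norm x powr p * u x powr (-q))" for x
      proof -
        have "norm ((u (T k *\<^sub>R x) - u x) / (T k - 1) * u x powr (-q)) = \<bar>(u (T k *\<^sub>R x) - u x) / (T k - 1)\<bar> * u x powr (-q)"
          unfolding real_norm_def abs_mult by simp
        also have "\<dots> \<le> C * (1 + norm x powr p) * u x powr (-q)" by (intro mult_right_mono bound) simp
        also have "\<dots> = C * (u x powr (-q) + norm x powr p * u x powr (-q))" by (simp add: algebra_simps)
        finally show ?thesis .
      qed
      then show "AE x in lborel. norm ((u (T k *\<^sub>R x) - u x) / (T k - 1) * u x powr (-q)) \<le> C * (u x powr (-q) + norm x powr p * u x powr (-q))"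
        by simp
    qed (use Gm in measurable)
    have quots: "(\<integral>x. (u (T k *\<^sub>R x) - u x) / (T k - 1) * u x powr (-q) \<partial>lborel) = (dilation_pairing (T k) - dilation_pairing 1) / (T k - 1)" for k
    proof -
      have "(dilation_pairing (T k) - dilation_pairing 1) / (T k - 1)
        = (\<integral>x. (u (T k *\<^sub>R x) * u x powr (-q) - u (1 *\<^sub>R x) * u x powr (-q)) / (T k - 1) \<partial>lborel)"
        using dilation_pairing_int[of "T k"] dilation_pairing_int[of 1]
        by (simp add: dilation_pairing_def integral_diff')
      then show ?thesis by (auto simp: left_diff_distrib)
    qed
    show "(\<lambda>k. (dilation_pairing (T k) - dilation_pairing 1) / (T k - 1)) \<longlonglongrightarrow>
        (\<integral>x. (\<integral>y. d x y * v y powr (-q) \<partial>lborel) * u x powr (-q) \<partial>lborel)"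
      using lim unfolding quots G_def .
  qed
  then obtain D where D: "\<And>T. (\<And>k. T k \<noteq> 1) \<Longrightarrow> (\<And>k. 0 \<le> T k \<and> T k \<le> 2) \<Longrightarrow> T \<longlonglongrightarrow> 1 \<Longrightarrow>
     (\<lambda>k. (dilation_pairing (T k) - dilation_pairing 1) / (T k - 1)) \<longlonglongrightarrow> D" by blast
  have "((\<lambda>t. (dilation_pairing t - dilation_pairing 1) / (t - 1)) \<longlongrightarrow> D) (at 1 within {0..2})"
    unfolding tendsto_at_iff_sequentially o_def using D by auto
  moreover have "at 1 within {0..2} = at (1::real)" by (rule at_within_interior) auto
  ultimately have "(dilation_pairing has_real_derivative D) (at 1)" by (simp add: has_field_derivative_iff)
  then show ?thesis by blast
qed

text \<open>A differentiable function that touches two lower bounds at \<open>1\<close> has the slope of both. The slopes are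
\<open>n I / (q - 1)\<close> and \<open>p I - n I / (q - 1)\<close>, where \<open>I\<close> is the common value at \<open>1\<close>.\<close>
theorem critical_exponent: "p * q = p + 2 * real CARD('n)"
proof -
  interpret sw: neg_power_pair v u p q by (rule swapped)
  define n where "n = real CARD('n)"
  define I where "I = dilation_pairing 1"
  have I: "I > 0" using dilation_pairing_1_pos by (simp add: I_def)
  have Isw: "sw.dilation_pairing 1 = I" using dilation_pairing_swap[of 1] by (simp add: I_def)
  obtain D where D: "(dilation_pairing has_real_derivative D) (at 1)"
    using dilation_pairing_differentiable by blast
  have q1: "q - 1 > 0" using q_gt_1 by simp
  have "((\<lambda>t. dilation_pairing t - I * (1 + (1 - t powr (- n)) / (q - 1))) has_real_derivative D - I * (n / (q - 1))) (at 1)"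
    using q1 by (auto intro!: derivative_eq_intros D)
  then have 1: "D - I * (n / (q - 1)) = 0"
    by (rule DERIV_local_min[where d = 1])
       (use dilation_pairing_lower in \<open>auto simp: I_def n_def abs_if split: if_splits\<close>)
  have "((\<lambda>t. dilation_pairing t - t powr p * (I * (1 + (1 - t powr n) / (q - 1)))) has_real_derivative
      D - (p * I - I * (n / (q - 1)))) (at 1)"
    using q1 by (auto intro!: derivative_eq_intros D)
  then have 2: "D - (p * I - I * (n / (q - 1))) = 0"
  proof (rule DERIV_local_min[where d = 1])
    show "\<forall>t. \<bar>1 - t\<bar> < 1 \<longrightarrow> dilation_pairing 1 - 1 powr p * (I * (1 + (1 - 1 powr n) / (q - 1)))
        \<le> dilation_pairing t - t powr p * (I * (1 + (1 - t powr n) / (q - 1)))"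
    proof (intro allI impI)
      fix t :: real assume "\<bar>1 - t\<bar> < 1"
      then have t: "t > 0" by auto
      have "I * (1 + (1 - (1 / t) powr (- n)) / (q - 1)) \<le> sw.dilation_pairing (1 / t)"
        using sw.dilation_pairing_lower[of "1 / t"] t by (simp add: Isw n_def)
      moreover have "(1 / t) powr (- n) = t powr n" using t by (simp add: powr_divide powr_minus)
      ultimately have "t powr p * (I * (1 + (1 - t powr n) / (q - 1))) \<le> dilation_pairing t"
        unfolding dilation_pairing_swap[OF t] by (simp add: mult_left_mono)
      then show "dilation_pairing 1 - 1 powr p * (I * (1 + (1 - 1 powr n) / (q - 1)))
        \<le> dilation_pairing t - t powr p * (I * (1 + (1 - t powr n) / (q - 1)))" by (simp add: I_def)
    qed
  qed simp
  from 1 2 have "p * I = 2 * (I * (n / (q - 1)))" by simp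
  then have "I * (p * (q - 1)) = I * (2 * n)" using q1 by (simp add: field_simps)
  then have "p * (q - 1) = 2 * n" using I by simp
  then show ?thesis by (simp add: n_def algebra_simps)
qed

end

section \<open>The Kelvin transform\<close>

definition kelvin :: "real \<Rightarrow> real \<Rightarrow> (real ^ 'n \<Rightarrow> real) \<Rightarrow> real ^ 'n \<Rightarrow> real" where
  "kelvin p r w z = (norm z / r) powr p * w (inversion r z)"

text \<open>The kernel of the potential of the reflected mass, normalised by the weight of the Kelvin transform. In this form
it is visibly symmetric and larger than \<open>norm (x - z) powr p\<close> when both points lie outside the sphere.\<close>
definition reflected_kernel :: "real \<Rightarrow> real \<Rightarrow> 'a::real_normed_vector \<Rightarrow> 'a \<Rightarrow> real" where
  "reflected_kernel p r x z =
    ((norm (x - z))\<^sup>2 + ((norm x)\<^sup>2 - r\<^sup>2) * ((norm z)\<^sup>2 - r\<^sup>2) / r\<^sup>2) powr (p / 2)"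

lemma powr_eq_square_powr_half: "a \<ge> 0 \<Longrightarrow> a powr p = (a\<^sup>2) powr (p / 2)" for a :: real
  by (cases "a = 0") (simp_all add: powr_powr flip: powr_numeral)

lemma inversion_distance:
  fixes x z :: "'a::real_inner"
  assumes "r > 0" "z \<noteq> 0"
  shows "(norm (x - inversion r z) * (norm z / r))\<^sup>2
    = (norm (x - z))\<^sup>2 + ((norm x)\<^sup>2 - r\<^sup>2) * ((norm z)\<^sup>2 - r\<^sup>2) / r\<^sup>2"
proof -
  have nz: "z \<bullet> z \<noteq> 0" using assms by simp
  have a: "(norm (x - inversion r z))\<^sup>2 = x \<bullet> x - 2 * (r\<^sup>2 / (z \<bullet> z)) * (x \<bullet> z) + (r\<^sup>2 / (z \<bullet> z))\<^sup>2 * (z \<bullet> z)"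
    by (simp only: inversion_def power2_norm_eq_inner)
      (simp add: inner_diff_left inner_diff_right inner_commute power2_eq_square algebra_simps)
  have b: "(norm z / r)\<^sup>2 = (z \<bullet> z) / r\<^sup>2" by (simp add: power_divide power2_norm_eq_inner)
  have c: "(norm (x - z))\<^sup>2 = x \<bullet> x - 2 * (x \<bullet> z) + z \<bullet> z"
    by (simp add: power2_norm_eq_inner inner_diff_left inner_diff_right inner_commute)
  show ?thesis
    unfolding power_mult_distrib a b c
    unfolding power2_norm_eq_inner
    using nz assms by (simp add: field_simps power2_eq_square)
qed

lemma kernel_reflect_right:
  fixes x z :: "'a::real_inner"
  assumes "r > 0" "z \<noteq> 0"
  shows "norm (x - inversion r z) powr p * (norm z / r) powr p = reflected_kernel p r x z"
proof -
  have "norm (x - inversion r z) powr p * (norm z / r) powr p = (norm (x - inversion r z) * (norm z / r)) powr p"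
    by (simp only: powr_mult)
  also have "\<dots> = ((norm (x - inversion r z) * (norm z / r))\<^sup>2) powr (p / 2)"
    by (rule powr_eq_square_powr_half) (use assms in auto)
  finally show ?thesis by (simp only: inversion_distance[OF assms] reflected_kernel_def)
qed

lemma reflected_kernel_commute: "reflected_kernel p r x z = reflected_kernel p r z x"
  by (simp add: reflected_kernel_def norm_minus_commute mult.commute)

lemma kernel_reflect_left:
  fixes x z :: "'a::real_inner"
  assumes "r > 0" "x \<noteq> 0"
  shows "(norm x / r) powr p * norm (inversion r x - z) powr p = reflected_kernel p r x z"
  using kernel_reflect_right[OF assms, of z p] by (simp add: reflected_kernel_commute norm_minus_commute mult.commute)

lemma kernel_reflect_both:
  fixes x z :: "'a::real_inner"
  assumes r: "r > 0" and x: "x \<noteq> 0" and z: "z \<noteq> 0"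
  shows "(norm x / r) powr p * (norm (inversion r x - inversion r z) powr p * (norm z / r) powr p) = norm (x - z) powr p"
proof -
  have "(norm x / r) powr p * (norm (inversion r x - inversion r z) powr p * (norm z / r) powr p)
    = reflected_kernel p r x (inversion r z) * (norm z / r) powr p"
    using kernel_reflect_left[OF r x, of p "inversion r z"] by simp
  also have "reflected_kernel p r x (inversion r z) = norm (x - z) powr p * (r / norm z) powr p"
    using kernel_reflect_right[OF r, of "inversion r z" x p] r z
    by (simp add: inversion_involution norm_inversion power2_eq_square)
  also have "norm (x - z) powr p * (r / norm z) powr p * (norm z / r) powr p = norm (x - z) powr p"
    using r z by (simp add: powr_divide)
  finally show ?thesis .
qed

lemma reflected_kernel_ge:
  fixes x z :: "'a::real_normed_vector"
  assumes "r > 0" "p > 0" "norm x \<ge> r" "norm z \<ge> r"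
  shows "norm (x - z) powr p \<le> reflected_kernel p r x z"
  unfolding reflected_kernel_def powr_eq_square_powr_half[OF norm_ge_zero]
  using assms by (intro powr_mono2) (auto intro!: divide_nonneg_nonneg mult_nonneg_nonneg power_mono)

lemma reflected_kernel_gt:
  fixes x z :: "'a::real_normed_vector"
  assumes "r > 0" "p > 0" "norm x > r" "norm z > r"
  shows "norm (x - z) powr p < reflected_kernel p r x z"
  unfolding reflected_kernel_def powr_eq_square_powr_half[OF norm_ge_zero]
  using assms by (intro powr_less_mono2) (auto intro!: divide_pos_pos mult_pos_pos power_strict_mono)

lemma reflected_kernel_le:
  fixes x z :: "'a::real_inner"
  assumes r: "r > 0" and p: "p > 0" and R: "r \<le> R" and x: "norm x \<le> R" and z: "r \<le> norm z" "norm z \<le> R"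
  shows "reflected_kernel p r x z \<le> (2 * R * (R / r)) powr p"
proof -
  have nz: "z \<noteq> 0" using r z by auto
  have "r\<^sup>2 / norm z \<le> r" using r z nz by (simp add: power2_eq_square divide_le_eq)
  then have "norm (x - inversion r z) \<le> 2 * R"
    using norm_triangle_ineq4[of x "inversion r z"] norm_inversion[OF nz, of r] x R by linarith
  moreover have "norm z / r \<le> R / r" using z r by (simp add: divide_right_mono)
  ultimately have "norm (x - inversion r z) * (norm z / r) \<le> 2 * R * (R / r)"
    using r R by (intro mult_mono) auto
  then have "(norm (x - inversion r z) * (norm z / r)) powr p \<le> (2 * R * (R / r)) powr p"
    using p r by (intro powr_mono2) auto
  then show ?thesis using kernel_reflect_right[OF r nz, of x p] by (simp only: powr_mult)
qed

lemma kelvin_fixed_sphere: "r > 0 \<Longrightarrow> norm z = r \<Longrightarrow> kelvin p r w z = w z"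
  by (simp add: kelvin_def inversion_def)

lemma AE_norm_neq: "AE y :: 'a::euclidean_space in lborel. norm y \<noteq> r"
proof -
  have "sphere (0 :: 'a) r \<in> null_sets lborel"
    using negligible_sphere[of "0 :: 'a" r] by (simp add: negligible_iff_null_sets null_sets_completion_iff)
  from AE_not_in[OF this] show ?thesis by (simp add: sphere_def)
qed

lemma kelvin_measurable [measurable]:
  fixes w :: "real ^ 'n \<Rightarrow> real"
  assumes [measurable]: "w \<in> borel_measurable borel" shows "kelvin p r w \<in> borel_measurable borel"
  unfolding kelvin_def[abs_def] by measurable

context neg_power_pair
begin

lemma kelvin_v_pos: "r > 0 \<Longrightarrow> z \<noteq> 0 \<Longrightarrow> kelvin p r v z > 0"
  using v_pos[of "inversion r z"] by (simp add: kelvin_def)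

text \<open>At the critical exponent the Jacobian is absorbed by the Kelvin transform.\<close>
lemma jacobian_kelvin:
  assumes r: "r > 0" and z: "z \<noteq> 0"
  shows "(r / norm z) ^ (2 * CARD('n)) * v (inversion r z) powr (-q)
    = (norm z / r) powr p * kelvin p r v z powr (-q)"
proof -
  define t where "t = norm z / r"
  have t: "t > 0" using r z by (simp add: t_def)
  have "(r / norm z) ^ (2 * CARD('n)) = t powr (- (2 * real CARD('n)))"
  proof -
    have "r / norm z = inverse t" by (simp add: t_def)
    then show ?thesis using t by (simp add: powr_minus powr_realpow[symmetric] power_inverse)
  qed
  \<comment> \<open>The critical exponent enters here.\<close>
  also have "- (2 * real CARD('n)) = p + p * (-q)" using critical_exponent by simp
  also have "t powr (p + p * (-q)) = t powr p * (t powr p) powr (-q)" by (simp only: powr_add powr_powr)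
  finally show ?thesis using t v_pos[of "inversion r z"]
    by (simp add: kelvin_def t_def[symmetric] powr_mult)
qed

text \<open>An integral against the weight is split at the sphere, and the part inside the sphere is folded outwards.\<close>
lemma fold_exterior:
  assumes r: "r > 0" and h[measurable]: "h \<in> borel_measurable borel"
    and int: "integrable lborel (\<lambda>y. h y * v y powr (-q))"
  shows "integrable lborel (\<lambda>z. indicator {z. r < norm z} z * (h z * v z powr (-q)))" (is ?I1)
    and "integrable lborel (\<lambda>z. indicator {z. r < norm z} z * (h (inversion r z) * (norm z / r) powr p * kelvin p r v z powr (-q)))" (is ?I2)
    and "(\<integral>y. h y * v y powr (-q) \<partial>lborel) =
      (\<integral>z. indicator {z. r < norm z} z * (h z * v z powr (-q)) \<partial>lborel) +
      (\<integral>z. indicator {z. r < norm z} z * (h (inversion r z) * (norm z / r) powr p * kelvin p r v z powr (-q)) \<partial>lborel)" (is ?E)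
proof -
  have m: "(\<lambda>y. h y * v y powr (-q)) \<in> borel_measurable borel" by measurable
  have eq: "indicator {z. r < norm z} z * ((r / norm z) ^ (2 * CARD('n)) * (h (inversion r z) * v (inversion r z) powr (-q)))
    = indicator {z. r < norm z} z * (h (inversion r z) * (norm z / r) powr p * kelvin p r v z powr (-q))" for z
  proof (cases "r < norm z")
    case True
    then have "z \<noteq> 0" using r by auto
    from jacobian_kelvin[OF r this] show ?thesis by simp
  qed simp
  have A: "{z. r < norm z} \<in> sets lborel" "{z. norm z < r} \<in> sets lborel" for r :: real by measurable
  show I1: ?I1 using integrable_mult_indicator[OF A(1) int] by simp
  have I0: "integrable lborel (\<lambda>y. indicator {y. norm y < r} y * (h y * v y powr (-q)))"
    using integrable_mult_indicator[OF A(2) int] by simp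
  show I2: ?I2 using integral_inversion(1)[OF r m] I0 unfolding eq by simp
  have "(\<integral>y. h y * v y powr (-q) \<partial>lborel) =
     (\<integral>y. indicator {y. r < norm y} y * (h y * v y powr (-q)) + indicator {y. norm y < r} y * (h y * v y powr (-q)) \<partial>lborel)"
  proof (rule integral_cong_AE)
    show "AE y in lborel. h y * v y powr (-q) = indicator {y. r < norm y} y * (h y * v y powr (-q)) + indicator {y. norm y < r} y * (h y * v y powr (-q))"
      using AE_norm_neq[of r] by eventually_elim (auto simp: indicator_def)
  qed measurable
  also have "\<dots> = (\<integral>y. indicator {y. r < norm y} y * (h y * v y powr (-q)) \<partial>lborel) + (\<integral>y. indicator {y. norm y < r} y * (h y * v y powr (-q)) \<partial>lborel)"
    by (rule integral_add'[OF I1 I0])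
  also have "(\<integral>y. indicator {y. norm y < r} y * (h y * v y powr (-q)) \<partial>lborel)
    = (\<integral>z. indicator {z. r < norm z} z * (h (inversion r z) * (norm z / r) powr p * kelvin p r v z powr (-q)) \<partial>lborel)"
    unfolding integral_inversion(2)[OF r m] eq ..
  finally show ?E .
qed

abbreviation weight_gap :: "real \<Rightarrow> real ^ 'n \<Rightarrow> real" where
  "weight_gap r z \<equiv> v z powr (-q) - kelvin p r v z powr (-q)"

text \<open>Fold both potentials, at \<open>x\<close> and at its reflection. The kernels \<open>norm (x - z) powr p\<close> and \<open>reflected_kernel p r x z\<close>
then appear with exchanged weights, so the difference factorises.\<close>
lemma kelvin_difference:
  assumes r: "r > 0" and x: "x \<noteq> 0"
  defines "G \<equiv> \<lambda>z. indicator {z. r < norm z} z *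
     ((reflected_kernel p r x z - norm (x - z) powr p) * weight_gap r z)"
  shows "integrable lborel G" and "kelvin p r u x - u x = (\<integral>z. G z \<partial>lborel)"
proof -
  let ?W = "\<lambda>z. kelvin p r v z powr (-q)"
  let ?ind = "\<lambda>z :: real ^ 'n. indicator {z. r < norm z} z :: real"
  let ?c = "(norm x / r) powr p"
  have m: "(\<lambda>z. norm (x' - z) powr p) \<in> borel_measurable borel" for x' :: "real ^ 'n" by measurable
  have nz: "z \<noteq> 0" if "r < norm z" for z :: "real ^ 'n" using that r by auto
  note F = fold_exterior[OF r m u_int, of x] and F' = fold_exterior[OF r m u_int, of "inversion r x"]
  have e1: "?ind z * (norm (x - inversion r z) powr p * (norm z / r) powr p * ?W z) = ?ind z * (reflected_kernel p r x z * ?W z)" for z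
    using kernel_reflect_right[OF r nz, of z x p] by (cases "r < norm z") auto
  have e2: "?c * (?ind z * (norm (inversion r x - z) powr p * v z powr (-q))) = ?ind z * (reflected_kernel p r x z * v z powr (-q))" for z
    using kernel_reflect_left[OF r x, of p z] by (cases "r < norm z") (auto simp flip: mult.assoc)
  have e3: "?c * (?ind z * (norm (inversion r x - inversion r z) powr p * (norm z / r) powr p * ?W z)) = ?ind z * (norm (x - z) powr p * ?W z)" for z
    using kernel_reflect_both[OF r x nz, of z p] by (cases "r < norm z") (auto simp flip: mult.assoc)
  have i1: "integrable lborel (\<lambda>z. ?ind z * (norm (x - z) powr p * v z powr (-q)))" by (rule F(1))
  have i2: "integrable lborel (\<lambda>z. ?ind z * (reflected_kernel p r x z * ?W z))" using F(2) unfolding e1 .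
  have i3: "integrable lborel (\<lambda>z. ?ind z * (reflected_kernel p r x z * v z powr (-q)))"
    using integrable_mult_right[OF F'(1), of ?c] unfolding e2 .
  have i4: "integrable lborel (\<lambda>z. ?ind z * (norm (x - z) powr p * ?W z))"
    using integrable_mult_right[OF F'(2), of ?c] unfolding e3 .
  have U: "u x = (\<integral>z. ?ind z * (norm (x - z) powr p * v z powr (-q)) \<partial>lborel) + (\<integral>z. ?ind z * (reflected_kernel p r x z * ?W z) \<partial>lborel)"
    using F(3) unfolding e1 u_eq[symmetric] .
  have "kelvin p r u x = ?c * (\<integral>z. ?ind z * (norm (inversion r x - z) powr p * v z powr (-q)) \<partial>lborel)
     + ?c * (\<integral>z. ?ind z * (norm (inversion r x - inversion r z) powr p * (norm z / r) powr p * ?W z) \<partial>lborel)"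
    using F'(3) unfolding u_eq[symmetric] kelvin_def by (simp only: distrib_left)
  also have "\<dots> = (\<integral>z. ?ind z * (reflected_kernel p r x z * v z powr (-q)) \<partial>lborel) + (\<integral>z. ?ind z * (norm (x - z) powr p * ?W z) \<partial>lborel)"
    unfolding integral_mult_right_zero[symmetric] e2 e3 ..
  finally have K: "kelvin p r u x = (\<integral>z. ?ind z * (reflected_kernel p r x z * v z powr (-q)) \<partial>lborel) + (\<integral>z. ?ind z * (norm (x - z) powr p * ?W z) \<partial>lborel)" .
  have G: "G = (\<lambda>z. (?ind z * (reflected_kernel p r x z * v z powr (-q)) + ?ind z * (norm (x - z) powr p * ?W z))
      - (?ind z * (norm (x - z) powr p * v z powr (-q)) + ?ind z * (reflected_kernel p r x z * ?W z)))"
    unfolding G_def by (rule ext) (simp add: algebra_simps)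
  show "integrable lborel G" unfolding G
    by (intro integrable_diff' integrable_add' i1 i2 i3 i4)
  show "kelvin p r u x - u x = (\<integral>z. G z \<partial>lborel)" unfolding G K U
    by (simp add: integral_diff' integral_add' i1 i2 i3 i4)
qed

text \<open>The limit of \<open>kelvin_difference\<close>, divided by \<open>\<bar>x\<bar>\<^sup>p\<close>, as \<open>\<bar>x\<bar> \<rightarrow> \<infinity>\<close>; it is obtained directly by folding the two
moments.\<close>
lemma kelvin_difference_at_infinity:
  assumes r: "r > 0"
  defines "G \<equiv> \<lambda>z. indicator {z. r < norm z} z *
     (((norm z / r) powr p - 1) * weight_gap r z)"
  shows "integrable lborel G" and "u 0 / r powr p - neg_mass q v = (\<integral>z. G z \<partial>lborel)"
proof -
  let ?W = "\<lambda>z. kelvin p r v z powr (-q)"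
  let ?ind = "\<lambda>z :: real ^ 'n. indicator {z. r < norm z} z :: real"
  have nz: "z \<noteq> 0" if "r < norm z" for z :: "real ^ 'n" using that r by auto
  have m1: "(\<lambda>z :: real ^ 'n. norm z powr p / r powr p) \<in> borel_measurable borel" by measurable
  have m2: "(\<lambda>z :: real ^ 'n. 1 :: real) \<in> borel_measurable borel" by measurable
  have j1: "integrable lborel (\<lambda>y. norm y powr p / r powr p * v y powr (-q))"
    using integrable_mult_right[OF v_moment_int, of "1 / r powr p"] by simp
  have j2: "integrable lborel (\<lambda>y. 1 * v y powr (-q))" using v_neg_power_int by simp
  note F = fold_exterior[OF r m1 j1] and F' = fold_exterior[OF r m2 j2]
  have e1: "?ind z * (norm (inversion r z) powr p / r powr p * (norm z / r) powr p * ?W z) = ?ind z * ?W z" for z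
  proof (cases "r < norm z")
    case True
    have "norm (inversion r z) powr p / r powr p * (norm z / r) powr p = (norm (inversion r z) / r * (norm z / r)) powr p"
      using r by (simp add: powr_mult powr_divide)
    also have "norm (inversion r z) / r * (norm z / r) = 1"
      using nz[OF True] r by (simp add: norm_inversion power2_eq_square)
    finally show ?thesis by (simp only: powr_one_eq_one mult_1_left)
  qed simp
  have e2: "norm z powr p / r powr p = (norm z / r) powr p" for z :: "real ^ 'n" using r by (simp add: powr_divide)
  have i1: "integrable lborel (\<lambda>z. ?ind z * ((norm z / r) powr p * v z powr (-q)))" using F(1) unfolding e2 .
  have i2: "integrable lborel (\<lambda>z. ?ind z * ?W z)" using F(2) unfolding e1 .
  have i3: "integrable lborel (\<lambda>z. ?ind z * v z powr (-q))" using F'(1) by simp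
  have i4: "integrable lborel (\<lambda>z. ?ind z * ((norm z / r) powr p * ?W z))" using F'(2) by simp
  have "u 0 / r powr p = (\<integral>y. norm y powr p / r powr p * v y powr (-q) \<partial>lborel)" by (simp add: u_0)
  also have "\<dots> = (\<integral>z. ?ind z * ((norm z / r) powr p * v z powr (-q)) \<partial>lborel) + (\<integral>z. ?ind z * ?W z \<partial>lborel)"
    unfolding F(3) e1 unfolding e2 ..
  finally have U: "u 0 / r powr p = (\<integral>z. ?ind z * ((norm z / r) powr p * v z powr (-q)) \<partial>lborel) + (\<integral>z. ?ind z * ?W z \<partial>lborel)" .
  have M: "neg_mass q v = (\<integral>z. ?ind z * v z powr (-q) \<partial>lborel) + (\<integral>z. ?ind z * ((norm z / r) powr p * ?W z) \<partial>lborel)"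
    using F'(3) by (simp add: neg_mass_def)
  have G: "G = (\<lambda>z. (?ind z * ((norm z / r) powr p * v z powr (-q)) + ?ind z * ?W z)
      - (?ind z * v z powr (-q) + ?ind z * ((norm z / r) powr p * ?W z)))"
    unfolding G_def by (rule ext) (simp add: algebra_simps)
  show "integrable lborel G" unfolding G
    by (intro integrable_diff' integrable_add' i1 i2 i3 i4)
  show "u 0 / r powr p - neg_mass q v = (\<integral>z. G z \<partial>lborel)" unfolding G U M
    by (simp add: integral_diff' integral_add' i1 i2 i3 i4)
qed

end

section \<open>Moving spheres: small radii\<close>

lemma isCont_inversion:
  fixes z :: "'a::real_inner"
  assumes "z \<noteq> 0" shows "isCont (inversion r) z"
  unfolding inversion_def[abs_def] using assms by (intro continuous_intros) auto

context neg_power_pair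
begin

definition kelvin_above :: "real \<Rightarrow> bool" where
  "kelvin_above r \<longleftrightarrow> (\<forall>z. r \<le> norm z \<longrightarrow> u z \<le> kelvin p r u z \<and> v z \<le> kelvin p r v z)"

lemma kelvin_above_swap: "neg_power_pair.kelvin_above v u p r \<longleftrightarrow> kelvin_above r"
  unfolding neg_power_pair.kelvin_above_def[OF swapped] kelvin_above_def by blast

lemma isCont_u: "isCont u x"
  using u_cont by (simp add: continuous_on_eq_continuous_at)

lemma kelvin_u_continuous: "continuous_on (- {0}) (kelvin p r u)"
proof (rule continuous_at_imp_continuous_on, rule ballI)
  fix z :: "real ^ 'n" assume "z \<in> - {0}"
  then have z: "z \<noteq> 0" by simp
  show "isCont (kelvin p r u) z" unfolding kelvin_def[abs_def]
  proof (intro continuous_mult)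
    show "isCont (\<lambda>z. (norm z / r) powr p) z"
      using z by (cases "r = 0") (auto intro!: continuous_intros)
    show "isCont (\<lambda>z. u (inversion r z)) z"
      by (rule isCont_o2[OF isCont_inversion[OF z] isCont_u])
  qed
qed

lemma kelvin_u_tendsto_radius:
  assumes R: "R \<longlonglongrightarrow> r" and r: "r > 0" and z: "z \<noteq> 0"
  shows "(\<lambda>k. kelvin p (R k) u z) \<longlonglongrightarrow> kelvin p r u z"
  unfolding kelvin_def
proof (intro tendsto_mult)
  show "(\<lambda>k. (norm z / R k) powr p) \<longlonglongrightarrow> (norm z / r) powr p"
    using R r z by (intro tendsto_intros) auto
  have "(\<lambda>k. inversion (R k) z) \<longlonglongrightarrow> inversion r z"
    unfolding inversion_def using R r z by (intro tendsto_intros) auto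
  then show "(\<lambda>k. u (inversion (R k) z)) \<longlonglongrightarrow> u (inversion r z)"
    by (rule isCont_tendsto_compose[OF isCont_u])
qed

lemma kelvin_u_ge:
  assumes r: "r > 0" and z: "r \<le> norm z" and m: "m > 0" "\<And>x. m \<le> u x"
  shows "m \<le> kelvin p r u z"
proof -
  have "1 \<le> (norm z / r) powr p" using r z p_pos by (intro ge_one_powr_ge_zero) auto
  then have "1 * m \<le> (norm z / r) powr p * u (inversion r z)" using m by (intro mult_mono) auto
  then show ?thesis by (simp add: kelvin_def)
qed

text \<open>In \<open>kelvin_difference\<close> only points where \<open>v\<close> exceeds its transform contribute positively to \<open>u - u\<^sub>r\<close>. They lie
in \<open>D\<close>, where the kernel is bounded and the difference of weights is at most a multiple of \<open>S\<close>.\<close>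
lemma narrow_difference_bound:
  assumes r: "r > 0" and R: "r \<le> R" and m: "m > 0" "\<And>x. m \<le> v x"
    and D[measurable]: "D \<in> sets borel" and D_bounded: "\<And>z. z \<in> D \<Longrightarrow> norm z \<le> R"
    and out: "\<And>z. r \<le> norm z \<Longrightarrow> z \<notin> D \<Longrightarrow> v z \<le> kelvin p r v z"
    and S: "\<And>z. r \<le> norm z \<Longrightarrow> norm z \<le> R \<Longrightarrow> v z - kelvin p r v z \<le> S" "S \<ge> 0"
    and x: "r \<le> norm x" "norm x \<le> R"
  shows "u x - kelvin p r u x \<le> (2 * R * (R / r)) powr p * (q * m powr (-q - 1)) * measure lborel D * S"
proof -
  interpret sw: neg_power_pair v u p q by (rule swapped)
  define c where "c = (2 * R * (R / r)) powr p * (q * m powr (-q - 1))"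
  have c: "c \<ge> 0" using q_pos by (simp add: c_def)
  have x0: "x \<noteq> 0" using x r by auto
  let ?G = "\<lambda>z. indicator {z. r < norm z} z *
     ((reflected_kernel p r x z - norm (x - z) powr p) * (v z powr (-q) - kelvin p r v z powr (-q)))"
  note G = kelvin_difference[OF r x0]
  have finD: "emeasure lborel D < \<infinity>"
  proof (rule emeasure_bounded_finite)
    show "bounded D" using D_bounded by (auto simp: bounded_iff)
  qed
  have le: "- ?G z \<le> c * S * indicator D z" for z
  proof (cases "r < norm z")
    case True
    then have z: "r \<le> norm z" by simp
    have K: "norm (x - z) powr p \<le> reflected_kernel p r x z"
      by (rule reflected_kernel_ge[OF r p_pos x(1) z])
    have km: "m \<le> kelvin p r v z" by (rule sw.kelvin_u_ge[OF r z m])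
    show ?thesis
    proof (cases "z \<in> D")
      case zD: True
      have K2: "reflected_kernel p r x z \<le> (2 * R * (R / r)) powr p"
        by (rule reflected_kernel_le[OF r p_pos R x(2) z D_bounded[OF zD]])
      have "kelvin p r v z powr (-q) - v z powr (-q) \<le> q * m powr (-q - 1) * max 0 (v z - kelvin p r v z)"
        by (rule neg_powr_diff_le[OF q_pos m(1) km m(2)])
      also have "\<dots> \<le> q * m powr (-q - 1) * S"
        using q_pos S(1)[OF z D_bounded[OF zD]] S(2) by (intro mult_left_mono) auto
      finally have W: "kelvin p r v z powr (-q) - v z powr (-q) \<le> q * m powr (-q - 1) * S" .
      have "(reflected_kernel p r x z - norm (x - z) powr p) * (kelvin p r v z powr (-q) - v z powr (-q))
        \<le> (reflected_kernel p r x z - norm (x - z) powr p) * (q * m powr (-q - 1) * S)"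
        using K W by (intro mult_left_mono) auto
      also have "\<dots> \<le> (2 * R * (R / r)) powr p * (q * m powr (-q - 1) * S)"
        using K2 q_pos S(2) by (intro mult_right_mono) (auto simp: add_increasing2 diff_le_eq)
      finally show ?thesis using True zD by (simp add: c_def algebra_simps)
    next
      case zD: False
      have "kelvin p r v z powr (-q) \<le> v z powr (-q)"
        using out[OF z zD] v_pos[of z] q_pos by (intro powr_mono2') auto
      then have "?G z \<ge> 0" using K by (intro mult_nonneg_nonneg) auto
      then show ?thesis using zD by simp
    qed
  qed (use c S in simp)
  have "u x - kelvin p r u x = (\<integral>z. - ?G z \<partial>lborel)" using G(2) by simp
  also have "\<dots> \<le> (\<integral>z. c * S * indicator D z \<partial>lborel)"
  proof (rule integral_mono)
    show "integrable lborel (\<lambda>z. - ?G z)" using G(1) by (rule Bochner_Integration.integrable_minus)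
    show "integrable lborel (\<lambda>z. c * S * indicat_real D z)"
      using finD by (intro integrable_mult_right integrable_real_indicator) auto
  qed (rule le)
  also have "\<dots> = c * measure lborel D * S" by simp
  finally show ?thesis by (simp add: c_def)
qed

definition bad_set :: "real \<Rightarrow> (real ^ 'n) set" where
  "bad_set r = {z. r \<le> norm z \<and> (kelvin p r u z < u z \<or> kelvin p r v z < v z)}"

lemma bad_set_measurable [measurable]: "bad_set r \<in> sets borel"
  unfolding bad_set_def by measurable

lemma kelvin_above_iff: "kelvin_above r \<longleftrightarrow> bad_set r = {}"
  unfolding kelvin_above_def bad_set_def by (auto simp: not_less)

text \<open>Let \<open>S\<close> be the supremum of the failure of the two inequalities. The bounds for \<open>u - u\<^sub>r\<close> and \<open>v - v\<^sub>r\<close>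
together give \<open>S \<le> \<theta> S\<close> with \<open>\<theta> < 1\<close>, so \<open>S = 0\<close>.\<close>
lemma narrow_region:
  assumes r: "r > 0" and R: "r \<le> R" and m: "m > 0" "\<And>x. m \<le> u x" "\<And>x. m \<le> v x"
    and bad: "\<And>z. z \<in> bad_set r \<Longrightarrow> norm z \<le> R"
    and small: "(2 * R * (R / r)) powr p * (q * m powr (-q - 1)) * measure lborel (bad_set r) < 1"
  shows "kelvin_above r"
proof -
  interpret sw: neg_power_pair v u p q by (rule swapped)
  define \<theta> where "\<theta> = (2 * R * (R / r)) powr p * (q * m powr (-q - 1)) * measure lborel (bad_set r)"
  define E where "E z = max 0 (max (u z - kelvin p r u z) (v z - kelvin p r v z))" for z
  define A where "A = {z :: real ^ 'n. r \<le> norm z \<and> norm z \<le> R}"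
  obtain e :: "real ^ 'n" where e: "norm e = 1" using nonempty_Basis norm_Basis by blast
  have "r *\<^sub>R e \<in> A" using e r R by (simp add: A_def)
  then have A_ne: "A \<noteq> {}" by blast
  obtain Cu where Cu: "Cu > 0" "\<And>x. u x \<le> Cu * (1 + norm x powr p)" using u_upper by blast
  obtain Cv where Cv: "Cv > 0" "\<And>x. v x \<le> Cv * (1 + norm x powr p)" using sw.u_upper by blast
  have bdd: "bdd_above (E ` A)"
  proof (rule bdd_aboveI2)
    fix z assume "z \<in> A"
    then have z: "z \<noteq> 0" "norm z powr p \<le> R powr p" using r p_pos by (auto simp: A_def intro!: powr_mono2)
    have "u z \<le> Cu * (1 + R powr p)" using z(2) Cu by (intro order_trans[OF Cu(2)] mult_left_mono) auto
    moreover have "v z \<le> Cv * (1 + R powr p)" using z(2) Cv by (intro order_trans[OF Cv(2)] mult_left_mono) auto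
    moreover have "kelvin p r u z > 0" "kelvin p r v z > 0" using sw.kelvin_v_pos kelvin_v_pos z r by auto
    moreover have "Cu * (1 + R powr p) > 0" "Cv * (1 + R powr p) > 0" using Cu Cv by (auto simp: add_pos_nonneg)
    ultimately show "E z \<le> Cu * (1 + R powr p) + Cv * (1 + R powr p)" unfolding E_def by auto
  qed
  define S where "S = (SUP z\<in>A. E z)"
  have ES: "E z \<le> S" if "z \<in> A" for z unfolding S_def by (rule cSUP_upper[OF that bdd])
  have S0: "S \<ge> 0" using ES[OF \<open>r *\<^sub>R e \<in> A\<close>] by (auto simp: E_def)
  have \<theta>0: "\<theta> \<ge> 0" using q_pos by (simp add: \<theta>_def)
  have "E x \<le> \<theta> * S" if "x \<in> A" for x
  proof -
    have x: "r \<le> norm x" "norm x \<le> R" using that by (auto simp: A_def)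
    have "u x - kelvin p r u x \<le> \<theta> * S" unfolding \<theta>_def
    proof (rule narrow_difference_bound[OF r R m(1,3) bad_set_measurable bad _ _ S0 x])
      show "r \<le> norm z \<Longrightarrow> z \<notin> bad_set r \<Longrightarrow> v z \<le> kelvin p r v z" for z by (auto simp: bad_set_def)
      show "r \<le> norm z \<Longrightarrow> norm z \<le> R \<Longrightarrow> v z - kelvin p r v z \<le> S" for z
        using ES[of z] by (auto simp: A_def E_def)
    qed
    moreover have "v x - kelvin p r v x \<le> \<theta> * S" unfolding \<theta>_def
    proof (rule sw.narrow_difference_bound[OF r R m(1,2) bad_set_measurable bad _ _ S0 x])
      show "r \<le> norm z \<Longrightarrow> z \<notin> bad_set r \<Longrightarrow> u z \<le> kelvin p r u z" for z by (auto simp: bad_set_def)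
      show "r \<le> norm z \<Longrightarrow> norm z \<le> R \<Longrightarrow> u z - kelvin p r u z \<le> S" for z
        using ES[of z] by (auto simp: A_def E_def)
    qed
    ultimately show ?thesis using \<theta>0 S0 by (simp add: E_def)
  qed
  then have "S \<le> \<theta> * S" unfolding S_def using A_ne by (intro cSUP_least) auto
  moreover have "\<theta> < 1" using small by (simp add: \<theta>_def)
  ultimately have "S \<le> 0" using S0 by (smt (verit) mult_le_cancel_right1)
  show ?thesis unfolding kelvin_above_iff
  proof (rule ccontr)
    assume "bad_set r \<noteq> {}"
    then obtain z where z: "z \<in> bad_set r" by blast
    then have "z \<in> A" using bad by (auto simp: A_def bad_set_def)
    moreover have "E z > 0" using z by (auto simp: E_def bad_set_def)
    ultimately show False using ES[of z] \<open>S \<le> 0\<close> by simp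
  qed
qed

lemma common_lower_bound: "\<exists>m>0. (\<forall>x. m \<le> u x) \<and> (\<forall>x. m \<le> v x)"
proof -
  obtain a where a: "a > 0" "\<And>x. a \<le> u x" using u_lower_const by blast
  obtain b where b: "b > 0" "\<And>x. b \<le> v x" using neg_power_pair.u_lower_const[OF swapped] by blast
  have "min a b > 0" using a b by simp
  moreover have "min a b \<le> u x" "min a b \<le> v x" for x using a(2)[of x] b(2)[of x] by auto
  ultimately show ?thesis by blast
qed

text \<open>Far outside a small sphere, \<open>u\<^sub>r\<close> is at least \<open>(\<bar>z\<bar>/r)\<^sup>p m\<close>, whereas \<open>u\<close> grows at most like \<open>C (1 + \<bar>z\<bar>\<^sup>p)\<close>.\<close>
lemma kelvin_u_large:
  assumes r: "r > 0" and m: "m > 0" "\<And>x. m \<le> u x" and C: "C > 0" "\<And>x. u x \<le> C * (1 + norm x powr p)"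
    and rp: "r powr p \<le> m / (2 * C)" and M: "M powr p \<ge> 2 * C / m" "M \<ge> 0" and z: "norm z > M * r"
  shows "u z \<le> kelvin p r u z"
proof -
  have nz: "norm z > 0" using z M(2) r by (meson le_less_trans mult_nonneg_nonneg less_imp_le)
  have rpp: "r powr p > 0" using r by simp
  have "M \<le> norm z / r" using z r by (simp add: pos_le_divide_eq)
  then have "M powr p \<le> (norm z / r) powr p" using M p_pos by (intro powr_mono2) auto
  then have 1: "C \<le> (norm z / r) powr p * (m / 2)"
    using M(1) m(1) C(1) by (smt (verit) divide_le_eq mult.commute mult_2 field_sum_of_halves mult_left_mono times_divide_eq_right)
  have "C * r powr p \<le> m / 2" using rp C(1) by (simp add: field_simps)
  then have "C * r powr p * (norm z / r) powr p \<le> m / 2 * (norm z / r) powr p" by (intro mult_right_mono) auto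
  moreover have "C * r powr p * (norm z / r) powr p = C * norm z powr p" using r by (simp add: powr_divide)
  ultimately have 2: "C * norm z powr p \<le> (norm z / r) powr p * (m / 2)" by (simp add: mult.commute)
  have "u z \<le> C + C * norm z powr p" using C(2)[of z] by (simp add: distrib_left)
  also have "\<dots> \<le> (norm z / r) powr p * m" using 1 2 by simp
  also have "\<dots> \<le> kelvin p r u z" unfolding kelvin_def using m by (intro mult_left_mono) auto
  finally show ?thesis .
qed

text \<open>For small \<open>r\<close> the inequalities can fail only at distance at most \<open>M r\<close>, with \<open>M\<close> independent of \<open>r\<close>. This is a narrow
region.\<close>
lemma kelvin_above_small: "\<exists>r>0. kelvin_above r"
proof -
  interpret sw: neg_power_pair v u p q by (rule swapped)
  obtain m where m: "m > 0" "\<And>x. m \<le> u x" "\<And>x. m \<le> v x" using common_lower_bound by blast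
  obtain Cu where Cu: "Cu > 0" "\<And>x. u x \<le> Cu * (1 + norm x powr p)" using u_upper by blast
  obtain Cv where Cv: "Cv > 0" "\<And>x. v x \<le> Cv * (1 + norm x powr p)" using sw.u_upper by blast
  define C where "C = max Cu Cv"
  have C: "C > 0" "\<And>x. u x \<le> C * (1 + norm x powr p)" "\<And>x. v x \<le> C * (1 + norm x powr p)"
    using Cu Cv by (auto simp: C_def intro!: order_trans[OF Cu(2)] order_trans[OF Cv(2)] mult_right_mono)
  \<comment> \<open>Chosen so that \<open>M\<^sup>p m \<ge> 2 C\<close>: half of \<open>(\<bar>z\<bar>/r)\<^sup>p m\<close> then exceeds the constant \<open>C\<close> beyond \<open>M r\<close>.\<close>
  define M where "M = max 1 ((2 * C / m) powr (1 / p))"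
  have M1: "M \<ge> 1" by (simp add: M_def)
  have Mp: "M powr p \<ge> 2 * C / m"
  proof -
    have "2 * C / m = ((2 * C / m) powr (1 / p)) powr p" using m C p_pos by (simp add: powr_powr)
    also have "\<dots> \<le> M powr p" using p_pos by (intro powr_mono2) (auto simp: M_def)
    finally show ?thesis .
  qed
  define B where "B = q * m powr (-q - 1) * measure lborel (cball (0 :: real ^ 'n) M)"
  have "((\<lambda>r. (2 * M * M * r) powr p * B) \<longlongrightarrow> (2 * M * M * 0) powr p * B) (at_right 0)"
    using p_pos M1 by (intro tendsto_intros tendsto_powr') (auto simp: eventually_at_filter)
  then have lim1: "((\<lambda>r. (2 * M * M * r) powr p * B) \<longlongrightarrow> 0) (at_right 0)" using p_pos by simp
  have "((\<lambda>r :: real. r powr p) \<longlongrightarrow> 0 powr p) (at_right 0)"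
    using p_pos by (intro tendsto_intros tendsto_powr') (auto simp: eventually_at_filter)
  then have lim2: "((\<lambda>r :: real. r powr p) \<longlongrightarrow> 0) (at_right 0)" using p_pos by simp
  have "\<forall>\<^sub>F r in at_right 0. (2 * M * M * r) powr p * B < 1 \<and> r powr p < m / (2 * C) \<and> 0 < r \<and> r < (1 :: real)"
  proof -
    have "\<forall>\<^sub>F r in at_right 0. (2 * M * M * r) powr p * B < 1" using order_tendstoD(2)[OF lim1, of 1] by simp
    moreover have "\<forall>\<^sub>F r in at_right 0. r powr p < m / (2 * C)"
      using order_tendstoD(2)[OF lim2, of "m / (2 * C)"] m C by simp
    moreover have "\<forall>\<^sub>F r in at_right 0. r < (1 :: real)"
      using order_tendstoD(2)[OF tendsto_ident_at, of "0 :: real" 1] by simp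
    ultimately show ?thesis using eventually_at_right_less[of "0 :: real"] by eventually_elim auto
  qed
  then obtain r where r: "(2 * M * M * r) powr p * B < 1" "r powr p < m / (2 * C)" "0 < r" "r < 1"
    using eventually_happens[of _ "at_right (0 :: real)"] by (auto simp: trivial_limit_at_right_real)
  have "kelvin_above r"
  proof (rule narrow_region[OF r(3) _ m])
    show "r \<le> M * r" using M1 r by simp
    show bad: "norm z \<le> M * r" if "z \<in> bad_set r" for z
    proof (rule ccontr)
      assume "\<not> norm z \<le> M * r"
      then have "u z \<le> kelvin p r u z" "v z \<le> kelvin p r v z"
        using kelvin_u_large[OF r(3) m(1,2) C(1,2) _ Mp, of z] sw.kelvin_u_large[OF r(3) m(1,3) C(1,3) _ Mp, of z] r M1 by auto
      then show False using that by (auto simp: bad_set_def)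
    qed
    have "measure lborel (bad_set r) \<le> measure lborel (cball (0 :: real ^ 'n) M)"
    proof (rule measure_mono_fmeasurable)
      show "bad_set r \<subseteq> cball 0 M"
      proof
        fix z assume "z \<in> bad_set r"
        from bad[OF this] have "norm z \<le> M * r" .
        also have "\<dots> \<le> M * 1" using M1 r by (intro mult_left_mono) auto
        finally show "z \<in> cball 0 M" by simp
      qed
      show "cball (0 :: real ^ 'n) M \<in> fmeasurable lborel"
        by (intro fmeasurableI emeasure_bounded_finite) (auto simp: emeasure_bounded_finite)
    qed auto
    then have "(2 * (M * r) * (M * r / r)) powr p * (q * m powr (-q - 1)) * measure lborel (bad_set r)
      \<le> (2 * (M * r) * (M * r / r)) powr p * (q * m powr (-q - 1)) * measure lborel (cball (0 :: real ^ 'n) M)"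
      using q_pos by (intro mult_left_mono) auto
    also have "\<dots> = (2 * M * M * r) powr p * B" using r by (simp add: B_def mult_ac)
    finally show "(2 * (M * r) * (M * r / r)) powr p * (q * m powr (-q - 1)) * measure lborel (bad_set r) < 1"
      using r(1) by simp
  qed
  then show ?thesis using r by blast
qed

end

section \<open>Moving spheres: the critical radius\<close>

context neg_power_pair
begin

lemma kelvin_integrand_nonneg:
  assumes "r > 0" "kelvin_above r" "r < norm z"
  shows "0 \<le> weight_gap r z"
proof -
  have "v z \<le> kelvin p r v z" using assms by (simp add: kelvin_above_def)
  then have "kelvin p r v z powr (-q) \<le> v z powr (-q)" using v_pos[of z] q_pos by (intro powr_mono2') auto
  then show ?thesis by simp
qed

lemma mass_le_of_dominates:
  assumes r: "r > 0" and dom: "kelvin_above r"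
  shows "neg_mass q v \<le> u 0 / r powr p"
proof -
  have "0 \<le> (\<integral>z. indicator {z. r < norm z} z * (((norm z / r) powr p - 1) * weight_gap r z) \<partial>lborel)"
  proof (rule integral_nonneg')
    fix z :: "real ^ 'n"
    show "0 \<le> indicator {z. r < norm z} z * (((norm z / r) powr p - 1) * weight_gap r z)"
    proof (cases "r < norm z")
      case True
      then have "1 \<le> (norm z / r) powr p" using r p_pos by (intro ge_one_powr_ge_zero) auto
      then show ?thesis using kelvin_integrand_nonneg[OF r dom True] by simp
    qed simp
  qed
  then show ?thesis using kelvin_difference_at_infinity(2)[OF r] by simp
qed

text \<open>By continuity, strictness at one point holds on an open set, and this set is not null.\<close>
lemma strict_exterior_integral_pos:
  assumes r: "r > 0" and dom: "kelvin_above r"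
    and z0: "r < norm z0" "v z0 < kelvin p r v z0"
    and k: "\<And>z. r < norm z \<Longrightarrow> k z > 0"
    and int: "integrable lborel (\<lambda>z. indicator {z. r < norm z} z * (k z * weight_gap r z))"
  shows "0 < (\<integral>z. indicator {z. r < norm z} z * (k z * weight_gap r z) \<partial>lborel)"
proof (rule ccontr)
  let ?G = "\<lambda>z. indicator {z. r < norm z} z * (k z * weight_gap r z)"
  define N where "N = {z. r < norm z} \<inter> (\<lambda>z. kelvin p r v z - v z) -` {0<..}"
  have op: "open {z :: real ^ 'n. r < norm z}" by (intro open_Collect_less continuous_intros)
  have "continuous_on {z. r < norm z} (\<lambda>z. kelvin p r v z - v z)"
    using r by (intro continuous_on_diff continuous_on_subset[OF neg_power_pair.kelvin_u_continuous[OF swapped]] continuous_on_subset[OF v_cont]) auto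
  then have N: "open N" unfolding N_def by (rule continuous_open_preimage[OF _ op]) simp
  have G0: "?G z \<ge> 0" for z
    using kelvin_integrand_nonneg[OF r dom, of z] k[of z] by (cases "r < norm z") auto
  assume "\<not> 0 < (\<integral>z. ?G z \<partial>lborel)"
  moreover have "0 \<le> (\<integral>z. ?G z \<partial>lborel)" using G0 by (rule integral_nonneg')
  ultimately have "(\<integral>z. ?G z \<partial>lborel) = 0" by simp
  then have "AE z in lborel. ?G z = 0"
    using integral_nonneg_eq_0_iff_AE[OF int] G0 by simp
  then have "AE z in lborel. z \<notin> N"
  proof eventually_elim
    case (elim z)
    show "z \<notin> N"
    proof
      assume "z \<in> N"
      then have z: "r < norm z" "v z < kelvin p r v z" by (auto simp: N_def)
      then have "kelvin p r v z powr (-q) < v z powr (-q)" using v_pos[of z] q_pos by (intro powr_less_mono2_neg) auto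
      then have "?G z > 0" using z k[OF z(1)] by simp
      then show False using elim by simp
    qed
  qed
  moreover have "N \<noteq> {}" using z0 by (auto simp: N_def)
  ultimately show False using not_AE_lborel_outside_open[OF N] by blast
qed

lemma strict_dominance:
  assumes r: "r > 0" and dom: "kelvin_above r" and z0: "r < norm z0" "v z0 < kelvin p r v z0"
  shows "r < norm x \<Longrightarrow> u x < kelvin p r u x" and "neg_mass q v < u 0 / r powr p"
proof -
  show "u x < kelvin p r u x" if x: "r < norm x"
  proof -
    have x0: "x \<noteq> 0" using x r by auto
    have "0 < kelvin p r u x - u x" unfolding kelvin_difference(2)[OF r x0]
      by (rule strict_exterior_integral_pos[OF r dom z0 _ kelvin_difference(1)[OF r x0]])
         (use reflected_kernel_gt[OF r p_pos x] in simp)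
    then show ?thesis by simp
  qed
  have "0 < u 0 / r powr p - neg_mass q v" unfolding kelvin_difference_at_infinity(2)[OF r]
  proof (rule strict_exterior_integral_pos[OF r dom z0 _ kelvin_difference_at_infinity(1)[OF r]])
    fix z :: "real ^ 'n" assume "r < norm z"
    then show "0 < (norm z / r) powr p - 1" using r p_pos by (simp add: gr_one_powr)
  qed
  then show "neg_mass q v < u 0 / r powr p" by simp
qed

text \<open>Strictness of one inequality at one point makes the other strict everywhere, also at infinity, and hence
the first one too. Otherwise the integrand in \<open>kelvin_difference\<close> vanishes.\<close>
lemma dominates_dichotomy:
  assumes r: "r > 0" and dom: "kelvin_above r"
  shows "(\<forall>z. r < norm z \<longrightarrow> kelvin p r u z = u z \<and> kelvin p r v z = v z) \<or>
    ((\<forall>z. r < norm z \<longrightarrow> u z < kelvin p r u z \<and> v z < kelvin p r v z) \<and>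
      neg_mass q v < u 0 / r powr p \<and> neg_mass q u < v 0 / r powr p)"
proof -
  interpret sw: neg_power_pair v u p q by (rule swapped)
  have swdom: "sw.kelvin_above r" using dom kelvin_above_swap by blast
  obtain e :: "real ^ 'n" where e: "norm e = 1" using nonempty_Basis norm_Basis by blast
  have far: "r < norm ((2 * r) *\<^sub>R e)" using e r by simp
  show ?thesis
  proof (cases "\<exists>z0. r < norm z0 \<and> v z0 < kelvin p r v z0")
    case True
    then obtain z0 where z0: "r < norm z0" "v z0 < kelvin p r v z0" by blast
    note 1 = strict_dominance[OF r dom z0]
    note 2 = sw.strict_dominance[OF r swdom far 1(1)[OF far]]
    show ?thesis using 1 2 by blast
  next
    case False
    have v: "kelvin p r v z = v z" if z: "r < norm z" for z
    proof -
      have "v z \<le> kelvin p r v z" using dom z by (simp add: kelvin_above_def)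
      moreover have "\<not> v z < kelvin p r v z" using False z by blast
      ultimately show ?thesis by simp
    qed
    have "kelvin p r u z = u z" if z: "r < norm z" for z
    proof -
      have z0: "z \<noteq> 0" using z r by auto
      have "(\<integral>y. indicator {y. r < norm y} y * ((reflected_kernel p r z y - norm (z - y) powr p) * weight_gap r y) \<partial>lborel) = integral\<^sup>L lborel (\<lambda>y :: real ^ 'n. 0 :: real)"
        by (rule integral_cong') (auto simp: indicator_def v)
      then show ?thesis using kelvin_difference(2)[OF r z0] by simp
    qed
    then show ?thesis using v by blast
  qed
qed

text \<open>Strictness at infinity persists, uniformly, for slightly larger radii, because the Kelvin transform at a
distant point only sees \<open>u\<close> near the origin.\<close>
lemma dominates_near_infinity:
  assumes r: "r > 0" and strict: "neg_mass q v < u 0 / r powr p"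
  shows "\<exists>\<epsilon>>0. \<exists>R. \<forall>s z. r \<le> s \<and> s \<le> r + \<epsilon> \<and> R \<le> norm z \<longrightarrow> u z \<le> kelvin p s u z"
proof -
  obtain \<beta> where \<beta>: "neg_mass q v < \<beta>" "\<beta> < u 0 / r powr p" using dense[OF strict] by blast
  have \<beta>0: "\<beta> > 0" using \<beta>(1) mass_v_pos by linarith
  obtain R1 where R1: "\<And>x. norm x \<ge> R1 \<Longrightarrow> u x \<le> \<beta> * norm x powr p"
    using u_asymptotic_upper[OF \<beta>(1)] by blast
  have "\<beta> * r powr p < u 0" using \<beta>(2) r by (simp add: pos_less_divide_eq)
  then obtain s where s: "\<beta> * r powr p < s" "s < u 0" using dense by blast
  have "\<forall>\<^sub>F x in nhds 0. s < u x"
    using order_tendstoD(1)[OF _ s(2)] isCont_u[of 0] by (simp add: isCont_def continuous_at tendsto_at_iff_tendsto_nhds)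
  then obtain d where d: "d > 0" "\<And>x. norm x < d \<Longrightarrow> s < u x"
    by (auto simp: eventually_nhds_metric)
  define g where "g t = \<beta> * t powr p" for t
  have "isCont g r" unfolding g_def[abs_def] using r by (intro continuous_intros) auto
  then have "(g \<longlongrightarrow> g r) (nhds r)" by (simp only: isCont_def tendsto_at_iff_tendsto_nhds)
  from order_tendstoD(2)[OF this, of s] s(1) have "\<forall>\<^sub>F t in nhds r. \<beta> * t powr p < s"
    by (simp add: g_def)
  then obtain d' where d': "d' > 0" "\<And>t. \<bar>t - r\<bar> < d' \<Longrightarrow> \<beta> * t powr p < s"
    by (auto simp: eventually_nhds_metric dist_real_def)
  define \<epsilon> where "\<epsilon> = d' / 2"
  define R where "R = max (max 1 R1) ((r + \<epsilon>)\<^sup>2 / d + 1)"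
  have \<epsilon>: "\<epsilon> > 0" using d' by (simp add: \<epsilon>_def)
  have "u z \<le> kelvin p t u z" if t: "r \<le> t" "t \<le> r + \<epsilon>" and z: "R \<le> norm z" for t z
  proof -
    have t0: "t > 0" using t r by simp
    have nz: "norm z > 0" "z \<noteq> 0" using z by (auto simp: R_def)
    have "(r + \<epsilon>)\<^sup>2 / d < norm z" using z by (simp add: R_def)
    then have "(r + \<epsilon>)\<^sup>2 < norm z * d" using d by (simp add: pos_divide_less_eq)
    moreover have "t\<^sup>2 \<le> (r + \<epsilon>)\<^sup>2" using t t0 by (intro power_mono) auto
    ultimately have "norm (inversion t z) < d"
      unfolding norm_inversion[OF nz(2)] using nz by (simp add: pos_divide_less_eq mult.commute)
    then have "s < u (inversion t z)" by (rule d(2))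
    moreover have "\<beta> * t powr p < s" using t d' by (intro d'(2)) (auto simp: \<epsilon>_def)
    ultimately have "\<beta> * t powr p * (norm z / t) powr p \<le> u (inversion t z) * (norm z / t) powr p"
      by (intro mult_right_mono) auto
    moreover have "\<beta> * t powr p * (norm z / t) powr p = \<beta> * norm z powr p" using t0 by (simp add: powr_divide)
    moreover have "u z \<le> \<beta> * norm z powr p" using z by (intro R1) (simp add: R_def)
    ultimately show ?thesis by (simp add: kelvin_def mult.commute)
  qed
  then show ?thesis using \<epsilon> by blast
qed

text \<open>As the radius decreases to \<open>r\<close>, the failure set stays bounded and leaves every point, so its measure tends to
zero by dominated convergence and it is eventually a narrow region.\<close>
lemma dominates_open_right:
  assumes r: "r > 0"
    and strict: "\<And>z. r < norm z \<Longrightarrow> u z < kelvin p r u z" "\<And>z. r < norm z \<Longrightarrow> v z < kelvin p r v z"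
    and infinity: "neg_mass q v < u 0 / r powr p" "neg_mass q u < v 0 / r powr p"
  shows "\<exists>s>r. kelvin_above s"
proof -
  interpret sw: neg_power_pair v u p q by (rule swapped)
  obtain m where m: "m > 0" "\<And>x. m \<le> u x" "\<And>x. m \<le> v x" using common_lower_bound by blast
  obtain \<epsilon>1 R1 where 1: "\<epsilon>1 > 0" "\<And>s z. r \<le> s \<Longrightarrow> s \<le> r + \<epsilon>1 \<Longrightarrow> R1 \<le> norm z \<Longrightarrow> u z \<le> kelvin p s u z"
    using dominates_near_infinity[OF r infinity(1)] by blast
  obtain \<epsilon>2 R2 where 2: "\<epsilon>2 > 0" "\<And>s z. r \<le> s \<Longrightarrow> s \<le> r + \<epsilon>2 \<Longrightarrow> R2 \<le> norm z \<Longrightarrow> v z \<le> kelvin p s v z"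
    using sw.dominates_near_infinity[OF r infinity(2)] by blast
  define \<epsilon> where "\<epsilon> = min \<epsilon>1 \<epsilon>2"
  define R where "R = max (max R1 R2) (r + \<epsilon>)"
  have \<epsilon>: "\<epsilon> > 0" using 1 2 by (simp add: \<epsilon>_def)
  \<comment> \<open>These radii stay in the range in which the failure set is uniformly bounded.\<close>
  define s where "s k = r + \<epsilon> / real (Suc k)" for k
  have s: "r < s k" "s k \<le> r + \<epsilon>" for k
    using \<epsilon> by (auto simp: s_def divide_le_eq mult_le_cancel_left1)
  have s_pos: "s k > 0" for k using s(1)[of k] r by simp
  have s_lim: "s \<longlonglongrightarrow> r"
    using tendsto_add[OF tendsto_const LIMSEQ_Suc[OF lim_const_over_n[of \<epsilon>]], of r] by (simp add: s_def[abs_def])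
  have bad: "norm z \<le> R" if "z \<in> bad_set (s k)" for z k
  proof (rule ccontr)
    assume "\<not> norm z \<le> R"
    then have "u z \<le> kelvin p (s k) u z" "v z \<le> kelvin p (s k) v z"
      using s[of k] by (auto intro!: 1 2 simp: R_def \<epsilon>_def)
    then show False using that by (auto simp: bad_set_def)
  qed
  have fin: "emeasure lborel (cball (0 :: real ^ 'n) R) < \<infinity>"
    by (intro emeasure_bounded_finite) simp
  have ptw: "(\<lambda>k. indicat_real (bad_set (s k)) z) \<longlonglongrightarrow> 0" for z
  proof (cases "r < norm z")
    case False
    then have "z \<notin> bad_set (s k)" for k using s(1)[of k] by (auto simp: bad_set_def)
    then show ?thesis by simp
  next
    case True
    then have z: "z \<noteq> 0" using r by auto
    have "\<forall>\<^sub>F k in sequentially. u z < kelvin p (s k) u z"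
      by (rule order_tendstoD(1)[OF kelvin_u_tendsto_radius[OF s_lim r z] strict(1)[OF True]])
    moreover have "\<forall>\<^sub>F k in sequentially. v z < kelvin p (s k) v z"
      by (rule order_tendstoD(1)[OF sw.kelvin_u_tendsto_radius[OF s_lim r z] strict(2)[OF True]])
    ultimately have "\<forall>\<^sub>F k in sequentially. indicat_real (bad_set (s k)) z = 0"
      by eventually_elim (auto simp: bad_set_def indicator_def)
    then show ?thesis by (rule tendsto_eventually)
  qed
  have "(\<lambda>k. \<integral>z. indicat_real (bad_set (s k)) z \<partial>lborel) \<longlonglongrightarrow> integral\<^sup>L lborel (\<lambda>z :: real ^ 'n. 0 :: real)"
  proof (rule integral_dominated_convergence)
    show "integrable lborel (indicat_real (cball (0 :: real ^ 'n) R))"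
      using fin by (intro integrable_real_indicator) auto
    show "AE z in lborel. norm (indicat_real (bad_set (s k)) z) \<le> indicat_real (cball 0 R) z" for k
      using bad[of _ k] by (intro AE_I2) (auto simp: indicator_def)
  qed (use ptw in auto)
  then have meas: "(\<lambda>k. measure lborel (bad_set (s k))) \<longlonglongrightarrow> 0" by simp
  have "(\<lambda>k. (2 * R * (R / s k)) powr p * (q * m powr (-q - 1)) * measure lborel (bad_set (s k)))
      \<longlonglongrightarrow> (2 * R * (R / r)) powr p * (q * m powr (-q - 1)) * 0"
    using r \<epsilon> by (intro tendsto_mult meas tendsto_const tendsto_powr tendsto_divide s_lim) (auto simp: R_def)
  then have "\<forall>\<^sub>F k in sequentially. (2 * R * (R / s k)) powr p * (q * m powr (-q - 1)) * measure lborel (bad_set (s k)) < 1"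
    by (rule order_tendstoD(2)) simp
  then obtain k where k: "(2 * R * (R / s k)) powr p * (q * m powr (-q - 1)) * measure lborel (bad_set (s k)) < 1"
    by (auto dest: eventually_happens)
  have "kelvin_above (s k)"
    by (rule narrow_region[OF s_pos _ m bad k]) (use s(2)[of k] in \<open>simp add: R_def\<close>)
  then show ?thesis using s(1) by blast
qed

lemma dominates_closed:
  assumes dom: "\<And>k. kelvin_above (s k)" and lim: "s \<longlonglongrightarrow> r" and le: "\<And>k. s k \<le> r" and r: "r > 0"
  shows "kelvin_above r"
  unfolding kelvin_above_def
proof (intro allI impI)
  fix z :: "real ^ 'n" assume z: "r \<le> norm z"
  then have z0: "z \<noteq> 0" using r by auto
  have "u z \<le> kelvin p (s k) u z" "v z \<le> kelvin p (s k) v z" for k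
    using dom[of k] le[of k] z by (auto simp: kelvin_above_def)
  then show "u z \<le> kelvin p r u z \<and> v z \<le> kelvin p r v z"
    using LIMSEQ_le_const[OF kelvin_u_tendsto_radius[OF lim r z0], of "u z"]
      LIMSEQ_le_const[OF neg_power_pair.kelvin_u_tendsto_radius[OF swapped lim r z0], of "v z"] by blast
qed

text \<open>Take the largest radius for which the inequalities hold. The values at the origin are read off from
\<open>kelvin_difference_at_infinity\<close>, whose integrand vanishes.\<close>
theorem kelvin_invariance:
  "\<exists>r>0. (\<forall>z. z \<noteq> 0 \<longrightarrow> kelvin p r u z = u z \<and> kelvin p r v z = v z) \<and>
     u 0 = r powr p * neg_mass q v \<and> v 0 = r powr p * neg_mass q u"
proof -
  interpret sw: neg_power_pair v u p q by (rule swapped)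
  define T where "T = {r. r > 0 \<and> kelvin_above r}"
  obtain r0 where r0: "r0 \<in> T" using kelvin_above_small by (auto simp: T_def)
  have "r \<le> (u 0 / neg_mass q v) powr (1 / p)" if "r \<in> T" for r
  proof -
    have r: "r > 0" "kelvin_above r" using that by (auto simp: T_def)
    have "r powr p \<le> u 0 / neg_mass q v"
      using mass_le_of_dominates[OF r] mass_v_pos r by (simp add: field_simps)
    then have "(r powr p) powr (1 / p) \<le> (u 0 / neg_mass q v) powr (1 / p)" using p_pos by (intro powr_mono2) auto
    then show ?thesis using r p_pos by (simp add: powr_powr)
  qed
  then have bdd: "bdd_above T" by (intro bdd_aboveI) auto
  define r where "r = Sup T"
  have le: "t \<le> r" if "t \<in> T" for t unfolding r_def by (rule cSup_upper[OF that bdd])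
  have r: "r > 0" using le[OF r0] r0 by (simp add: T_def)
  have "r \<in> closure T" unfolding r_def using r0 bdd by (intro closure_contains_Sup) auto
  then obtain s where s: "\<And>k. s k \<in> T" "s \<longlonglongrightarrow> r" by (auto simp: closure_sequential)
  have dom: "kelvin_above r"
    by (rule dominates_closed[OF _ s(2) le r]) (use s(1) in \<open>auto simp: T_def\<close>)
  have no: "\<not> kelvin_above t" if "t > r" for t
    using le[of t] that r by (auto simp: T_def)
  have out: "kelvin p r u z = u z \<and> kelvin p r v z = v z" if "r < norm z" for z
    using dominates_dichotomy[OF r dom] dominates_open_right[OF r] no that by blast
  have inv: "kelvin p r w z = w z"
    if z: "z \<noteq> 0" and w: "\<And>z. r < norm z \<Longrightarrow> kelvin p r w z = w z" for w :: "real ^ 'n \<Rightarrow> real" and z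
  proof (cases "norm z" r rule: linorder_cases)
    case less
    have nz: "norm z > 0" using z by simp
    have "r * norm z < r * r" using less r by simp
    then have "r < norm (inversion r z)"
      unfolding norm_inversion[OF z] using nz by (simp add: pos_less_divide_eq power2_eq_square)
    from w[OF this] have "w (inversion r z) = (r / norm z) powr p * w z"
      using r by (simp add: kelvin_def inversion_involution norm_inversion[OF z] power2_eq_square)
    then show ?thesis using r nz by (simp add: kelvin_def powr_divide)
  qed (use w kelvin_fixed_sphere[OF r] in auto)
  have zero: "(\<integral>z. indicator {z. r < norm z} z * (((norm z / r) powr p - 1) * weight_gap r z) \<partial>lborel) = integral\<^sup>L lborel (\<lambda>z :: real ^ 'n. 0 :: real)"
    "(\<integral>z. indicator {z. r < norm z} z * (((norm z / r) powr p - 1) * (u z powr (-q) - kelvin p r u z powr (-q))) \<partial>lborel) = integral\<^sup>L lborel (\<lambda>z :: real ^ 'n. 0 :: real)"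
    by (rule integral_cong'; auto simp: indicator_def out)+
  have "u 0 = r powr p * neg_mass q v" "v 0 = r powr p * neg_mass q u"
    using kelvin_difference_at_infinity(2)[OF r] sw.kelvin_difference_at_infinity(2)[OF r] zero r
    by (simp_all add: field_simps)
  then show ?thesis using r inv out by blast
qed

end

section \<open>Classification\<close>

context neg_power_pair
begin

text \<open>For \<open>p < 1\<close> the \<open>p\<close>-th moment is not enough. The weight decays like \<open>\<bar>y\<bar>\<^sup>-\<^sup>p\<^sup>-\<^sup>2\<^sup>n\<close>, and inversion in the unit
sphere turns the tail into the integral of \<open>\<bar>y\<bar>\<^sup>p\<^sup>-\<^sup>1\<close> over the unit ball.\<close>
lemma first_moment_int: "integrable lborel (\<lambda>y. norm y * v y powr (-q))"
proof (cases "p < 1")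
  case False
  show ?thesis
  proof (rule integrable_bound')
    show "integrable lborel (\<lambda>y. v y powr (-q) + norm y powr p * v y powr (-q))"
      by (intro integrable_add' v_neg_power_int v_moment_int)
    have "norm y \<le> 1 + norm y powr p" for y :: "real ^ 'n"
    proof (cases "norm y \<le> 1")
      case not1: False
      then have "norm y powr 1 \<le> norm y powr p" using False by (intro powr_mono) auto
      then show ?thesis by simp
    qed (simp add: add_increasing2)
    then have "norm y * v y powr (-q) \<le> (1 + norm y powr p) * v y powr (-q)" for y
      by (intro mult_right_mono) auto
    then show "AE y in lborel. norm (norm y * v y powr (-q)) \<le> norm (v y powr (-q) + norm y powr p * v y powr (-q))"
      by (intro AE_I2) (simp add: algebra_simps)
  qed measurable
next
  case True
  define n where "n = real CARD('n)"
  have n1: "n \<ge> 1" by (simp add: n_def Suc_leI)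
  have nD: "real DIM(real ^ 'n) = n" by (simp add: n_def)
  obtain c where c: "c > 0" "\<And>x. c * norm x powr p \<le> v x" using neg_power_pair.u_lower[OF swapped] by blast
  have a: "0 \<le> 1 - p" "1 - p < real DIM(real ^ 'n)" using True p_pos n1 unfolding nD by linarith+
  from nn_integral_norm_powr_le[OF a] obtain C1 where C1:
    "\<And>r. r > 0 \<Longrightarrow> (\<integral>\<^sup>+ z. ennreal (norm z powr (- (1 - p))) * indicator {z. norm z \<le> r} z \<partial>(lborel :: (real^'n) measure))
       \<le> ennreal (C1 * r powr (real DIM(real ^ 'n) - (1 - p)))" by blast
  have m: "(\<lambda>y :: real ^ 'n. norm y powr (p - 1)) \<in> borel_measurable borel" by measurable
  define J :: "real ^ 'n \<Rightarrow> real" where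
    "J y = indicator {z. 1 < norm z} y * ((1 / norm y) ^ (2 * CARD('n)) * norm (inversion 1 y) powr (p - 1))" for y
  have "integrable lborel (\<lambda>y :: real ^ 'n. indicator {y. norm y < 1} y * norm y powr (p - 1))"
  proof (rule integrableI_nonneg)
    show "(\<lambda>y :: real ^ 'n. indicator {y. norm y < 1} y * norm y powr (p - 1)) \<in> borel_measurable lborel"
      by measurable
    show "AE y :: real ^ 'n in lborel. 0 \<le> indicator {y. norm y < 1} y * norm y powr (p - 1)"
      by (intro AE_I2) (simp add: indicator_def)
    have "(\<integral>\<^sup>+ y. ennreal (indicator {y :: real ^ 'n. norm y < 1} y * norm y powr (p - 1)) \<partial>lborel)
      \<le> (\<integral>\<^sup>+ z. ennreal (norm z powr (- (1 - p))) * indicator {z. norm z \<le> 1} z \<partial>(lborel :: (real^'n) measure))"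
      by (intro nn_integral_mono) (auto simp: indicator_def)
    also have "\<dots> < \<infinity>" using C1[of 1] by (auto intro: le_less_trans)
    finally show "(\<integral>\<^sup>+ y. ennreal (indicator {y :: real ^ 'n. norm y < 1} y * norm y powr (p - 1)) \<partial>lborel) < \<infinity>" .
  qed
  then have i: "integrable lborel J"
    using integral_inversion(1)[OF _ m, of 1] unfolding J_def[abs_def] by simp
  have eq: "(1 / norm z) ^ (2 * CARD('n)) * norm (inversion 1 z) powr (p - 1) = norm z * norm z powr (- (p * q))"
    if "1 < norm z" for z :: "real ^ 'n"
  proof -
    have z: "z \<noteq> 0" "norm z > 0" using that by auto
    have "(1 / norm z) ^ (2 * CARD('n)) = norm z powr (- (2 * n))"
      using z by (simp add: powr_minus n_def powr_realpow[symmetric] power_one_over divide_inverse power_inverse)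
    moreover have "norm (inversion 1 z) powr (p - 1) = norm z powr (1 - p)"
      using z by (simp add: norm_inversion powr_divide powr_minus_divide[symmetric])
    moreover have "norm z powr (- (2 * n)) * norm z powr (1 - p) = norm z powr (1 + - (p * q))"
    proof -
      have "- (2 * n) + (1 - p) = 1 + - (p * q)" using critical_exponent by (simp add: n_def)
      then show ?thesis by (simp only: powr_add[symmetric])
    qed
    moreover have "norm z powr (1 + - (p * q)) = norm z * norm z powr (- (p * q))"
      using z by (simp only: powr_add) simp
    ultimately show ?thesis by (simp only:)
  qed
  show ?thesis
  proof (rule integrable_bound')
    show "integrable lborel (\<lambda>y. v y powr (-q) + c powr (-q) * J y)"
      by (intro integrable_add' v_neg_power_int integrable_mult_right i)
    have "norm y * v y powr (-q) \<le> v y powr (-q) + c powr (-q) * J y" for y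
    proof (cases "1 < norm y")
      case y: True
      have "y \<noteq> 0" using y by auto
      then have "v y powr (-q) \<le> (c * norm y powr p) powr (-q)"
        using c q_pos by (intro powr_mono2') auto
      also have "\<dots> = c powr (-q) * norm y powr (- (p * q))" using c by (simp add: powr_mult powr_powr)
      finally have "norm y * v y powr (-q) \<le> norm y * (c powr (-q) * norm y powr (- (p * q)))" by (intro mult_left_mono) auto
      also have "\<dots> \<le> v y powr (-q) + c powr (-q) * (norm y * norm y powr (- (p * q)))" by simp
      finally show ?thesis using y eq[OF y] by (simp add: J_def)
    next
      case False
      then have "norm y * v y powr (-q) \<le> 1 * v y powr (-q)" by (intro mult_right_mono) auto
      then show ?thesis using False by (simp add: J_def)
    qed
    then show "AE y in lborel. norm (norm y * v y powr (-q)) \<le> norm (v y powr (-q) + c powr (-q) * J y)"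
      by (intro AE_I2) (simp add: order_trans[OF _ abs_ge_self])
  qed measurable
qed

lemma mass_translate: "neg_mass q (\<lambda>x. v (x + c)) = neg_mass q v"
  unfolding neg_mass_def by (rule lborel_translate(2)[of "\<lambda>y. v y powr (-q)"]) measurable

lemma invariance_at:
  "\<exists>r>0. (\<forall>z. z \<noteq> 0 \<longrightarrow> u (x + z) = (norm z / r) powr p * u (x + inversion r z)) \<and>
     u x = r powr p * neg_mass q v \<and> v x = r powr p * neg_mass q u"
proof -
  interpret tr: neg_power_pair "\<lambda>y. u (y + x)" "\<lambda>y. v (y + x)" p q by (rule translated)
  from tr.kelvin_invariance show ?thesis
    unfolding mass_translate neg_power_pair.mass_translate[OF swapped] kelvin_def
    by (metis add.commute add_0)
qed

text \<open>Both functions are multiples of the \<open>p\<close>-th power of the same radius, so \<open>u = \<kappa> v\<close>. Comparing the masses gives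
\<open>\<kappa>\<^sup>1\<^sup>-\<^sup>q = 1\<close>.\<close>
lemma components_equal: "u = v"
proof -
  interpret sw: neg_power_pair v u p q by (rule swapped)
  define \<kappa> where "\<kappa> = neg_mass q v / neg_mass q u"
  have \<kappa>: "\<kappa> > 0" using mass_v_pos sw.mass_v_pos by (simp add: \<kappa>_def)
  have u: "u x = \<kappa> * v x" for x
  proof -
    obtain r where "u x = r powr p * neg_mass q v" "v x = r powr p * neg_mass q u" using invariance_at[of x] by blast
    then show ?thesis using sw.mass_v_pos by (simp add: \<kappa>_def)
  qed
  have "neg_mass q u = (\<integral>y. \<kappa> powr (-q) * v y powr (-q) \<partial>lborel)"
    unfolding neg_mass_def using \<kappa> by (simp add: u powr_mult)
  then have "neg_mass q u = \<kappa> powr (-q) * neg_mass q v" by (simp add: neg_mass_def)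
  then have "\<kappa> * \<kappa> powr (-q) = 1" using mass_v_pos sw.mass_v_pos \<kappa> by (simp add: \<kappa>_def field_simps)
  then have "\<kappa> powr (1 - q) = 1" using \<kappa> powr_add[of \<kappa> 1 "-q"] by simp
  then have "(\<kappa> powr (1 - q)) powr (1 / (1 - q)) = 1" by simp
  then have "\<kappa> = 1" using q_gt_1 \<kappa> by (simp add: powr_powr)
  then show ?thesis using u by (intro ext) simp
qed

text \<open>Inversion about \<open>x\<close> carries the line through \<open>x\<close> to infinity. In this representation the kernel is, for every \<open>y\<close>,
smooth in \<open>t\<close> near \<open>0\<close>, whereas \<open>\<bar>x + t e - y\<bar>\<^sup>p\<close> need not be so for \<open>y = x\<close>.\<close>
lemma u_on_line:
  assumes r: "r > 0" and inv: "\<And>z. z \<noteq> 0 \<Longrightarrow> u (x + z) = (norm z / r) powr p * u (x + inversion r z)"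
    and ux: "u x = r powr p * neg_mass q v" and e: "norm e = 1"
  shows "integrable lborel (\<lambda>y. norm (r *\<^sub>R e + (t / r) *\<^sub>R (x - y)) powr p * v y powr (-q))"
    and "u (x + t *\<^sub>R e) = (\<integral>y. norm (r *\<^sub>R e + (t / r) *\<^sub>R (x - y)) powr p * v y powr (-q) \<partial>lborel)"
proof -
  let ?P = "\<lambda>y. norm (r *\<^sub>R e + (t / r) *\<^sub>R (x - y)) powr p"
  have *: "integrable lborel (\<lambda>y. ?P y * v y powr (-q)) \<and>
     u (x + t *\<^sub>R e) = (\<integral>y. ?P y * v y powr (-q) \<partial>lborel)"
  proof (cases "t = 0")
    case True
    then show ?thesis using r e ux v_neg_power_int by (simp add: neg_mass_def)
  next
    case False
    define X where "X = x + inversion r (t *\<^sub>R e)"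
    have z: "t *\<^sub>R e \<noteq> 0" using False e by auto
    have eq: "?P y = (\<bar>t\<bar> / r) powr p * norm (X - y) powr p" for y
    proof -
      have "inversion r (t *\<^sub>R e) = (r\<^sup>2 / t) *\<^sub>R e"
        using False e by (simp add: inversion_def power2_eq_square)
      then have "(t / r) *\<^sub>R (X - y) = r *\<^sub>R e + (t / r) *\<^sub>R (x - y)"
        using False r by (simp add: X_def algebra_simps power2_eq_square)
      then have "norm (r *\<^sub>R e + (t / r) *\<^sub>R (x - y)) = (\<bar>t\<bar> / r) * norm (X - y)"
        using r by (metis abs_divide abs_of_pos norm_scaleR)
      then show ?thesis by (simp only: powr_mult)
    qed
    have "u (x + t *\<^sub>R e) = (\<bar>t\<bar> / r) powr p * u X" using inv[OF z] e by (simp add: X_def)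
    also have "\<dots> = (\<integral>y. (\<bar>t\<bar> / r) powr p * (norm (X - y) powr p * v y powr (-q)) \<partial>lborel)"
      by (simp add: u_eq[of X])
    finally show ?thesis using integrable_mult_right[OF u_int[of X], of "(\<bar>t\<bar> / r) powr p"]
      unfolding eq mult.assoc by blast
  qed
  then show "integrable lborel (\<lambda>y. ?P y * v y powr (-q))"
    and "u (x + t *\<^sub>R e) = (\<integral>y. ?P y * v y powr (-q) \<partial>lborel)" by blast+
qed

text \<open>The majorant for differentiating \<open>u_on_line\<close> at \<open>t = 0\<close>; in either case it is integrable by the available
moments of the weight.\<close>
lemma line_quotient_bound:
  assumes r: "r > 0" and e: "norm e = 1" and t: "\<bar>t\<bar> \<le> 1"
  shows "\<bar>norm (r *\<^sub>R e + (t / r) *\<^sub>R (x - y)) powr p - r powr p\<bar>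
    \<le> \<bar>t\<bar> * (if p < 1 then r powr (p - 1) / r * (norm x + norm y)
              else p * (2 powr p * (r powr p + (1 / r) powr p * (2 powr p * (norm x powr p + norm y powr p)))))"
proof -
  let ?B = "2 powr p * (r powr p + (1 / r) powr p * (2 powr p * (norm x powr p + norm y powr p)))"
  define a where "a = norm (r *\<^sub>R e + (t / r) *\<^sub>R (x - y))"
  have re: "norm (r *\<^sub>R e) = r" using r e by simp
  have d: "\<bar>a - r\<bar> \<le> \<bar>t\<bar> * (norm (x - y) / r)"
    using norm_triangle_ineq3[of "r *\<^sub>R e + (t / r) *\<^sub>R (x - y)" "r *\<^sub>R e"] r unfolding re a_def by simp
  have a0: "a \<ge> 0" by (simp add: a_def)
  show ?thesis
  proof (cases "p < 1")
    case True
    have "\<bar>a powr p - r powr p\<bar> \<le> \<bar>a - r\<bar> * r powr (p - 1)"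
      using True p_pos r a0 by (intro abs_diff_powr_le_concave) auto
    also have "\<dots> \<le> \<bar>t\<bar> * (norm (x - y) / r) * r powr (p - 1)" using d by (intro mult_right_mono) auto
    also have "\<dots> = \<bar>t\<bar> * (r powr (p - 1) / r * norm (x - y))" by simp
    also have "\<dots> \<le> \<bar>t\<bar> * (r powr (p - 1) / r * (norm x + norm y))"
      using r by (intro mult_left_mono norm_triangle_ineq4) auto
    finally show ?thesis using True by (simp add: a_def)
  next
    case False
    define c where "c = r + norm (x - y) / r"
    have nr: "norm (x - y) / r \<ge> 0" using r by simp
    have "\<bar>t\<bar> * (norm (x - y) / r) \<le> 1 * (norm (x - y) / r)" using t nr by (intro mult_right_mono) auto
    then have c: "a \<le> c" "r \<le> c" "norm (x - y) / r \<le> c" "c > 0" using d r nr by (auto simp: c_def)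
    have "\<bar>a powr p - r powr p\<bar> \<le> p * c powr (p - 1) * \<bar>a - r\<bar>"
      using False c a0 r by (intro abs_diff_powr_le_convex) auto
    also have "\<dots> \<le> p * c powr (p - 1) * (\<bar>t\<bar> * c)"
    proof (rule mult_left_mono)
      show "\<bar>a - r\<bar> \<le> \<bar>t\<bar> * c" using c(3) by (intro order_trans[OF d] mult_left_mono) auto
    qed (use p_pos in simp)
    also have "\<dots> = \<bar>t\<bar> * (p * c powr p)" using c by (simp add: powr_diff)
    also have "\<dots> \<le> \<bar>t\<bar> * (p * (?B))"
    proof (intro mult_left_mono)
      have "c powr p \<le> 2 powr p * (r powr p + (norm (x - y) / r) powr p)"
        unfolding c_def using r nr p_pos by (intro powr_add_le_two_powr) auto
      also have "(norm (x - y) / r) powr p = (1 / r) powr p * norm (x - y) powr p" using r by (simp add: powr_divide)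
      also have "2 powr p * (r powr p + \<dots>) \<le> ?B"
        using p_pos by (intro mult_left_mono add_left_mono norm_powr_diff_le) auto
      finally show "c powr p \<le> ?B" .
    qed (use p_pos in auto)
    finally show ?thesis using False by (simp add: a_def)
  qed
qed

definition barycenter :: "real ^ 'n" where
  "barycenter = (1 / neg_mass q v) *\<^sub>R (\<integral>y. v y powr (-q) *\<^sub>R y \<partial>lborel)"

lemma inner_moment:
  "integrable lborel (\<lambda>y. (e \<bullet> (x - y)) * v y powr (-q))"
  "(\<integral>y. (e \<bullet> (x - y)) * v y powr (-q) \<partial>lborel) = neg_mass q v * (e \<bullet> (x - barycenter))"
proof -
  have i: "integrable lborel (\<lambda>y. v y powr (-q) *\<^sub>R y)"
  proof (rule integrable_norm_cancel)
    show "integrable lborel (\<lambda>y. norm (v y powr (-q) *\<^sub>R y))" using first_moment_int by (simp add: mult.commute)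
  qed measurable
  have j: "integrable lborel (\<lambda>y. (e \<bullet> x) * v y powr (-q) - e \<bullet> (v y powr (-q) *\<^sub>R y))"
    by (intro integrable_diff' integrable_mult_right v_neg_power_int integrable_inner_right i)
  have eq: "(e \<bullet> (x - y)) * v y powr (-q) = (e \<bullet> x) * v y powr (-q) - e \<bullet> (v y powr (-q) *\<^sub>R y)" for y
    by (simp add: inner_diff_right algebra_simps)
  show "integrable lborel (\<lambda>y. (e \<bullet> (x - y)) * v y powr (-q))" using j unfolding eq .
  have "(\<integral>y. (e \<bullet> (x - y)) * v y powr (-q) \<partial>lborel) = (e \<bullet> x) * neg_mass q v - e \<bullet> (\<integral>y. v y powr (-q) *\<^sub>R y \<partial>lborel)"
    unfolding eq neg_mass_def
      integral_diff'[OF integrable_mult_right[OF v_neg_power_int] integrable_inner_right[OF i]]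
      integral_inner_right[OF i] integral_mult_right_zero ..
  also have "\<dots> = neg_mass q v * (e \<bullet> (x - barycenter))"
    using mass_v_pos by (simp add: barycenter_def inner_diff_right algebra_simps)
  finally show "(\<integral>y. (e \<bullet> (x - y)) * v y powr (-q) \<partial>lborel) = neg_mass q v * (e \<bullet> (x - barycenter))" .
qed

lemma u_line_derivative:
  assumes r: "r > 0" and inv: "\<And>z. z \<noteq> 0 \<Longrightarrow> u (x + z) = (norm z / r) powr p * u (x + inversion r z)"
    and ux: "u x = r powr p * neg_mass q v" and e: "norm e = 1"
  shows "((\<lambda>t. u (x + t *\<^sub>R e)) has_real_derivative p * r powr (p - 2) * (neg_mass q v * (e \<bullet> (x - barycenter)))) (at 0)"
proof -
  define k where "k t y = norm (r *\<^sub>R e + (t / r) *\<^sub>R (x - y)) powr p" for t y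
  have L: "integrable lborel (\<lambda>y. k t y * v y powr (-q))" "u (x + t *\<^sub>R e) = (\<integral>y. k t y * v y powr (-q) \<partial>lborel)" for t
    using u_on_line[OF r inv ux e, of t] unfolding k_def by blast+
  have k0: "k 0 y = r powr p" for y using r e by (simp add: k_def)
  have dk: "((\<lambda>t. k t y) has_real_derivative p * r powr (p - 2) * (e \<bullet> (x - y))) (at 0)" for y
  proof -
    \<comment> \<open>A power of a quadratic polynomial in \<open>t\<close> with the value \<open>r\<^sup>2 > 0\<close> at \<open>0\<close>, even for \<open>y = x\<close>.\<close>
    have keq: "k t y = (r\<^sup>2 + 2 * t * (e \<bullet> (x - y)) + (t / r)\<^sup>2 * ((x - y) \<bullet> (x - y))) powr (p / 2)" for t
    proof -
      have ee: "e \<bullet> e = 1" using e by (simp add: norm_eq_1)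
      have "(r *\<^sub>R e + (t / r) *\<^sub>R (x - y)) \<bullet> (r *\<^sub>R e + (t / r) *\<^sub>R (x - y))
         = r\<^sup>2 + 2 * t * (e \<bullet> (x - y)) + (t / r)\<^sup>2 * ((x - y) \<bullet> (x - y))"
        using r ee by (simp only: inner_add_left inner_add_right inner_scaleR_left inner_scaleR_right inner_commute[of "x - y" e])
          (simp add: field_simps power2_eq_square)
      then show ?thesis unfolding k_def powr_eq_square_powr_half[OF norm_ge_zero] power2_norm_eq_inner by simp
    qed
    have "((\<lambda>t. r\<^sup>2 + 2 * t * (e \<bullet> (x - y)) + (t / r)\<^sup>2 * ((x - y) \<bullet> (x - y))) has_real_derivative 2 * (e \<bullet> (x - y))) (at 0)"
      using r by (auto intro!: derivative_eq_intros)
    from DERIV_powr[OF this _ DERIV_const[of "p / 2"]] r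
    have "((\<lambda>t. (r\<^sup>2 + 2 * t * (e \<bullet> (x - y)) + (t / r)\<^sup>2 * ((x - y) \<bullet> (x - y))) powr (p / 2)) has_real_derivative
       (r\<^sup>2) powr (p / 2) * (2 * (e \<bullet> (x - y)) * (p / 2) / r\<^sup>2)) (at 0)" by simp
    moreover have "(r\<^sup>2) powr (p / 2) * (2 * (e \<bullet> (x - y)) * (p / 2) / r\<^sup>2) = p * r powr (p - 2) * (e \<bullet> (x - y))"
    proof -
      have "(r\<^sup>2) powr (p / 2) = r powr p" using powr_eq_square_powr_half[of r p] r by simp
      moreover have "r powr (p - 2) = r powr p / r\<^sup>2" using r by (simp add: powr_diff powr_numeral)
      ultimately show ?thesis by simp
    qed
    ultimately show ?thesis by (simp only: keq)
  qed
  define B where "B y = (if p < 1 then r powr (p - 1) / r * (norm x + norm y)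
      else p * (2 powr p * (r powr p + (1 / r) powr p * (2 powr p * (norm x powr p + norm y powr p)))))" for y :: "real ^ 'n"
  define H where "H y = B y * v y powr (-q)" for y
  have iH: "integrable lborel H"
  proof (cases "p < 1")
    case True
    have "H = (\<lambda>y. r powr (p - 1) / r * (norm x * v y powr (-q) + norm y * v y powr (-q)))"
      using True by (intro ext) (simp add: H_def B_def algebra_simps add_divide_distrib)
    then show ?thesis
      by (simp only:) (intro integrable_mult_right integrable_add' v_neg_power_int first_moment_int)
  next
    case False
    have "H = (\<lambda>y. p * (2 powr p * (r powr p * v y powr (-q) + (1 / r) powr p * (2 powr p * (norm x powr p * v y powr (-q) + norm y powr p * v y powr (-q))))))"
      using False by (intro ext) (simp add: H_def B_def algebra_simps)
    then show ?thesis
      by (simp only:) (intro integrable_mult_right integrable_add' v_neg_power_int v_moment_int)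
  qed
  have "((\<lambda>t. (u (x + t *\<^sub>R e) - u x) / t) \<longlongrightarrow> p * r powr (p - 2) * (neg_mass q v * (e \<bullet> (x - barycenter)))) (at 0 within {-1..1})"
    unfolding tendsto_at_iff_sequentially o_def
  proof (intro allI impI)
    fix T :: "nat \<Rightarrow> real" assume T0: "\<forall>i. T i \<in> {-1..1} - {0}" and T: "T \<longlonglongrightarrow> 0"
    have filt: "filterlim T (at 0) sequentially" using T T0 by (simp add: filterlim_at)
    have quot: "(u (x + T i *\<^sub>R e) - u x) / T i = (\<integral>y. (k (T i) y - k 0 y) / T i * v y powr (-q) \<partial>lborel)" for i
    proof -
      have "(u (x + T i *\<^sub>R e) - u (x + 0 *\<^sub>R e)) / T i = (\<integral>y. (k (T i) y * v y powr (-q) - k 0 y * v y powr (-q)) / T i \<partial>lborel)"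
        unfolding L(2) integral_divide_zero integral_diff'[OF L(1) L(1)] ..
      then show ?thesis by (simp add: left_diff_distrib)
    qed
    have "(\<lambda>i. \<integral>y. (k (T i) y - k 0 y) / T i * v y powr (-q) \<partial>lborel) \<longlonglongrightarrow> (\<integral>y. p * r powr (p - 2) * (e \<bullet> (x - y)) * v y powr (-q) \<partial>lborel)"
    proof (rule integral_dominated_convergence[OF _ _ iH])
      show "(\<lambda>y. p * r powr (p - 2) * (e \<bullet> (x - y)) * v y powr (-q)) \<in> borel_measurable lborel" by measurable
      show "(\<lambda>y. (k (T i) y - k 0 y) / T i * v y powr (-q)) \<in> borel_measurable lborel" for i
        unfolding k_def by measurable
      show "AE y in lborel. (\<lambda>i. (k (T i) y - k 0 y) / T i * v y powr (-q)) \<longlonglongrightarrow> p * r powr (p - 2) * (e \<bullet> (x - y)) * v y powr (-q)"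
      proof (intro AE_I2 tendsto_mult_right)
        fix y
        from dk[of y] have "((\<lambda>t. (k t y - k 0 y) / t) \<longlongrightarrow> p * r powr (p - 2) * (e \<bullet> (x - y))) (at 0)"
          by (simp add: has_field_derivative_iff)
        from filterlim_compose[OF this filt] show "(\<lambda>i. (k (T i) y - k 0 y) / T i) \<longlonglongrightarrow> p * r powr (p - 2) * (e \<bullet> (x - y))" .
      qed
      fix i
      have t: "\<bar>T i\<bar> \<le> 1" "T i \<noteq> 0" using T0 by (auto simp: abs_le_iff)
      have "norm ((k (T i) y - k 0 y) / T i * v y powr (-q)) \<le> H y" for y
      proof -
        have "\<bar>k (T i) y - k 0 y\<bar> \<le> \<bar>T i\<bar> * B y"
          unfolding k0 B_def unfolding k_def by (rule line_quotient_bound[OF r e t(1)])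
        then have "\<bar>k (T i) y - k 0 y\<bar> / \<bar>T i\<bar> \<le> B y"
          using t(2) by (simp add: pos_divide_le_eq mult.commute)
        from mult_right_mono[OF this, of "v y powr (-q)"] show ?thesis
          unfolding H_def real_norm_def abs_mult abs_divide by simp
      qed
      then show "AE y in lborel. norm ((k (T i) y - k 0 y) / T i * v y powr (-q)) \<le> H y" by simp
    qed
    also have "(\<integral>y. p * r powr (p - 2) * (e \<bullet> (x - y)) * v y powr (-q) \<partial>lborel) = p * r powr (p - 2) * (neg_mass q v * (e \<bullet> (x - barycenter)))"
      by (simp add: mult.assoc inner_moment(2))
    finally show "(\<lambda>i. (u (x + T i *\<^sub>R e) - u x) / T i) \<longlonglongrightarrow> p * r powr (p - 2) * (neg_mass q v * (e \<bullet> (x - barycenter)))"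
      unfolding quot .
  qed
  moreover have "at 0 within {-1..1} = at (0::real)" by (rule at_within_interior) auto
  ultimately show ?thesis by (simp add: has_field_derivative_iff)
qed

text \<open>Along every unit direction \<open>e\<close>, the function \<open>W = (u/\<alpha>)\<^sup>2\<^sup>/\<^sup>p\<close> has the derivative \<open>2 (e \<bullet> (x - c))\<close>, which is that of
\<open>\<bar>x - c\<bar>\<^sup>2\<close>. Integrating from \<open>c\<close> to \<open>x\<close> gives the formula, with \<open>b\<^sup>2 = W c > 0\<close>.\<close>
theorem classification:
  "\<exists>a b c. a > 0 \<and> b > 0 \<and> (\<forall>x. u x = a * (b\<^sup>2 + (norm (x - c))\<^sup>2) powr (p / 2))"
proof -
  define \<alpha> where "\<alpha> = neg_mass q v"
  have \<alpha>: "\<alpha> > 0" using mass_v_pos by (simp add: \<alpha>_def)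
  define c where "c = barycenter"
  define W where "W x = (u x / \<alpha>) powr (2 / p)" for x
  have W_pos: "W x > 0" for x using u_pos[of x] \<alpha> by (simp add: W_def)
  have dW: "((\<lambda>t. W (x + t *\<^sub>R e)) has_real_derivative 2 * (e \<bullet> (x - c))) (at 0)" if e: "norm e = 1" for x e
  proof -
    obtain r where r: "r > 0" "\<And>z. z \<noteq> 0 \<Longrightarrow> u (x + z) = (norm z / r) powr p * u (x + inversion r z)"
      "u x = r powr p * neg_mass q v" using invariance_at[of x] by blast
    have ur: "u x / \<alpha> = r powr p" using r(3) \<alpha> by (simp add: \<alpha>_def)
    have "((\<lambda>t. u (x + t *\<^sub>R e) / \<alpha>) has_real_derivative p * r powr (p - 2) * (\<alpha> * (e \<bullet> (x - c))) / \<alpha>) (at 0)"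
      unfolding \<alpha>_def c_def by (rule DERIV_cdivide[OF u_line_derivative[OF r e]])
    from DERIV_powr[OF this _ DERIV_const[of "2 / p"]]
    have "((\<lambda>t. W (x + t *\<^sub>R e)) has_real_derivative
      (r powr p) powr (2 / p) * (p * r powr (p - 2) * (\<alpha> * (e \<bullet> (x - c))) / \<alpha> * (2 / p) / (r powr p))) (at 0)"
      using r(1) by (simp add: W_def ur)
    moreover have "(r powr p) powr (2 / p) * (p * r powr (p - 2) * (\<alpha> * (e \<bullet> (x - c))) / \<alpha> * (2 / p) / (r powr p)) = 2 * (e \<bullet> (x - c))"
    proof -
      have "(r powr p) powr (2 / p) = r\<^sup>2" using r(1) p_pos by (simp add: powr_powr powr_numeral)
      moreover have "r powr (p - 2) = r powr p / r\<^sup>2" using r(1) by (simp add: powr_diff powr_numeral)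
      ultimately show ?thesis using r(1) p_pos \<alpha> by (simp add: field_simps)
    qed
    ultimately show ?thesis by simp
  qed
  have W: "W x = W c + (norm (x - c))\<^sup>2" for x
  proof (cases "x = c")
    case False
    define e where "e = (x - c) /\<^sub>R norm (x - c)"
    have e: "norm e = 1" using False by (simp add: e_def)
    then have ee: "e \<bullet> e = 1" by (simp add: norm_eq_1)
    have "((\<lambda>t. W (c + t *\<^sub>R e) - t\<^sup>2) has_real_derivative 0) (at s)" for s
    proof -
      have "((\<lambda>t. W ((c + s *\<^sub>R e) + t *\<^sub>R e)) has_real_derivative 2 * (e \<bullet> ((c + s *\<^sub>R e) - c))) (at 0)"
        by (rule dW[OF e])
      then have "((\<lambda>t. W ((c + s *\<^sub>R e) + t *\<^sub>R e)) has_real_derivative 2 * s) (at (s + - s))"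
        using ee by simp
      then have "((\<lambda>t. W ((c + s *\<^sub>R e) + (t + - s) *\<^sub>R e)) has_real_derivative 2 * s) (at s)"
        by (subst (asm) DERIV_shift)
      moreover have "(\<lambda>t. W ((c + s *\<^sub>R e) + (t + - s) *\<^sub>R e)) = (\<lambda>t. W (c + t *\<^sub>R e))"
        by (simp add: algebra_simps)
      ultimately have "((\<lambda>t. W (c + t *\<^sub>R e)) has_real_derivative 2 * s) (at s)" by simp
      then show ?thesis by (auto intro!: derivative_eq_intros)
    qed
    from DERIV_isconst_all[OF allI[OF this], of "norm (x - c)" 0]
    have "W (c + norm (x - c) *\<^sub>R e) - (norm (x - c))\<^sup>2 = W c" by simp
    moreover have "c + norm (x - c) *\<^sub>R e = x" using False by (simp add: e_def)
    ultimately show ?thesis by simp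
  qed simp
  define b where "b = sqrt (W c)"
  have b: "b > 0" "b\<^sup>2 = W c" using W_pos[of c] by (auto simp: b_def)
  have "u x = \<alpha> * (b\<^sup>2 + (norm (x - c))\<^sup>2) powr (p / 2)" for x
  proof -
    have "(W x) powr (p / 2) = u x / \<alpha>" using p_pos u_pos[of x] \<alpha> by (simp add: W_def powr_powr)
    then show ?thesis using \<alpha> by (simp add: b W[of x, symmetric])
  qed
  then show ?thesis using \<alpha> b(1) by blast
qed

end

theorem theorem4:
  fixes u v :: "real ^ 'n \<Rightarrow> real" and p q :: real
  assumes p_pos: "p > 0" and q_pos: "q > 0"
    and u_meas: "u \<in> borel_measurable lebesgue"
    and v_meas: "v \<in> borel_measurable lebesgue"
    and u_nonneg: "\<And>x. u x \<ge> 0"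
    and v_nonneg: "\<And>x. v x \<ge> 0"
    and u_eq: "\<And>x. ennreal (u x) =
      (\<integral>\<^sup>+ y. ennreal (norm (x - y) powr p) * neg_power (v y) q \<partial>lebesgue)"
    and v_eq: "\<And>x. ennreal (v x) =
      (\<integral>\<^sup>+ y. ennreal (norm (x - y) powr p) * neg_power (u y) q \<partial>lebesgue)"
  shows "q = 1 + 2 * real CARD('n) / p \<and>
    (\<exists>a b :: real. \<exists>xbar :: real ^ 'n. a > 0 \<and> b > 0 \<and>
      (\<forall>x. u x = v x \<and> v x = a * (b\<^sup>2 + (norm (x - xbar))\<^sup>2) powr (p / 2)))"
proof -
  interpret neg_power_pair u v p q
    by (rule neg_power_pairI[OF p_pos q_pos u_meas v_meas u_nonneg v_nonneg u_eq v_eq])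
  have "q = 1 + 2 * real CARD('n) / p" using critical_exponent p_pos by (simp add: field_simps)
  moreover obtain a b c where "a > 0" "b > 0" "\<And>x. u x = a * (b\<^sup>2 + (norm (x - c))\<^sup>2) powr (p / 2)"
    using classification by blast
  ultimately show ?thesis using components_equal by metis
qed

end
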